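(* Every non-cyclic homomorphism $B_3\to B_4$ is, up to a transvection by a homomorphism $B_3\to Z(B_4)$ and post-composing by an automorphism of $B_4$, one of the following. \begin{enumerate} \item[(i)] An endomorphism of $B_3$, followed by the standard inclusion $B_3\hookrightarrow B_4$. \item[(ii)] The homomorphism given by $\alpha\mapsto g\beta_4g^{-1}$, $\beta\mapsto\alpha_4^2$, for some $g\in B_4$. \end{enumerate}
   Context: $B_n$ is the braid group on $n$ strands with Artin generators $\sigma_1,\dots,\sigma_{n-1}$ and center $Z(B_n)$. Put $\alpha_n=\sigma_1\cdots\sigma_{n-1}$ and $\beta_n=\alpha_n\sigma_1$ (so $\alpha_n^n=\beta_n^{n-1}$ generates $Z(B_n)$ for $n\ge 3$), and $\alpha=\alpha_3$, $\beta=\beta_3$, so $B_3=\langle\alpha,\beta\mid\alpha^3=\beta^2\rangle$. The standard inclusion $B_3\hookrightarrow B_4$ is $\sigma_i\mapsto\sigma_i$, $i=1,2$. A homomorphism is cyclic if its image is a cyclic group. The transvection of $\varphi\colon G\to H$ by a cyclic homomorphism $t$ from $G$ to the centralizer of $\varphi(G)$ in $H$ is $\varphi^t(g)=\varphi(g)t(g)$. *)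

theory Defs
  imports "HOL-Algebra.Elementary_Groups"
begin

text \<open>Words are lists of letters \<open>(x, b)\<close>: the letter \<open>(x, True)\<close> stands for the generator \<open>x\<close>
  and \<open>(x, False)\<close> for its inverse. A relation is a pair of words that are to become equal.\<close>

type_synonym 'a gword = "('a \<times> bool) list"

definition gwords :: "'a set \<Rightarrow> 'a gword set" where
  "gwords X = lists (X \<times> UNIV)"

inductive_set pres_rel :: "'a set \<Rightarrow> ('a gword \<times> 'a gword) set \<Rightarrow> ('a gword \<times> 'a gword) set"
  for X R where
  refl: "w \<in> gwords X \<Longrightarrow> (w, w) \<in> pres_rel X R"
| sym: "(v, w) \<in> pres_rel X R \<Longrightarrow> (w, v) \<in> pres_rel X R"
| trans: "(u, v) \<in> pres_rel X R \<Longrightarrow> (v, w) \<in> pres_rel X R \<Longrightarrow> (u, w) \<in> pres_rel X R"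
| cancel: "u \<in> gwords X \<Longrightarrow> v \<in> gwords X \<Longrightarrow> x \<in> X \<Longrightarrow>
    (u @ [(x, b), (x, \<not> b)] @ v, u @ v) \<in> pres_rel X R"
| relation: "u \<in> gwords X \<Longrightarrow> v \<in> gwords X \<Longrightarrow> (r, s) \<in> R \<Longrightarrow>
    r \<in> gwords X \<Longrightarrow> s \<in> gwords X \<Longrightarrow> (u @ r @ v, u @ s @ v) \<in> pres_rel X R"

definition presented_group ::
    "'a set \<Rightarrow> ('a gword \<times> 'a gword) set \<Rightarrow> 'a gword set monoid" where
  "presented_group X R =
    \<lparr>carrier = gwords X // pres_rel X R,
     mult = (\<lambda>A B. \<Union>a\<in>A. \<Union>b\<in>B. pres_rel X R `` {a @ b}),
     one = pres_rel X R `` {[]}\<rparr>"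

lemma gwords_append [simp]: "u @ v \<in> gwords X \<longleftrightarrow> u \<in> gwords X \<and> v \<in> gwords X"
  by (auto simp: gwords_def)

lemma gwords_Nil [simp]: "[] \<in> gwords X"
  by (simp add: gwords_def)

lemma gwords_Cons [simp]: "(x, b) # w \<in> gwords X \<longleftrightarrow> x \<in> X \<and> w \<in> gwords X"
  by (auto simp: gwords_def)

lemma pres_rel_gwords: "(u, v) \<in> pres_rel X R \<Longrightarrow> u \<in> gwords X \<and> v \<in> gwords X"
  by (induction rule: pres_rel.induct) auto

lemma equiv_pres_rel: "equiv (gwords X) (pres_rel X R)"
proof (rule equivI)
  show "pres_rel X R \<subseteq> gwords X \<times> gwords X"
    by (auto dest: pres_rel_gwords)
  show "refl_on (gwords X) (pres_rel X R)"
    by (rule refl_onI) (rule pres_rel.refl)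
  show "sym (pres_rel X R)"
    by (rule symI) (rule pres_rel.sym)
  show "trans (pres_rel X R)"
    by (rule transI) (rule pres_rel.trans)
qed

lemma pres_rel_append_right:
  "(u, v) \<in> pres_rel X R \<Longrightarrow> w \<in> gwords X \<Longrightarrow> (u @ w, v @ w) \<in> pres_rel X R"
proof (induction rule: pres_rel.induct)
  case (cancel u v x b)
  then show ?case using pres_rel.cancel[of u X "v @ w" x b R] by simp
next
  case (relation u v r s)
  then show ?case using pres_rel.relation[of u X "v @ w" r s R] by simp
next
  case (trans u v w')
  then show ?case by (blast intro: pres_rel.trans)
next
  case (sym v w')
  then show ?case by (blast intro: pres_rel.sym)
qed (simp add: pres_rel.refl)

lemma pres_rel_append_left:
  "(u, v) \<in> pres_rel X R \<Longrightarrow> w \<in> gwords X \<Longrightarrow> (w @ u, w @ v) \<in> pres_rel X R"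
proof (induction rule: pres_rel.induct)
  case (cancel u v x b)
  then show ?case using pres_rel.cancel[of "w @ u" X "v" x b R] by simp
next
  case (relation u v r s)
  then show ?case using pres_rel.relation[of "w @ u" X "v" r s R] by simp
next
  case (trans u v w')
  then show ?case by (blast intro: pres_rel.trans)
next
  case (sym v w')
  then show ?case by (blast intro: pres_rel.sym)
qed (simp add: pres_rel.refl)

lemma pres_rel_append:
  assumes "(u, u') \<in> pres_rel X R" "(v, v') \<in> pres_rel X R"
  shows "(u @ v, u' @ v') \<in> pres_rel X R"
proof (rule pres_rel.trans)
  show "(u @ v, u' @ v) \<in> pres_rel X R"
    using assms by (intro pres_rel_append_right) (auto dest: pres_rel_gwords)
  show "(u' @ v, u' @ v') \<in> pres_rel X R"
    using assms by (intro pres_rel_append_left) (auto dest: pres_rel_gwords)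
qed

lemma presented_group_mult:
  assumes "u \<in> gwords X" "v \<in> gwords X"
  shows "pres_rel X R `` {u} \<otimes>\<^bsub>presented_group X R\<^esub> pres_rel X R `` {v} = pres_rel X R `` {u @ v}"
proof -
  have eq: "pres_rel X R `` {a @ b} = pres_rel X R `` {u @ v}"
    if "a \<in> pres_rel X R `` {u}" "b \<in> pres_rel X R `` {v}" for a b
  proof -
    have "(u @ v, a @ b) \<in> pres_rel X R"
      using that by (intro pres_rel_append) simp_all
    from equiv_class_eq[OF equiv_pres_rel this] show ?thesis by (rule HOL.sym)
  qed
  have mem: "u \<in> pres_rel X R `` {u}" "v \<in> pres_rel X R `` {v}"
    using assms by (simp_all add: pres_rel.refl)
  have "(\<Union>a\<in>pres_rel X R `` {u}. \<Union>b\<in>pres_rel X R `` {v}. pres_rel X R `` {a @ b})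
      = (\<Union>a\<in>pres_rel X R `` {u}. \<Union>b\<in>pres_rel X R `` {v}. pres_rel X R `` {u @ v})"
    by (intro SUP_cong HOL.refl eq)
  also have "\<dots> = pres_rel X R `` {u @ v}"
    using mem by blast
  finally show ?thesis
    by (simp add: presented_group_def)
qed

lemma presented_group_cases:
  assumes "A \<in> carrier (presented_group X R)"
  obtains w where "w \<in> gwords X" "A = pres_rel X R `` {w}"
  using assms by (auto simp: presented_group_def elim: quotientE)

lemma presented_group_carrierI:
  "w \<in> gwords X \<Longrightarrow> pres_rel X R `` {w} \<in> carrier (presented_group X R)"
  by (auto simp: presented_group_def intro: quotientI)

lemma presented_group_one: "\<one>\<^bsub>presented_group X R\<^esub> = pres_rel X R `` {[]}"
  by (simp add: presented_group_def)

lemma pres_rel_inverse: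
  "w \<in> gwords X \<Longrightarrow> (rev (map (\<lambda>(x, b). (x, \<not> b)) w) @ w, []) \<in> pres_rel X R \<and>
     rev (map (\<lambda>(x, b). (x, \<not> b)) w) \<in> gwords X"
proof (induction w)
  case Nil
  then show ?case by (auto intro: pres_rel.refl)
next
  case (Cons a w)
  obtain x b where a: "a = (x, b)" by (cases a)
  let ?w = "rev (map (\<lambda>(x, b). (x, \<not> b)) w)"
  have w: "x \<in> X" "w \<in> gwords X" "?w \<in> gwords X" "(?w @ w, []) \<in> pres_rel X R"
    using Cons a by auto
  have "(?w @ [(x, \<not> b), (x, \<not> \<not> b)] @ w, ?w @ w) \<in> pres_rel X R"
    using w by (intro pres_rel.cancel) auto
  then have "(?w @ [(x, \<not> b), (x, b)] @ w, []) \<in> pres_rel X R"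
    using pres_rel.trans[OF _ w(4)] by simp
  then show ?case using w a by simp
qed

lemma group_presented_group: "group (presented_group X R)"
proof (rule groupI)
  fix A B assume "A \<in> carrier (presented_group X R)" "B \<in> carrier (presented_group X R)"
  then show "A \<otimes>\<^bsub>presented_group X R\<^esub> B \<in> carrier (presented_group X R)"
    by (elim presented_group_cases) (simp add: presented_group_mult presented_group_carrierI)
next
  show "\<one>\<^bsub>presented_group X R\<^esub> \<in> carrier (presented_group X R)"
    by (simp add: presented_group_one presented_group_carrierI)
next
  fix A B C
  assume "A \<in> carrier (presented_group X R)" "B \<in> carrier (presented_group X R)"
    "C \<in> carrier (presented_group X R)"
  then show "A \<otimes>\<^bsub>presented_group X R\<^esub> B \<otimes>\<^bsub>presented_group X R\<^esub> C =
      A \<otimes>\<^bsub>presented_group X R\<^esub> (B \<otimes>\<^bsub>presented_group X R\<^esub> C)"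
    by (elim presented_group_cases) (simp add: presented_group_mult)
next
  fix A assume A: "A \<in> carrier (presented_group X R)"
  then show "\<one>\<^bsub>presented_group X R\<^esub> \<otimes>\<^bsub>presented_group X R\<^esub> A = A"
    by (elim presented_group_cases) (simp add: presented_group_mult presented_group_one)
  from A obtain w where w: "w \<in> gwords X" "A = pres_rel X R `` {w}"
    by (rule presented_group_cases)
  note inv = pres_rel_inverse[OF w(1), of R]
  show "\<exists>B\<in>carrier (presented_group X R). B \<otimes>\<^bsub>presented_group X R\<^esub> A = \<one>\<^bsub>presented_group X R\<^esub>"
  proof
    show "pres_rel X R `` {rev (map (\<lambda>(x, b). (x, \<not> b)) w)} \<otimes>\<^bsub>presented_group X R\<^esub> A
        = \<one>\<^bsub>presented_group X R\<^esub>"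
      using inv w equiv_class_eq[OF equiv_pres_rel conjunct1[OF inv]]
      by (simp add: presented_group_mult presented_group_one)
    show "pres_rel X R `` {rev (map (\<lambda>(x, b). (x, \<not> b)) w)} \<in> carrier (presented_group X R)"
      using inv by (intro presented_group_carrierI) simp
  qed
qed

definition braid_relations :: "nat \<Rightarrow> (nat gword \<times> nat gword) set" where
  "braid_relations n =
    {([(i, True), (j, True)], [(j, True), (i, True)]) | i j.
       i \<in> {1..<n} \<and> j \<in> {1..<n} \<and> i + 2 \<le> j} \<union>
    {([(i, True), (Suc i, True), (i, True)], [(Suc i, True), (i, True), (Suc i, True)]) | i.
       i \<in> {1..<n} \<and> Suc i \<in> {1..<n}}"

abbreviation braid_eq :: "nat \<Rightarrow> (nat gword \<times> nat gword) set" where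
  "braid_eq n \<equiv> pres_rel {1..<n} (braid_relations n)"

definition braid_group :: "nat \<Rightarrow> nat gword set monoid" where
  "braid_group n = presented_group {1..<n} (braid_relations n)"

definition braid_gen :: "nat \<Rightarrow> nat \<Rightarrow> nat gword set" where
  "braid_gen n i = braid_eq n `` {[(i, True)]}"

definition braid_alpha :: "nat \<Rightarrow> nat gword set" where
  "braid_alpha n = foldr (mult (braid_group n)) (map (braid_gen n) [1..<n]) \<one>\<^bsub>braid_group n\<^esub>"

definition braid_beta :: "nat \<Rightarrow> nat gword set" where
  "braid_beta n = braid_alpha n \<otimes>\<^bsub>braid_group n\<^esub> braid_gen n 1"

text \<open>Read a word representing an \<open>m\<close>-strand braid as a word in the generators for \<open>n \<ge> m\<close>
  strands.\<close>

definition braid_inclusion :: "nat \<Rightarrow> nat \<Rightarrow> nat gword set \<Rightarrow> nat gword set" where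
  "braid_inclusion m n A = braid_eq n `` A"

lemma group_braid_group: "group (braid_group n)"
  by (simp add: braid_group_def group_presented_group)

lemma braid_gen_closed: "i \<in> {1..<n} \<Longrightarrow> braid_gen n i \<in> carrier (braid_group n)"
  by (simp add: braid_gen_def braid_group_def presented_group_carrierI)

lemma braid_gen_commute:
  assumes "i \<in> {1..<n}" "j \<in> {1..<n}" "i + 2 \<le> j"
  shows "braid_gen n i \<otimes>\<^bsub>braid_group n\<^esub> braid_gen n j =
         braid_gen n j \<otimes>\<^bsub>braid_group n\<^esub> braid_gen n i"
proof -
  have "([(i, True), (j, True)], [(j, True), (i, True)]) \<in> braid_relations n"
    using assms by (auto simp: braid_relations_def)
  from pres_rel.relation[OF _ _ this, of "[]" "{1..<n}" "[]"] assms show ?thesis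
    by (simp add: braid_gen_def braid_group_def presented_group_mult
        equiv_class_eq[OF equiv_pres_rel])
qed

lemma braid_gen_braid:
  assumes "i \<in> {1..<n}" "Suc i \<in> {1..<n}"
  shows "braid_gen n i \<otimes>\<^bsub>braid_group n\<^esub> braid_gen n (Suc i) \<otimes>\<^bsub>braid_group n\<^esub> braid_gen n i =
         braid_gen n (Suc i) \<otimes>\<^bsub>braid_group n\<^esub> braid_gen n i \<otimes>\<^bsub>braid_group n\<^esub> braid_gen n (Suc i)"
proof -
  have "([(i, True), (Suc i, True), (i, True)], [(Suc i, True), (i, True), (Suc i, True)])
      \<in> braid_relations n"
    using assms by (auto simp: braid_relations_def)
  from pres_rel.relation[OF _ _ this, of "[]" "{1..<n}" "[]"] assms show ?thesis
    by (simp add: braid_gen_def braid_group_def presented_group_mult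
        equiv_class_eq[OF equiv_pres_rel])
qed

lemma braid_eq_mono:
  assumes "(u, v) \<in> braid_eq m" "m \<le> n"
  shows "(u, v) \<in> braid_eq n"
proof -
  have words: "w \<in> gwords {1..<n}" if "w \<in> gwords {1..<m}" for w
    using that \<open>m \<le> n\<close> by (auto simp: gwords_def)
  have rels: "p \<in> braid_relations n" if "p \<in> braid_relations m" for p
    using that \<open>m \<le> n\<close> unfolding braid_relations_def by fastforce
  show ?thesis
    using assms(1)
  proof (induction rule: pres_rel.induct)
    case (cancel u v x b)
    then show ?case using words \<open>m \<le> n\<close> by (intro pres_rel.cancel) auto
  next
    case (relation u v r s)
    then show ?case using words rels by (intro pres_rel.relation) auto
  next
    case (trans u v w)
    then show ?case by (blast intro: pres_rel.trans)
  next
    case (sym v w)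
    then show ?case by (blast intro: pres_rel.sym)
  next
    case (refl w)
    then show ?case using words by (blast intro: pres_rel.refl)
  qed
qed

lemma braid_inclusion_class:
  assumes "m \<le> n" "w \<in> gwords {1..<m}"
  shows "braid_inclusion m n (braid_eq m `` {w}) = braid_eq n `` {w}"
proof -
  have refl: "(w, w) \<in> braid_eq m" using assms by (intro pres_rel.refl)
  have "(w, u) \<in> braid_eq n" if "(w, v) \<in> braid_eq m" "(v, u) \<in> braid_eq n" for u v
    using braid_eq_mono[OF that(1) \<open>m \<le> n\<close>] that(2) by (rule pres_rel.trans)
  with refl show ?thesis
    unfolding braid_inclusion_def by blast
qed

lemma braid_inclusion_gen:
  assumes "m \<le> n" "i \<in> {1..<m}"
  shows "braid_inclusion m n (braid_gen m i) = braid_gen n i"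
  using assms by (simp add: braid_gen_def braid_inclusion_class del: One_nat_def)

lemma braid_inclusion_hom:
  assumes "m \<le> n"
  shows "braid_inclusion m n \<in> hom (braid_group m) (braid_group n)"
proof (rule homI)
  have words: "w \<in> gwords {1..<n}" if "w \<in> gwords {1..<m}" for w
    using that \<open>m \<le> n\<close> by (auto simp: gwords_def)
  fix A assume A: "A \<in> carrier (braid_group m)"
  then show "braid_inclusion m n A \<in> carrier (braid_group n)"
    unfolding braid_group_def using assms words
    by (elim presented_group_cases) (simp add: braid_inclusion_class presented_group_carrierI del: One_nat_def)
  fix B assume "B \<in> carrier (braid_group m)"
  with A show "braid_inclusion m n (A \<otimes>\<^bsub>braid_group m\<^esub> B) =
      braid_inclusion m n A \<otimes>\<^bsub>braid_group n\<^esub> braid_inclusion m n B"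
    unfolding braid_group_def using assms words
    by (elim presented_group_cases) (simp add: braid_inclusion_class presented_group_mult del: One_nat_def)
qed

definition center :: "('a, 'b) monoid_scheme \<Rightarrow> 'a set" where
  "center G = {z \<in> carrier G. \<forall>g\<in>carrier G. z \<otimes>\<^bsub>G\<^esub> g = g \<otimes>\<^bsub>G\<^esub> z}"

definition cyclic_hom ::
    "('a, 'c) monoid_scheme \<Rightarrow> ('b, 'd) monoid_scheme \<Rightarrow> ('a \<Rightarrow> 'b) \<Rightarrow> bool" where
  "cyclic_hom G H \<phi> \<longleftrightarrow> \<phi> \<in> hom G H \<and> cyclic_group (H\<lparr>carrier := \<phi> ` carrier G\<rparr>)"

definition transvection ::
    "('b, 'd) monoid_scheme \<Rightarrow> ('a \<Rightarrow> 'b) \<Rightarrow> ('a \<Rightarrow> 'b) \<Rightarrow> 'a \<Rightarrow> 'b" where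
  "transvection H \<phi> t = (\<lambda>g. \<phi> g \<otimes>\<^bsub>H\<^esub> t g)"

end

theory Submission
  imports Defs Complex_Main
begin

text \<open>
  Let \<open>W\<close> be the free product of three groups of order two. The group \<open>B\<^sub>4\<close> acts on \<open>W\<close> with kernel
  its center, the inner automorphisms of \<open>W\<close> are realized by conjugates of \<open>\<alpha>\<^sub>4\<^sup>2\<close>, and the
  quotient is \<open>PSL\<^sub>2(\<int>)\<close>. A homomorphism \<open>\<phi>\<close> is a pair \<open>X = \<phi>(\<alpha>)\<close>, \<open>Y = \<phi>(\<beta>)\<close> with
  \<open>X\<^sup>3 = Y\<^sup>2\<close>; put \<open>S = X\<^sup>-\<^sup>1 Y = \<phi>(\<sigma>\<^sub>1)\<close>.

  Suppose that the images of \<open>X\<close> and \<open>Y\<close> in \<open>SL\<^sub>2(\<int>)\<close> commute. Then \<open>\<phi>(\<sigma>\<^sub>2 \<sigma>\<^sub>1\<^sup>-\<^sup>1)\<close> acts as an inner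
  automorphism given by some \<open>u\<close> of even length with \<open>\<theta>(u) = u \<theta>\<^sup>2(u)\<close>, where \<open>\<theta>\<close> is the action of \<open>S\<close>.
  If the trace of \<open>S\<close> is at least 2 in absolute value, then the leading Magnus coefficient of \<open>u\<close> is an
  eigenvector with a real eigenvalue \<open>d = 1 + d\<^sup>2\<close>, so \<open>u = 1\<close> and \<open>\<phi>\<close> is cyclic. For the traces 0
  and \<open>-1\<close> uniqueness of roots in \<open>W\<close> makes \<open>X\<close> and \<open>Y\<close> commute. For the trace 1 the same holds unless
  \<open>Y\<close> is an involution modulo the center; then \<open>Y\<close> is conjugate to \<open>\<alpha>\<^sub>4\<^sup>2\<close> and \<open>X\<close> to \<open>\<beta>\<^sub>4\<close> or its
  inverse, modulo the center.

  If the matrices do not commute, then \<open>X\<^sup>3 = Y\<^sup>2\<close> acts as an inner automorphism given by a word of odd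
  length, whose conjugacy class is preserved by a rotation about a vertex and by an inversion of an edge
  of the trivalent tree of \<open>PSL\<^sub>2(\<int>)\<close>. Convexity of the cyclic length along the path joining them forces
  the class to be that of a power of \<open>\<delta> = s\<^sub>2 s\<^sub>1 s\<^sub>3\<close>. So after a conjugation \<open>X\<close> and \<open>Y\<close> fix \<open>\<delta>\<close>,
  and the stabilizer of \<open>\<delta>\<close> is the product of \<open>B\<^sub>3\<close> and the center of \<open>B\<^sub>4\<close>.
\<close>

section \<open>Reduced words\<close>

text \<open>The obstacle is that B_4 is given only by a presentation, so nothing can be computed in
  it directly. Identities are checked in W, hence up to the center, and are then made exact by the
  exponent sum, which every nontrivial power of the central generator changes. That the action has
  no larger kernel is read off the quotient: modulo the lifts of inner automorphisms an element is
  an alternating product of alpha_4 and powers of beta_4, and the matrices of alpha_4 beta_4 and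
  alpha_4 beta_4^2 are, up to sign, the two nonnegative elementary matrices, whose nonempty products
  are never the identity.

  Roots in W are unique except that 0 has every involution as a square root. This single failure is
  what leaves room for family (ii): there the two images are periodic modulo the center, and nothing
  ties their conjugators together.

  The transvection comes from the center as well. Since alpha_3 and beta_3 have exponent sums 2 and
  3, the central factors compatible with alpha^3 = beta^2 are exactly those of a homomorphism that
  factors through the exponent sum.\<close>

primrec push :: "'a \<Rightarrow> 'a list \<Rightarrow> 'a list" where
  "push l [] = [l]"
| "push l (m # w) = (if l = m then w else l # m # w)"

lemma distinct_adj_push: "distinct_adj w \<Longrightarrow> distinct_adj (push l w)"
  by (cases w) (auto simp: distinct_adj_Cons)

lemma push_push: "distinct_adj w \<Longrightarrow> push l (push l w) = w"
  by (cases w; cases "tl w") (auto simp: distinct_adj_Cons)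

lemma distinct_adj_foldr_push: "distinct_adj v \<Longrightarrow> distinct_adj (foldr push u v)"
  by (induction u) (auto intro: distinct_adj_push)

text \<open>This is what makes the product associative: a letter that cancels in the left factor
  also cancels after multiplication, because pushing it twice does nothing
  (\<open>push_push\<close>).\<close>

lemma foldr_push_push:
  "distinct_adj v \<Longrightarrow> foldr push (push l u) v = push l (foldr push u v)"
  by (cases u) (auto simp: push_push distinct_adj_foldr_push)

lemma foldr_push_foldr_push:
  "distinct_adj w \<Longrightarrow> foldr push (foldr push u v) w = foldr push u (foldr push v w)"
  by (induction u) (auto simp: foldr_push_push)

lemma foldr_push_append: "distinct_adj (u @ v) \<Longrightarrow> foldr push u v = u @ v"
proof (induction u)
  case (Cons l u)
  then show ?case by (cases "u @ v") (auto simp: distinct_adj_Cons)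
qed simp

lemma foldr_push_rev: "distinct_adj v \<Longrightarrow> foldr push (rev u) (foldr push u v) = v"
  by (induction u arbitrary: v) (simp_all add: push_push distinct_adj_foldr_push)

text \<open>The free product of copies of \<open>\<int>/2\<close> indexed by a type, as reduced words. It is written
  additively, although not commutative, to make the class \<open>group_add\<close> available.\<close>

typedef 'a ucox = "{w::'a list. distinct_adj w}" morphisms word Abs_ucox
  by (rule exI[of _ "[]"]) simp

setup_lifting type_definition_ucox

lemma distinct_adj_word [simp]: "distinct_adj (word u)"
  using word by blast

instantiation ucox :: (type) group_add
begin
lift_definition zero_ucox :: "'a ucox" is "[]" by simp
lift_definition plus_ucox :: "'a ucox \<Rightarrow> 'a ucox \<Rightarrow> 'a ucox" is "foldr push"
  by (rule distinct_adj_foldr_push)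
lift_definition uminus_ucox :: "'a ucox \<Rightarrow> 'a ucox" is rev by simp
definition minus_ucox :: "'a ucox \<Rightarrow> 'a ucox \<Rightarrow> 'a ucox" where "minus_ucox u v = u + - v"
instance
proof
  fix u v w :: "'a ucox"
  show "u + v + w = u + (v + w)"
    by transfer (rule foldr_push_foldr_push)
  show "0 + u = u"
    by transfer simp
  show "u + 0 = u"
    by transfer (use foldr_push_append[of _ "[]"] in simp)
  show "- u + u = 0"
    by transfer (metis append_Nil2 distinct_adj_Nil foldr_push_append foldr_push_rev)
  show "u + - v = u - v"
    by (simp add: minus_ucox_def)
qed
end

lift_definition gen :: "'a \<Rightarrow> 'a ucox" is "\<lambda>l. [l]" by simp

lemma word_zero [simp]: "word 0 = []"
  by (fact zero_ucox.rep_eq)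

lemma word_gen [simp]: "word (gen l) = [l]"
  by (fact gen.rep_eq)

lemma word_uminus [simp]: "word (- u) = rev (word u)"
  by (fact uminus_ucox.rep_eq)

lemma word_gen_add: "word (gen l + u) = push l (word u)"
  by (simp add: plus_ucox.rep_eq)

lemma word_add: "distinct_adj (word u @ word v) \<Longrightarrow> word (u + v) = word u @ word v"
  by (simp add: plus_ucox.rep_eq foldr_push_append)

lemma word_eq_Nil_iff [simp]: "word u = [] \<longleftrightarrow> u = 0"
  using word_inject[of u 0] by simp

lemma uminus_gen [simp]: "- gen l = gen l"
  by transfer simp

lemma gen_add_gen [simp]: "gen l + gen l = 0"
  by transfer simp

lemma gen_add_gen_add [simp]: "gen l + (gen l + u) = u"
  by (simp flip: add.assoc)

definition elt :: "'a list \<Rightarrow> 'a ucox" where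
  "elt w = sum_list (map gen w)"

lemma elt_simps [simp]:
  "elt [] = 0" "elt (l # w) = gen l + elt w" "elt (v @ w) = elt v + elt w"
  by (simp_all add: elt_def)

lemma elt_rev: "elt (rev w) = - elt w"
  by (induction w) (simp_all add: minus_add)

lemma push_eq_Cons: "w = [] \<or> l \<noteq> hd w \<Longrightarrow> push l w = l # w"
  by (cases w) auto

lemma word_elt: "distinct_adj w \<Longrightarrow> word (elt w) = w"
  by (induction w) (auto simp: word_gen_add distinct_adj_Cons push_eq_Cons)

lemma elt_word [simp]: "elt (word u) = u"
  by (simp add: word_elt flip: word_inject)

lemma ucox_induct [case_names zero gen_add]:
  assumes "P 0" "\<And>l u. word (gen l + u) = l # word u \<Longrightarrow> P u \<Longrightarrow> P (gen l + u)"
  shows "P u"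
proof -
  have "P (elt w)" if "distinct_adj w" for w
    using that
  proof (induction w)
    case (Cons l w)
    moreover have "word (gen l + elt w) = l # word (elt w)"
      using word_elt[OF Cons.prems] distinct_adj_ConsD[OF Cons.prems] by (simp add: word_elt)
    ultimately show ?case using assms(2)[of l "elt w"] distinct_adj_ConsD[OF Cons.prems] by (simp add: word_elt)
  qed (simp add: assms)
  from this[of "word u"] show ?thesis by simp
qed

section \<open>Homomorphisms and inner automorphisms of the free product\<close>

definition add_hom :: "('a::group_add \<Rightarrow> 'b::group_add) \<Rightarrow> bool" where
  "add_hom f \<longleftrightarrow> (\<forall>u v. f (u + v) = f u + f v)"

lemma add_hom_add: "add_hom f \<Longrightarrow> f (u + v) = f u + f v"
  by (simp add: add_hom_def)

lemma add_hom_zero: "add_hom f \<Longrightarrow> f 0 = 0"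
  using add_hom_add[of f 0 0] by (metis add.right_neutral add_left_cancel)

lemma add_hom_uminus: "add_hom f \<Longrightarrow> f (- u) = - f u"
  using add_hom_add[of f "-u" u] by (simp add: add_hom_zero eq_neg_iff_add_eq_0)

lemma add_hom_comp: "add_hom f \<Longrightarrow> add_hom g \<Longrightarrow> add_hom (f \<circ> g)"
  by (simp add: add_hom_def)

lemma add_hom_id: "add_hom id" "add_hom (\<lambda>x. x)"
  by (simp_all add: add_hom_def)

lemma add_hom_eqI:
  assumes "add_hom f" "add_hom g" "\<And>l. f (gen l) = g (gen l)"
  shows "f = g"
proof
  fix u show "f u = g u"
    by (induction u rule: ucox_induct) (simp_all add: assms add_hom_zero add_hom_add)
qed

definition hom_ext :: "('a \<Rightarrow> 'b::group_add) \<Rightarrow> 'a ucox \<Rightarrow> 'b" where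
  "hom_ext f u = sum_list (map f (word u))"

lemma hom_ext_gen [simp]: "hom_ext f (gen l) = f l"
  by (simp add: hom_ext_def)

text \<open>Universal property of the free product of groups of order two: letters cancel only in
  \<open>push\<close>, and there the hypothesis on \<open>f\<close> applies.\<close>

lemma add_hom_hom_ext:
  assumes "\<And>l. f l + f l = 0"
  shows "add_hom (hom_ext f)"
proof -
  have push: "sum_list (map f (push l w)) = f l + sum_list (map f w)" for l w
    by (cases w) (auto simp: assms simp flip: add.assoc)
  have "sum_list (map f (foldr push u v)) = sum_list (map f u) + sum_list (map f v)" for u v
    by (induction u) (simp_all add: push add.assoc)
  then show ?thesis
    by (simp add: add_hom_def hom_ext_def plus_ucox.rep_eq)
qed

definition inn :: "'a::group_add \<Rightarrow> 'a \<Rightarrow> 'a" where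
  "inn u v = u + v + - u"

lemma add_hom_inn: "add_hom (inn u)"
  by (simp add: add_hom_def inn_def add.assoc del: add_uminus_conv_diff)

lemma inn_inn: "inn u (inn v w) = inn (u + v) w"
  by (simp add: inn_def add.assoc minus_add del: add_uminus_conv_diff)

lemma inn_zero [simp]: "inn 0 v = v"
  by (simp add: inn_def)

lemma inn_uminus_inn [simp]: "inn (- u) (inn u v) = v" "inn u (inn (- u) v) = v"
  by (simp_all add: inn_inn)

lemma add_hom_apply_inn: "add_hom f \<Longrightarrow> f (inn u v) = inn (f u) (f v)"
  by (simp add: inn_def add_hom_add add_hom_uminus del: add_uminus_conv_diff)

lemma inn_eq_self_iff: "inn u v = v \<longleftrightarrow> u + v = v + u"
  by (simp add: inn_def diff_eq_eq)

text \<open>Among three letters one differs from both ends of a nonempty word; multiplying by it on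
  either side causes no cancellation, and the two products have different first letters.\<close>

lemma gen_commute_imp_zero:
  fixes u :: "'a ucox"
  assumes comm: "\<And>l. gen l + u = u + gen l" and "\<And>x y :: 'a. \<exists>z. z \<noteq> x \<and> z \<noteq> y"
  shows "u = 0"
proof (rule ccontr)
  assume "u \<noteq> 0"
  then have ne: "word u \<noteq> []" by simp
  obtain l where l: "l \<noteq> hd (word u)" "l \<noteq> last (word u)" using assms(2) by blast
  have "word (gen l + u) = l # word u"
    using ne l(1) by (cases "word u") (simp_all add: word_gen_add)
  moreover have "word (u + gen l) = word u @ [l]"
    using l(2) by (simp add: word_add distinct_adj_append_iff)
  ultimately have "l # word u = word u @ [l]" using comm[of l] by simp
  then show False using l(1) ne by (metis hd_append2 list.sel(1))
qed

lemma inn_eq_iff: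
  fixes u v :: "'a ucox"
  assumes "\<And>x y :: 'a. \<exists>z. z \<noteq> x \<and> z \<noteq> y"
  shows "inn u = inn v \<longleftrightarrow> u = v"
proof
  assume eq: "inn u = inn v"
  have "inn (- v + u) w = w" for w
    using eq by (simp flip: inn_inn)
  then have "- v + u + w = w + (- v + u)" for w
    by (simp add: inn_eq_self_iff)
  then have "- v + u = 0"
    using assms by (intro gen_commute_imp_zero) simp_all
  then show "u = v" by (metis add.inverse_inverse eq_neg_iff_add_eq_0 neg_eq_iff_add_eq_0)
qed simp

section \<open>Cyclic reduction and conjugacy\<close>

definition cyc_red :: "'a list \<Rightarrow> bool" where
  "cyc_red w \<longleftrightarrow> w \<noteq> [] \<and> distinct_adj w \<and> (length w = 1 \<or> hd w \<noteq> last w)"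

lemma reduced_core:
  assumes "distinct_adj w" "w \<noteq> []"
  shows "\<exists>g x. w = g @ x @ rev g \<and> cyc_red x"
  using assms
proof (induction w rule: length_induct)
  case (1 w)
  show ?case
  proof (cases "cyc_red w")
    case True
    then show ?thesis by (intro exI[of _ "[]"] exI[of _ w]) simp
  next
    case False
    then have w: "length w \<noteq> 1" "hd w = last w" using 1 by (auto simp: cyc_red_def)
    obtain l v where v: "w = l # v" "v \<noteq> []" using w 1 by (cases w) auto
    then have vl: "v = butlast v @ [l]" using w by (metis append_butlast_last_id last_ConsR list.sel(1))
    have "distinct_adj (butlast v)" using 1 v vl distinct_adj_appendD1 distinct_adj_ConsD by metis
    moreover have "butlast v \<noteq> []" using 1 v vl by (metis append_Nil distinct_adj_Cons_Cons)
    ultimately obtain g x where "butlast v = g @ x @ rev g" "cyc_red x"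
      using 1 v by (metis length_butlast length_Cons less_Suc_eq_le diff_le_self)
    then show ?thesis using v vl by (intro exI[of _ "l # g"] exI[of _ x]) auto
  qed
qed

text \<open>Read from the outside inwards: a core of more than one letter has distinct ends, so no
  layer of the other conjugator can belong to it.\<close>

lemma core_unique:
  assumes "g @ x @ rev g = h @ y @ rev h" "cyc_red x" "cyc_red y"
  shows "g = h \<and> x = y"
  using assms
proof (induction g arbitrary: h)
  case Nil
  show ?case
  proof (cases h)
    case (Cons l h')
    then have "hd x = last x" "length x \<noteq> 1" using Nil by auto
    then show ?thesis using Nil by (auto simp: cyc_red_def)
  qed (use Nil in auto)
next
  case (Cons l g)
  show ?case
  proof (cases h)
    case Nil
    then have "y = l # (g @ x @ rev g) @ [l]" using Cons.prems by simp
    then have "hd y = last y" "length y \<noteq> 1" by (simp_all)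
    then show ?thesis using Cons by (auto simp: cyc_red_def)
  next
    case (Cons m h')
    then have "l = m" "g @ x @ rev g = h' @ y @ rev h'" using Cons.prems by auto
    then show ?thesis using Cons Cons.IH[of h'] Cons.prems by auto
  qed
qed

text \<open>Induction on the conjugator. Its last letter either meets an equal letter at one end of
  \<open>x\<close>, and then conjugation by it only rotates \<open>x\<close>, or nothing cancels at
  all; in the latter case the conjugate has equal ends and cannot be cyclically reduced.\<close>

lemma conj_cyc_red:
  assumes "cyc_red x" "cyc_red y" "elt y = inn g (elt x)"
  shows "\<exists>k. y = rotate k x"
  using assms
proof (induction "length (word g)" arbitrary: g x rule: less_induct)
  case less
  have x: "x \<noteq> []" "distinct_adj x" and y: "y \<noteq> []" "distinct_adj y"
    using less.prems by (auto simp: cyc_red_def)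
  have wx: "word (elt x) = x" "word (elt y) = y"
    using x y by (simp_all add: word_elt)
  show ?case
  proof (cases "word g = []")
    case True
    then have "elt x = elt y" using less.prems by simp
    then have "x = y" using wx by metis
    then show ?thesis by (metis rotate0 id_apply)
  next
    case False
    define s where "s = last (word g)"
    define h where "h = elt (butlast (word g))"
    have dh: "distinct_adj (butlast (word g))" using distinct_adj_word[of g] False
      by (metis append_butlast_last_id distinct_adj_appendD1)
    then have lh: "length (word h) < length (word g)"
      using False by (simp add: h_def word_elt)
    have "elt (butlast (word g) @ [last (word g)]) = g" using False by simp
    then have g: "g = h + gen s"
      unfolding h_def s_def by simp
    have eq: "elt y = inn h (inn (gen s) (elt x))" using less.prems g by (simp add: inn_inn)
    consider "length x = 1" "hd x = s" | "length x \<noteq> 1" "hd x = s" | "length x \<noteq> 1" "last x = s"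
      | "hd x \<noteq> s" "last x \<noteq> s"
      by (metis One_nat_def x(1) last_ConsL length_0_conv length_Suc_conv list.sel(1))
    then show ?thesis
    proof cases
      case 1
      then have "x = [s]" by (cases x) auto
      then have "inn (gen s) (elt x) = elt x" by (simp add: inn_def)
      then show ?thesis using less eq lh by metis
    next
      case 2
      then obtain v where v: "x = s # v" "v \<noteq> []" using x by (cases x) auto
      have "cyc_red (rotate1 x)"
        using less.prems(1) v by (auto simp: cyc_red_def distinct_adj_append_iff distinct_adj_Cons)
      moreover have "inn (gen s) (elt x) = elt (rotate1 x)"
        using v by (simp add: inn_def add.assoc del: add_uminus_conv_diff)
      ultimately obtain k where "y = rotate k (rotate1 x)" using less eq lh by metis
      then show ?thesis by (metis rotate_Suc rotate1_rotate_swap)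
    next
      case 3
      define v where "v = s # butlast x"
      have xv: "x = butlast x @ [s]" using x 3 by (metis append_butlast_last_id)
      have bx: "butlast x \<noteq> []" using 3 xv x by (metis append_Nil length_Cons list.size(3) One_nat_def)
      have rot: "rotate1 v = x" using xv by (simp add: v_def)
      have "hd x = hd (butlast x)" using xv bx by (metis hd_append2)
      moreover have "last (butlast x) \<noteq> s" using xv bx x by (metis distinct_adj_append_iff list.sel(1) not_Cons_self2)
      moreover have "hd x \<noteq> s" using less.prems(1) 3 by (auto simp: cyc_red_def)
      ultimately have "cyc_red v"
        using x bx xv by (auto simp: cyc_red_def v_def distinct_adj_Cons) (metis distinct_adj_appendD1)
      moreover have "inn (gen s) (elt x) = elt v"
      proof -
        have "elt x = elt (butlast x) + gen s" by (subst xv) simp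
        then show ?thesis by (simp add: inn_def add.assoc v_def del: add_uminus_conv_diff)
      qed
      ultimately obtain k where "y = rotate k v" using less eq lh by metis
      \<comment> \<open>\<open>v\<close> is \<open>x\<close> rotated backwards by one letter,
        written as a forward rotation.\<close>
      moreover have "v = rotate (length x - 1) x"
      proof -
        have "rotate (length x - 1) x = rotate (length x - 1) (rotate1 v)" using rot by simp
        also have "\<dots> = rotate (Suc (length x - 1)) v" by (metis rotate1_rotate_swap rotate_Suc)
        also have "Suc (length x - 1) = length v" using x by (simp add: v_def)
        finally show ?thesis by simp
      qed
      ultimately show ?thesis using rotate_rotate by metis
    next
      case 4
      have hx: "hd (x @ [s] @ rev (butlast (word g))) = hd x" using x by simp
      have gw: "word g = butlast (word g) @ [s]" using False s_def by simp
      then have dr: "distinct_adj (s # rev (butlast (word g)))"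
        by (metis distinct_adj_rev distinct_adj_word rev.simps(2) rev_rev_ident)
      have dd: "distinct_adj (word g @ x @ rev (word g))"
      proof -
        have "last (word g) = s" "hd (rev (word g)) = s"
          using False s_def by (simp_all add: hd_rev)
        then show ?thesis using x 4 False by (auto simp: distinct_adj_append_iff)
      qed
      have "y = word (elt (word g @ x @ rev (word g)))"
        using less.prems wx by (simp add: inn_def elt_rev add.assoc del: add_uminus_conv_diff)
      also have "\<dots> = word g @ x @ rev (word g)" using dd by (rule word_elt)
      finally have "hd y = last y" "length y \<noteq> 1"
        using False x by (cases x; simp add: last_rev)+
      then show ?thesis using less.prems by (auto simp: cyc_red_def)
    qed
  qed
qed

section \<open>Multiples, torsion and uniqueness of roots\<close>

abbreviation ntimes :: "nat \<Rightarrow> 'a::monoid_add \<Rightarrow> 'a" where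
  "ntimes n u \<equiv> sum_list (replicate n u)"

lemma ntimes_add: "ntimes (m + n) u = ntimes m u + ntimes n u"
  by (simp add: replicate_add)

lemma add_hom_ntimes: "add_hom f \<Longrightarrow> f (ntimes n u) = ntimes n (f u)"
  by (induction n) (simp_all add: add_hom_zero add_hom_add)

lemma inn_ntimes: "inn g (ntimes n u) = ntimes n (inn g u)"
  by (rule add_hom_ntimes) (rule add_hom_inn)

lemma ntimes_elt: "ntimes n (elt w) = elt (concat (replicate n w))"
  by (induction n) simp_all

lemma concat_replicate_eq_Nil_iff: "concat (replicate n w) = [] \<longleftrightarrow> n = 0 \<or> w = []"
  by (auto simp: concat_eq_Nil_conv)

lemma hd_concat_replicate: "n > 0 \<Longrightarrow> w \<noteq> [] \<Longrightarrow> hd (concat (replicate n w)) = hd w"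
  by (cases n) auto

lemma last_concat_replicate: "n > 0 \<Longrightarrow> w \<noteq> [] \<Longrightarrow> last (concat (replicate n w)) = last w"
  by (induction n) (auto simp: concat_replicate_eq_Nil_iff last_append)

lemma cyc_red_concat_replicate:
  assumes "cyc_red w" "length w \<noteq> 1" "n > 0"
  shows "cyc_red (concat (replicate n w))"
proof -
  have w: "w \<noteq> []" "distinct_adj w" "hd w \<noteq> last w" using assms by (auto simp: cyc_red_def)
  have "distinct_adj (concat (replicate n w))"
    by (induction n) (use w in \<open>auto simp: distinct_adj_append_iff hd_concat_replicate
      concat_replicate_eq_Nil_iff\<close>)
  then show ?thesis using w assms
    by (auto simp: cyc_red_def hd_concat_replicate last_concat_replicate concat_replicate_eq_Nil_iff)
qed

lemma length_concat_replicate: "length (concat (replicate n w)) = n * length w"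
  by (induction n) simp_all

lemma concat_replicate_inject:
  assumes "concat (replicate n v) = concat (replicate n w)" "n > 0"
  shows "v = w"
proof -
  have "n * length v = n * length w"
    using arg_cong[OF assms(1), of length] by (simp add: length_concat_replicate)
  then have "length v = length w" using assms by simp
  then show ?thesis using assms by (cases n) auto
qed

lemma ucox_core:
  assumes "u \<noteq> 0"
  obtains g x where "word u = g @ x @ rev g" "cyc_red x" "u = inn (elt g) (elt x)"
proof -
  obtain g x where gx: "word u = g @ x @ rev g" "cyc_red x"
    using reduced_core[of "word u"] assms by auto
  moreover have "u = elt (g @ x @ rev g)" using gx elt_word by metis
  then have "u = inn (elt g) (elt x)" 
    by (simp add: inn_def elt_rev add.assoc del: add_uminus_conv_diff)
  ultimately show ?thesis using that by blast
qed

lemma word_ntimes_core: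
  assumes "word u = g @ x @ rev g" "cyc_red x" "length x \<noteq> 1" "n > 0"
  shows "word (ntimes n u) = g @ concat (replicate n x) @ rev g"
proof -
  have "u = elt (g @ x @ rev g)" using assms elt_word by metis
  then have u: "u = inn (elt g) (elt x)"
    by (simp add: inn_def elt_rev add.assoc del: add_uminus_conv_diff)
  have "ntimes n u = inn (elt g) (ntimes n (elt x))" by (simp add: u inn_ntimes)
  also have "\<dots> = elt (g @ concat (replicate n x) @ rev g)"
    by (simp add: ntimes_elt inn_def elt_rev add.assoc del: add_uminus_conv_diff)
  finally have eq: "ntimes n u = elt (g @ concat (replicate n x) @ rev g)" .
  have x: "x \<noteq> []" using assms by (auto simp: cyc_red_def)
  have "cyc_red (concat (replicate n x))" using assms cyc_red_concat_replicate by blast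
  moreover have "distinct_adj (g @ x @ rev g)" using assms(1) distinct_adj_word[of u] by simp
  ultimately have "distinct_adj (g @ concat (replicate n x) @ rev g)"
    using x assms(4) by (auto simp: cyc_red_def distinct_adj_append_iff hd_concat_replicate
      last_concat_replicate concat_replicate_eq_Nil_iff)
  then show ?thesis by (simp only: eq word_elt)
qed

lemma ntimes_conj_gen:
  "ntimes n (inn g (gen l)) = (if even n then 0 else inn g (gen l))"
proof -
  have "ntimes n (gen l) = (if even n then 0 else gen l)"
    by (induction n) simp_all
  then show ?thesis by (simp add: inn_ntimes[symmetric]) (simp add: inn_def)
qed

text \<open>Copies of a cyclically reduced core of length at least two concatenate without
  cancellation, so only a core of one letter can have finite order.\<close>

lemma torsion_imp_conj_gen:
  assumes "ntimes n u = 0" "n > 0" "u \<noteq> 0"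
  obtains g l where "u = inn g (gen l)"
proof -
  obtain g x where gx: "word u = g @ x @ rev g" "cyc_red x" "u = inn (elt g) (elt x)"
    using ucox_core[OF assms(3)] .
  have "length x = 1"
  proof (rule ccontr)
    assume "length x \<noteq> 1"
    then have "word (ntimes n u) = g @ concat (replicate n x) @ rev g"
      using word_ntimes_core gx assms by blast
    then show False using assms gx by (auto simp: concat_replicate_eq_Nil_iff cyc_red_def)
  qed
  then obtain l where "x = [l]" by (cases x) auto
  then show ?thesis using gx that by simp
qed

text \<open>For a core of one letter the multiple is 0 or \<open>u\<close> itself according to the
  parity of \<open>n\<close>; being nonzero selects the latter.\<close>

lemma word_ntimes:
  assumes "word u = g @ x @ rev g" "cyc_red x" "ntimes n u \<noteq> 0"
  shows "word (ntimes n u) = g @ (if length x = 1 then x else concat (replicate n x)) @ rev g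
    \<and> cyc_red (if length x = 1 then x else concat (replicate n x))"
proof (cases "length x = 1")
  case True
  then obtain l where "x = [l]" by (cases x) auto
  moreover have "u = elt (g @ x @ rev g)" using assms elt_word by metis
  ultimately have "u = inn (elt g) (gen l)"
    by (simp add: inn_def elt_rev add.assoc del: add_uminus_conv_diff)
  then have "ntimes n u = u" using assms(3) ntimes_conj_gen[of n] by metis
  then show ?thesis using assms True by simp
next
  case False
  moreover have "n > 0" using assms(3) by (auto intro: Nat.gr0I)
  ultimately show ?thesis
    using word_ntimes_core[OF assms(1,2)] cyc_red_concat_replicate[OF assms(2)] by simp
qed

lemma ntimes_zero: "ntimes n (0::'a::monoid_add) = 0"
  by (induction n) simp_all

text \<open>Involutions spoil the uniqueness of roots, hence the nonzero assumption.\<close>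

lemma ntimes_inject:
  fixes u v :: "'a ucox"
  assumes eq: "ntimes n u = ntimes n v" and nz: "ntimes n u \<noteq> 0"
  shows "u = v"
proof -
  have n: "n > 0" and u: "u \<noteq> 0" and v: "v \<noteq> 0"
    using assms by (auto intro: Nat.gr0I simp: ntimes_zero)
  obtain g x where gx: "word u = g @ x @ rev g" "cyc_red x" "u = inn (elt g) (elt x)"
    using ucox_core[OF u] .
  obtain h y where hy: "word v = h @ y @ rev h" "cyc_red y" "v = inn (elt h) (elt y)"
    using ucox_core[OF v] .
  define X where "X = (if length x = 1 then x else concat (replicate n x))"
  define Y where "Y = (if length y = 1 then y else concat (replicate n y))"
  have X: "word (ntimes n u) = g @ X @ rev g" "cyc_red X"
    using word_ntimes gx nz unfolding X_def by blast+
  have Y: "word (ntimes n v) = h @ Y @ rev h" "cyc_red Y"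
    using word_ntimes hy nz unfolding Y_def eq by blast+
  have "g = h" "X = Y" using core_unique X Y eq by metis+
  moreover have "x = y"
  proof (cases "length x = 1"; cases "length y = 1")
    assume "length x \<noteq> 1" "length y \<noteq> 1"
    then show ?thesis using \<open>X = Y\<close> n concat_replicate_inject by (auto simp: X_def Y_def)
  qed (use \<open>X = Y\<close> in \<open>auto simp: X_def Y_def length_concat_replicate
        dest!: arg_cong[where f = length]\<close>)
  ultimately show ?thesis using gx hy by simp
qed


section \<open>The centralizer of a product of three distinct letters\<close>

lemma ntimes_uminus: "ntimes n (- u) = - ntimes n (u::'a::group_add)"
proof (induction n)
  case (Suc n)
  have "u + ntimes n u = ntimes n u + u"
    using ntimes_add[of 1 n u] ntimes_add[of n 1 u] by simp
  then have "- u + - ntimes n u = - (u + ntimes n u)"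
    by (metis minus_add)
  then show ?case using Suc by simp
qed simp

text \<open>The descent step for the centralizer. If only \<open>c\<close> cancels on the left, the
  product starts with \<open>a\<close> and is longer than \<open>u\<close>. It equals the product on
  the right, which starts with \<open>c\<close> or is longer still unless both \<open>a\<close> and
  \<open>b\<close> cancel there, and in that case it is shorter than \<open>u\<close>.\<close>

lemma length_word_add_commute_less:
  assumes comm: "elt [a, b, c] + u = u + elt [a, b, c]" and d: "distinct [a, b, c]"
    and hd: "word u = c # w"
  shows "length (word (elt [a, b, c] + u)) < length (word u)"
proof -
  have wd: "word (elt [a, b, c]) = [a, b, c]" using d by (intro word_elt) simp
  show ?thesis
proof (cases "w \<noteq> [] \<and> hd w = b")
  case True
  then obtain w' where w: "word u = c # b # w'" using hd by (cases w) auto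
  then have "word (elt [a, b, c] + u) = push a w'"
    by (simp add: word_gen_add add.assoc)
  then show ?thesis using w by (cases w') auto
next
  case False
  then have "push b w = b # w" by (intro push_eq_Cons) auto
  then have l: "word (elt [a, b, c] + u) = a # b # w"
    using hd d by (simp add: word_gen_add add.assoc)
  show ?thesis
  proof (cases "last (word u) = a")
    case False
    then have "distinct_adj (word u @ word (elt [a, b, c]))"
      using d distinct_adj_word[of u] unfolding wd distinct_adj_append_iff by simp
    then have "word (u + elt [a, b, c]) = c # w @ [a, b, c]"
      using d hd word_elt[of "[a,b,c]"] by (subst word_add) (simp_all)
    then show ?thesis using l comm d by simp
  next
    case True
    define w0 where "w0 = butlast (word u)"
    have w0: "word u = w0 @ [a]" using True hd unfolding w0_def by (metis append_butlast_last_id list.distinct(1))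
    then have hw: "w0 \<noteq> []" "hd w0 = c" using hd d by (cases w0; auto)+
    have dw: "distinct_adj w0" using w0 distinct_adj_word[of u] distinct_adj_appendD1 by metis
    have "u = elt w0 + gen a" using elt_word[of u] w0 by simp
    then have eq: "u + elt [a, b, c] = elt w0 + elt [b, c]" by (simp add: add.assoc)
    show ?thesis
    proof (cases "last w0 = b")
      case False
      then have "distinct_adj (w0 @ [b, c])"
        using dw d by (simp add: distinct_adj_append_iff)
      then have "word (u + elt [a, b, c]) = w0 @ [b, c]"
        unfolding eq using word_elt[of "w0 @ [b, c]"] by simp
      then show ?thesis using l comm d hw by (cases w0) auto
    next
      case True
      define w1 where "w1 = butlast w0"
      have w1: "w0 = w1 @ [b]" using True hw unfolding w1_def by (metis append_butlast_last_id)
      have "u + elt [a, b, c] = elt w1 + gen c" unfolding eq by (simp add: w1 add.assoc)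
      moreover have "length (foldr push w1 [c]) \<le> length w1 + 1"
      proof (induction w1)
        case (Cons x w1)
        have "length (push x v) \<le> Suc (length v)" for v by (cases v) auto
        then show ?case using Cons by (metis add_Suc foldr.simps(2) comp_apply le_trans length_Cons Suc_le_mono)
      qed simp
      moreover have "word (elt w1) = w1" using dw w1 distinct_adj_appendD1 by (metis word_elt)
      ultimately have "length (word (u + elt [a, b, c])) \<le> length w1 + 1"
        by (simp add: plus_ucox.rep_eq)
      then show ?thesis using w0 w1 comm by simp
    qed
  qed
qed
qed

text \<open>As long as something cancels at either end, adding \<open>elt [a, b, c]\<close> shortens
  \<open>u\<close>. If nothing cancels, both products are plain concatenations, so \<open>u\<close>
  has \<open>[a, b, c]\<close> as a prefix, and this prefix is removed.\<close>

lemma centralizer_elt3: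
  assumes "elt [a, b, c] + u = u + elt [a, b, c]" and d: "distinct [a, b, c]"
  shows "\<exists>n. u = ntimes n (elt [a, b, c]) \<or> u = - ntimes n (elt [a, b, c])"
  using assms(1)
proof (induction "length (word u)" arbitrary: u rule: less_induct)
  case less
  let ?d = "elt [a, b, c]"
  have wd: "word ?d = [a, b, c]" using d by (intro word_elt) simp
  have comm1: "ntimes (Suc n) ?d = ntimes n ?d + ?d" for n
    using ntimes_add[of n 1 ?d] by simp
  have up: "\<exists>n. ?d + v = ntimes n ?d \<or> ?d + v = - ntimes n ?d"
    if "v = ntimes n ?d \<or> v = - ntimes n ?d" for v n
    using that
  proof
    assume "v = ntimes n ?d"
    then show ?thesis by (intro exI[of _ "Suc n"]) simp
  next
    assume v: "v = - ntimes n ?d"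
    show ?thesis
    proof (cases n)
      case 0
      then show ?thesis using v by (intro exI[of _ 1]) simp
    next
      case (Suc m)
      have "?d + v = - ntimes m ?d" unfolding v Suc comm1 minus_add by (rule add_minus_cancel)
      then show ?thesis by blast
    qed
  qed
  have down: "\<exists>n. - ?d + v = ntimes n ?d \<or> - ?d + v = - ntimes n ?d"
    if "v = ntimes n ?d \<or> v = - ntimes n ?d" for v n
    using that
  proof
    assume v: "v = - ntimes n ?d"
    have "- ?d + v = - ntimes (Suc n) ?d" unfolding v comm1 minus_add ..
    then show ?thesis by blast
  next
    assume v: "v = ntimes n ?d"
    show ?thesis
    proof (cases n)
      case 0
      then show ?thesis using v by (intro exI[of _ 1]) simp
    next
      case (Suc m)
      then have "- ?d + v = ntimes m ?d" unfolding v Suc by (simp del: elt_simps)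
      then show ?thesis by blast
    qed
  qed
  have hd: "length (word (?d + u)) < length (word u)" if "u \<noteq> 0" "hd (word u) = c"
  proof -
    have "word u = c # tl (word u)" using that by (metis list.collapse word_eq_Nil_iff)
    then show ?thesis using length_word_add_commute_less[OF less.prems d] by blast
  qed
  \<comment> \<open>The mirror image of \<open>hd\<close>: it is applied to \<open>- u\<close>,
    whose word starts with \<open>a\<close>, and to the inverse \<open>[c, b, a]\<close>.\<close>
  have last: "length (word (?d + u)) < length (word u)" if "u \<noteq> 0" "last (word u) = a"
  proof -
    have rd: "elt [c, b, a] = - ?d" using elt_rev[of "[a, b, c]"] by simp
    have "word (- u) = a # tl (word (- u))"
      using that by (metis hd_rev list.collapse rev_is_Nil_conv word_eq_Nil_iff word_uminus)
    moreover have "- ?d + - u = - u + - ?d" using less.prems by (metis minus_add)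
    moreover have "distinct [c, b, a]" using d by auto
    ultimately have "length (word (- ?d + - u)) < length (word (- u))"
      using length_word_add_commute_less[of c b a "- u", unfolded rd] by blast
    moreover have "- ?d + - u = - (?d + u)" using less.prems by (metis minus_add)
    ultimately show ?thesis by (metis length_rev word_uminus)
  qed
  consider "u = 0" | "length (word (?d + u)) < length (word u)"
    | "u \<noteq> 0" "hd (word u) \<noteq> c" "last (word u) \<noteq> a"
    using hd last by blast
  then show ?case
  proof cases
    case 1
    then show ?thesis by (intro exI[of _ 0]) simp
  next
    case 2
    have "?d + (?d + u) = (?d + u) + ?d" using less.prems by (metis add.assoc)
    then obtain n where "?d + u = ntimes n ?d \<or> ?d + u = - ntimes n ?d"
      using less.hyps 2 by blast
    from down[OF this] show ?thesis by (simp del: elt_simps)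
  next
    case 3
    have "word (?d + u) = [a, b, c] @ word u"
      using wd 3 d by (subst word_add)
        (auto simp: distinct_adj_append_iff distinct_adj_Cons simp del: elt_simps)
    moreover have "word (u + ?d) = word u @ [a, b, c]"
      using wd 3 d by (subst word_add) (auto simp: distinct_adj_append_iff simp del: elt_simps)
    ultimately have eq: "[a, b, c] @ word u = word u @ [a, b, c]" using less.prems by metis
    have "length (word u) \<noteq> 1" "length (word u) \<noteq> 2"
      using eq d by (auto simp: length_Suc_conv numeral_2_eq_2)
    moreover have "length (word u) \<noteq> 0" using 3 by simp
    ultimately have len: "length (word u) \<ge> 3" by linarith
    define w where "w = drop 3 (word u)"
    have "take 3 (word u) = [a, b, c]"
      using len arg_cong[OF eq, of "take 3"] by simp
    then have w: "word u = [a, b, c] @ w"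
      unfolding w_def by (metis append_take_drop_id)
    then have u: "u = ?d + elt w" using elt_word[of u] by (simp add: add.assoc)
    then have "?d + elt w = elt w + ?d" using less.prems by (metis add.assoc add_left_cancel)
    moreover have "word (elt w) = w" using w distinct_adj_word[of u] distinct_adj_appendD2
      by (metis word_elt)
    ultimately obtain n where "elt w = ntimes n ?d \<or> elt w = - ntimes n ?d"
      using less.hyps[of "elt w"] w by auto
    from up[OF this] show ?thesis unfolding u .
  qed
qed

text \<open>Triviality of the first cohomology of the cyclic group generated by a fixed-point-free
  permutation of order three of the free factors.\<close>

lemma rotation_cocycle_trivial:
  fixes \<rho> :: "'a \<Rightarrow> 'a"
  defines "r \<equiv> hom_ext (\<lambda>l. gen (\<rho> l))"
  assumes \<rho>: "\<And>l. \<rho> (\<rho> (\<rho> l)) = l" "\<And>l. \<rho> l \<noteq> l" and cocycle: "f + r f + r (r f) = 0"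
  shows "\<exists>g. f = g + - r g"
  using cocycle
proof (induction "length (word f)" arbitrary: f rule: less_induct)
  case less
  have r: "add_hom r" unfolding r_def by (rule add_hom_hom_ext) simp
  have rgen: "r (gen l) = gen (\<rho> l)" for l by (simp add: r_def)
  have inj: "inj \<rho>" by (metis \<rho>(1) injI)
  have relt: "r (elt w) = elt (map \<rho> w)" for w
    by (induction w) (simp_all add: rgen add_hom_add[OF r] add_hom_zero[OF r])
  define w where "w = word f"
  have f: "f = elt w" and dw: "distinct_adj w" by (simp_all add: w_def)
  show ?case
  proof (cases "w = []")
    case True
    then show ?thesis using f by (intro exI[of _ 0]) (simp add: add_hom_zero[OF r])
  next
    case False
    \<comment> \<open>Otherwise the three rotated copies of \<open>w\<close> concatenate without
      cancellation and their sum is not 0. With equality, \<open>f\<close> is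
      \<open>gen l + elt v - r (gen l)\<close>, that is, the shorter \<open>elt v\<close> changed by
      a coboundary.\<close>
    have last: "last w = \<rho> (hd w)"
    proof (rule ccontr)
      assume *: "last w \<noteq> \<rho> (hd w)"
      have "distinct_adj (map \<rho> v)" if "distinct_adj v" for v
        using that inj by (intro distinct_adj_mapI) (auto intro: inj_on_subset)
      moreover have "\<rho> (last w) \<noteq> \<rho> (\<rho> (hd w))" using * inj by (simp add: inj_eq)
      ultimately have "distinct_adj (w @ map \<rho> w @ map \<rho> (map \<rho> w))"
        using dw False * by (simp add: distinct_adj_append_iff hd_map last_map del: map_map)
      then have "word (elt (w @ map \<rho> w @ map \<rho> (map \<rho> w))) \<noteq> []"
        using False by (simp add: word_elt del: map_map elt_simps word_eq_Nil_iff)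
      then show False using less.prems by (simp add: f relt add.assoc del: map_map)
    qed
    then have "tl w \<noteq> []" using False \<rho>(2) by (metis last.simps list.collapse)
    define l where "l = hd w"
    define v where "v = butlast (tl w)"
    have wv: "w = l # v @ [\<rho> l]"
      using last \<open>tl w \<noteq> []\<close> False unfolding l_def v_def
      by (metis append_butlast_last_id last_tl list.collapse)
    have fv: "f = gen l + elt v + gen (\<rho> l)" by (simp add: f wv add.assoc)
    have "f + r f + r (r f) = inn (gen l) (elt v + r (elt v) + r (r (elt v)))"
      by (simp add: fv add_hom_add[OF r] rgen \<rho> add.assoc inn_def)
    then have "inn (gen l) (elt v + r (elt v) + r (r (elt v))) = inn (gen l) 0"
      using less.prems by (simp add: inn_def)
    then have "elt v + r (elt v) + r (r (elt v)) = 0" by (metis inn_uminus_inn(1))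
    moreover have "word (elt v) = v" using dw wv
      by (metis distinct_adj_ConsD distinct_adj_appendD1 word_elt)
    ultimately obtain g where "elt v = g + - r g"
      using less.hyps[of "elt v"] wv w_def by auto
    then have "f = (gen l + g) + - r (gen l + g)"
      by (simp add: fv add_hom_add[OF r] rgen minus_add add.assoc del: add_uminus_conv_diff)
    then show ?thesis by blast
  qed
qed

section \<open>Conjugacy classes and the trivalent tree\<close>

datatype letter = S1 | S2 | S3

lemma third_letter: "\<exists>z::letter. z \<noteq> x \<and> z \<noteq> y"
  by (cases x; cases y) (auto intro: exI[of _ S1] exI[of _ S2] exI[of _ S3])

fun rot :: "letter \<Rightarrow> letter" where
  "rot S1 = S2" | "rot S2 = S3" | "rot S3 = S1"

lemma rot_rot_rot [simp]: "rot (rot (rot l)) = l"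
  by (cases l) auto

lemma rot_neq [simp]: "rot l \<noteq> l" "l \<noteq> rot l" "rot (rot l) \<noteq> l" "l \<noteq> rot (rot l)"
  by (cases l; simp)+

lemma inj_rot: "inj rot"
  by (metis injI rot_rot_rot)

text \<open>The actions of \<open>\<beta>\<^sub>4\<close> and \<open>\<alpha>\<^sub>4\<close>.\<close>

definition aut_e :: "letter ucox \<Rightarrow> letter ucox" where
  "aut_e = hom_ext (\<lambda>l. gen (rot l))"

definition aut_a :: "letter ucox \<Rightarrow> letter ucox" where
  "aut_a = hom_ext (\<lambda>l. case l of S1 \<Rightarrow> gen S1 | S2 \<Rightarrow> gen S3 | S3 \<Rightarrow> elt [S1, S2, S1])"

lemma add_hom_aut: "add_hom aut_e" "add_hom aut_a"
  unfolding aut_e_def aut_a_def by (rule add_hom_hom_ext; simp add: add.assoc split: letter.split)+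

lemma aut_e_gen [simp]: "aut_e (gen l) = gen (rot l)"
  by (simp add: aut_e_def)

lemma aut_a_gen [simp]:
  "aut_a (gen S1) = gen S1" "aut_a (gen S2) = gen S3" "aut_a (gen S3) = gen S1 + (gen S2 + gen S1)"
  by (simp_all add: aut_a_def)

lemmas aut_add [simp] = add_hom_aut[THEN add_hom_add]
lemmas aut_zero [simp] = add_hom_aut[THEN add_hom_zero]
lemmas aut_uminus [simp] = add_hom_aut[THEN add_hom_uminus]
lemmas aut_inn = add_hom_aut[THEN add_hom_apply_inn]

lemma aut_e_cube: "aut_e (aut_e (aut_e u)) = u"
proof -
  have "aut_e \<circ> (aut_e \<circ> aut_e) = id"
    by (intro add_hom_eqI add_hom_comp add_hom_aut add_hom_id) simp
  then show ?thesis by (simp add: fun_eq_iff)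
qed

lemma aut_a_square: "aut_a (aut_a u) = inn (gen S1) u"
proof -
  have "aut_a (aut_a (gen l)) = inn (gen S1) (gen l)" for l
    by (cases l) (simp_all add: inn_def add.assoc)
  then have "aut_a \<circ> aut_a = inn (gen S1)"
    by (intro add_hom_eqI add_hom_comp add_hom_aut add_hom_inn) simp
  then show ?thesis by (simp add: fun_eq_iff)
qed

lemma inn_eq_zero_iff: "inn g u = 0 \<longleftrightarrow> u = 0"
  by (metis inn_uminus_inn(1) add_hom_zero add_hom_inn)

lemma aut_eq_zero_iff [simp]: "aut_e u = 0 \<longleftrightarrow> u = 0" "aut_a u = 0 \<longleftrightarrow> u = 0"
  using aut_e_cube[of u] aut_a_square[of u] by (auto simp: inn_eq_zero_iff)

subsection \<open>Patterns in cyclic words\<close>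

text \<open>Sums over the cyclic windows of three letters. Indices are taken modulo the length, so
  in words of one or two letters a window runs around the word.\<close>

definition cyc_sum :: "('a \<Rightarrow> 'a \<Rightarrow> 'a \<Rightarrow> nat) \<Rightarrow> 'a list \<Rightarrow> nat" where
  "cyc_sum g w = (\<Sum>i<length w. g (w ! (i mod length w)) (w ! (Suc i mod length w))
     (w ! (Suc (Suc i) mod length w)))"

lemma sum_periodic_shift:
  fixes h :: "nat \<Rightarrow> nat"
  assumes "h n = h 0"
  shows "(\<Sum>i<n. h (Suc i)) = (\<Sum>i<n. h i)"
  using sum.lessThan_Suc_shift[of h n] sum.lessThan_Suc[of h n] assms by simp

lemma cyc_sum_rotate1: "cyc_sum g (rotate1 w) = cyc_sum g w"
proof (cases "w = []")
  case False
  let ?n = "length w"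
  have nth: "rotate1 w ! (i mod ?n) = w ! (Suc i mod ?n)" for i
    using False by (simp add: nth_rotate1 mod_Suc_eq)
  define h where "h i = g (w ! (i mod ?n)) (w ! (Suc i mod ?n)) (w ! (Suc (Suc i) mod ?n))" for i
  have "cyc_sum g (rotate1 w) = (\<Sum>i<?n. h (Suc i))"
    unfolding cyc_sum_def length_rotate1 nth h_def ..
  also have "\<dots> = (\<Sum>i<?n. h i)"
  proof (rule sum_periodic_shift)
    have "(?n + k) mod ?n = k mod ?n" for k by simp
    from this[of 0] this[of 1] this[of "Suc (Suc 0)"] show "h ?n = h 0" by (simp add: h_def)
  qed
  finally show ?thesis by (simp add: cyc_sum_def h_def)
qed simp

lemma cyc_sum_rotate: "cyc_sum g (rotate k w) = cyc_sum g w"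
  by (induction k) (simp_all add: cyc_sum_rotate1)

lemma cyc_sum_shift: "cyc_sum (\<lambda>u v t. g v t) w = cyc_sum (\<lambda>u v t. g u v) w"
proof (cases "w = []")
  case False
  let ?n = "length w"
  define h where "h i = g (w ! (i mod ?n)) (w ! (Suc i mod ?n))" for i
  have "(\<Sum>i<?n. h (Suc i)) = (\<Sum>i<?n. h i)"
  proof (rule sum_periodic_shift)
    have "(?n + k) mod ?n = k mod ?n" for k by simp
    from this[of 0] this[of 1] show "h ?n = h 0" by (simp add: h_def)
  qed
  then show ?thesis by (simp add: cyc_sum_def h_def)
qed (simp add: cyc_sum_def)

lemma cyc_sum_map: "cyc_sum g (map f w) = cyc_sum (\<lambda>u v t. g (f u) (f v) (f t)) w"
  by (cases "w = []") (auto simp: cyc_sum_def intro!: sum.cong)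

lemma cyc_sum_mono: "(\<And>u v t. g u v t \<le> g' u v t) \<Longrightarrow> cyc_sum g w \<le> cyc_sum g' w"
  unfolding cyc_sum_def by (intro sum_mono)

lemma cyc_sum_add: "cyc_sum (\<lambda>u v t. g u v t + g' u v t) w = cyc_sum g w + cyc_sum g' w"
  by (simp add: cyc_sum_def sum.distrib)

text \<open>Places counted by \<open>edges S1\<close> are those where \<open>aut_a\<close> inserts a
  letter \<open>S1\<close>; those counted by \<open>turns S1\<close> are where it deletes one. Their
  difference is the growth of the cyclic length. The other values of \<open>x\<close> serve to
  follow the rotation \<open>aut_e\<close>.\<close>

definition edges :: "letter \<Rightarrow> letter list \<Rightarrow> nat" where
  "edges x = cyc_sum (\<lambda>u v _. of_bool (u \<noteq> x \<and> v \<noteq> x \<and> u \<noteq> v))"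

definition turns :: "letter \<Rightarrow> letter list \<Rightarrow> nat" where
  "turns x = cyc_sum (\<lambda>u v t. of_bool (v = x \<and> u \<noteq> x \<and> t \<noteq> x \<and> u \<noteq> t))"

text \<open>The two neighbours of a turn at \<open>x\<close> are the two other letters, so exactly
  one of them is the third letter \<open>z\<close>. This gives an adjacent pair of \<open>x\<close>
  and \<open>z\<close>, which avoids \<open>y\<close>, and different turns give different
  pairs.\<close>

lemma turns_le_edges:
  assumes "x \<noteq> y"
  shows "turns x w \<le> edges y w"
proof -
  obtain z where z: "z \<noteq> x" "z \<noteq> y" using third_letter by blast
  have "turns x w \<le> cyc_sum (\<lambda>u v t. of_bool (u = z \<and> v = x) + of_bool (v = x \<and> t = z)) w"
    unfolding turns_def
  proof (rule cyc_sum_mono)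
    fix u v t
    show "of_bool (v = x \<and> u \<noteq> x \<and> t \<noteq> x \<and> u \<noteq> t)
        \<le> (of_bool (u = z \<and> v = x) + of_bool (v = x \<and> t = z) :: nat)"
      using assms z by (cases x; cases y; cases z; cases u; cases t) auto
  qed
  also have "\<dots> = cyc_sum (\<lambda>u v t. of_bool (u = z \<and> v = x)) w +
      cyc_sum (\<lambda>u v t. of_bool (u = x \<and> v = z)) w"
    unfolding cyc_sum_add cyc_sum_shift[of "\<lambda>u v. of_bool (u = x \<and> v = z)"] ..
  also have "\<dots> = cyc_sum (\<lambda>u v t. of_bool (u = z \<and> v = x) + of_bool (u = x \<and> v = z)) w"
    by (rule cyc_sum_add[symmetric])
  also have "\<dots> \<le> edges y w"
    unfolding edges_def using assms z by (intro cyc_sum_mono) auto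
  finally show ?thesis .
qed

lemma edges_rotate: "edges x (rotate k w) = edges x w" "turns x (rotate k w) = turns x w"
  by (simp_all add: edges_def turns_def cyc_sum_rotate)

lemma edges_map_rot: "edges (rot x) (map rot w) = edges x w" "turns (rot x) (map rot w) = turns x w"
  by (simp_all add: edges_def turns_def cyc_sum_map inj_eq[OF inj_rot])

text \<open>The automorphism \<open>aut_a\<close> on a path between letters other than \<open>S1\<close>: these two letters are
  exchanged, and a letter \<open>S1\<close> between distinct ones is deleted or inserted.\<close>

fun swap23 :: "letter \<Rightarrow> letter" where
  "swap23 S1 = S1" | "swap23 S2 = S3" | "swap23 S3 = S2"

fun toggle :: "letter list \<Rightarrow> letter list" where
  "toggle [] = []"
| "toggle [x] = [swap23 x]"
| "toggle (x # S1 # y # w) = (if x = y then swap23 x # S1 # toggle (y # w) else swap23 x # toggle (y # w))"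
| "toggle (x # y # w) = swap23 x # S1 # toggle (y # w)"

fun path_edges :: "letter list \<Rightarrow> nat" where
  "path_edges (x # y # w) = of_bool (x \<noteq> S1 \<and> y \<noteq> S1 \<and> x \<noteq> y) + path_edges (y # w)"
| "path_edges w = 0"

fun path_turns :: "letter list \<Rightarrow> nat" where
  "path_turns (x # y # z # w) =
     of_bool (y = S1 \<and> x \<noteq> S1 \<and> z \<noteq> S1 \<and> x \<noteq> z) + path_turns (y # z # w)"
| "path_turns w = 0"

lemma path_turns_Cons: "y \<noteq> S1 \<Longrightarrow> path_turns (x # y # w) = path_turns (y # w)"
  by (cases w) auto

definition path :: "letter list \<Rightarrow> bool" where
  "path w \<longleftrightarrow> w \<noteq> [] \<and> distinct_adj w \<and> hd w \<noteq> S1 \<and> last w \<noteq> S1"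

lemma path_cases:
  assumes "path w"
  obtains (single) x where "w = [x]" "x \<noteq> S1"
  | (edge) x y v where "w = x # y # v" "x \<noteq> S1" "y \<noteq> S1" "x \<noteq> y" "path (y # v)"
  | (turn) x y v where "w = x # S1 # y # v" "x \<noteq> S1" "y \<noteq> S1" "path (y # v)"
proof (cases w)
  case (Cons x w')
  show ?thesis
  proof (cases w')
    case Nil
    then show ?thesis using Cons assms single by (auto simp: path_def)
  next
    case (Cons y v)
    note w = \<open>w = x # w'\<close> Cons
    show ?thesis
    proof (cases "y = S1")
      case False
      then show ?thesis using w assms edge[of x y v] by (auto simp: path_def)
    next
      case True
      then obtain z v' where "v = z # v'" using w assms by (cases v) (auto simp: path_def)
      then show ?thesis using w True assms turn[of x z v'] by (auto simp: path_def)
    qed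
  qed
qed (use assms in \<open>simp add: path_def\<close>)

text \<open>The letter \<open>S1\<close> that surrounds the image \<open>S1 S2 S1\<close> of
  \<open>S3\<close>, while the image \<open>S3\<close> of \<open>S2\<close> has none around
  it.\<close>

definition corr :: "letter \<Rightarrow> letter ucox" where
  "corr x = (if x = S3 then gen S1 else 0)"

text \<open>Each letter other than \<open>S1\<close> is exchanged and flanked by its
  \<open>corr\<close> on both sides. Between neighbours these flanks combine with a letter
  \<open>S1\<close> that may already stand there, which gives the insertions and deletions of
  \<open>toggle\<close>; only the two outermost flanks remain.\<close>

lemma toggle_path:
  assumes "path w"
  shows "path (toggle w) \<and> hd (toggle w) = swap23 (hd w) \<and> last (toggle w) = swap23 (last w) \<and>
    length (toggle w) \<ge> 1 \<and> (length w > 1 \<longrightarrow> length (toggle w) > 1) \<and>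
    path_edges (toggle w) = path_turns w \<and> path_turns (toggle w) = path_edges w \<and>
    aut_a (elt w) = corr (hd w) + elt (toggle w) + corr (last w)"
  using assms
proof (induction "length w" arbitrary: w rule: less_induct)
  case less
  from less.prems show ?case
  proof (cases rule: path_cases)
    case (single x)
    then show ?thesis by (cases x) (auto simp: path_def corr_def add.assoc)
  next
    case (edge x y v)
    note IH = less.hyps[OF _ edge(5)]
    obtain z t where t: "toggle (y # v) = z # t" using IH edge by (cases "toggle (y # v)") auto
    have z: "z = swap23 y" using IH edge t by auto
    have tg: "toggle w = swap23 x # S1 # z # t" using edge t by (cases y; cases v) auto
    have pw: "path_turns w = path_turns (y # v)" using edge by (cases v) auto
    show ?thesis
      using IH edge t z unfolding tg pw
      by (cases x; cases y) (auto simp: path_def corr_def add.assoc path_turns_Cons)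
  next
    case (turn x y v)
    note IH = less.hyps[OF _ turn(4)]
    obtain z t where t: "toggle (y # v) = z # t" using IH turn by (cases "toggle (y # v)") auto
    have z: "z = swap23 y" using IH turn t by auto
    have tg: "toggle w = (if x = y then swap23 x # S1 # z # t else swap23 x # z # t)"
      using turn t by simp
    have pw: "path_turns w = of_bool (x \<noteq> y) + path_turns (y # v)" using turn by (cases v; cases x; cases y) auto
    show ?thesis
      using IH turn t z unfolding tg pw
      by (cases x; cases y) (auto simp: path_def corr_def add.assoc path_turns_Cons)
  qed
qed


lemma path_edges_sum:
  "path_edges w = (\<Sum>i<length w - 1. of_bool (w ! i \<noteq> S1 \<and> w ! Suc i \<noteq> S1 \<and> w ! i \<noteq> w ! Suc i))"
proof (induction w rule: path_edges.induct)
  case (1 x y w)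
  then show ?case by (simp add: sum.lessThan_Suc_shift del: sum.lessThan_Suc)
qed auto

lemma path_turns_sum:
  "path_turns w = (\<Sum>i<length w - 2. of_bool (w ! Suc i = S1 \<and> w ! i \<noteq> S1 \<and>
     w ! Suc (Suc i) \<noteq> S1 \<and> w ! i \<noteq> w ! Suc (Suc i)))"
proof (induction w rule: path_turns.induct)
  case (1 x y z w)
  then show ?case by (simp add: sum.lessThan_Suc_shift del: sum.lessThan_Suc)
qed auto

lemma cyc_counts_path:
  assumes "w \<noteq> []" "hd w \<noteq> S1"
  shows "edges S1 w = path_edges (w @ [hd w])" "turns S1 w = path_turns (w @ [hd w])"
proof -
  let ?n = "length w" and ?p = "w @ [hd w]"
  have p: "?p ! i = w ! (i mod ?n)" if "i \<le> ?n" for i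
    using that assms by (auto simp: nth_append hd_conv_nth)
  show "edges S1 w = path_edges ?p"
    unfolding edges_def cyc_sum_def path_edges_sum
    by (intro sum.cong) (auto simp: p)
  obtain m where m: "?n = Suc m" using assms by (cases w) auto
  \<comment> \<open>The window left out is centered at the first letter, which is not
    \<open>S1\<close>, so it contributes 0.\<close>
  have "turns S1 w = (\<Sum>i<m. of_bool (w ! (Suc i mod ?n) = S1 \<and> w ! (i mod ?n) \<noteq> S1 \<and>
     w ! (Suc (Suc i) mod ?n) \<noteq> S1 \<and> w ! (i mod ?n) \<noteq> w ! (Suc (Suc i) mod ?n)))"
    unfolding turns_def cyc_sum_def using m assms by (simp add: hd_conv_nth)
  also have "\<dots> = path_turns ?p"
    unfolding path_turns_sum using m by (intro sum.cong) (auto simp: p)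
  finally show "turns S1 w = path_turns ?p" .
qed

section \<open>Cyclic words of conjugacy classes and their change under the two
  automorphisms\<close>

definition cyc_word :: "'a ucox \<Rightarrow> 'a list \<Rightarrow> bool" where
  "cyc_word u w \<longleftrightarrow> cyc_red w \<and> (\<exists>g. u = inn g (elt w))"

lemma cyc_word_exists: "u \<noteq> 0 \<Longrightarrow> \<exists>w. cyc_word u w"
  by (metis cyc_word_def ucox_core)

lemma cyc_word_inn: "cyc_word u w \<Longrightarrow> cyc_word (inn g u) w"
  by (auto simp: cyc_word_def inn_inn)

lemma cyc_word_unique: "cyc_word u v \<Longrightarrow> cyc_word u w \<Longrightarrow> \<exists>k. w = rotate k v"
  unfolding cyc_word_def by (metis conj_cyc_red inn_inn inn_uminus_inn(1))

lemma elt_rotate1: "\<exists>g. elt (rotate1 w) = inn g (elt w)"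
proof (cases w)
  case (Cons l v)
  then have "elt (rotate1 w) = inn (gen l) (elt w)" by (simp add: inn_def add.assoc)
  then show ?thesis by blast
qed (auto intro: exI[of _ 0])

lemma elt_rotate: "\<exists>g. elt (rotate k w) = inn g (elt w)"
proof (induction k)
  case (Suc k)
  then show ?case using elt_rotate1[of "rotate k w"] by (auto simp: inn_inn)
qed (auto intro: exI[of _ 0])

lemma cyc_red_rotate: "cyc_red w \<Longrightarrow> cyc_red (rotate k w)"
proof (induction k)
  case (Suc k)
  then obtain l v where v: "rotate k w = l # v" by (cases "rotate k w") (auto simp: cyc_red_def)
  then have "cyc_red (v @ [l])" using Suc
    by (cases "v = []") (auto simp: cyc_red_def distinct_adj_append_iff distinct_adj_Cons)
  then show ?case using v by simp
qed simp

lemma cyc_word_rotate: "cyc_word u w \<Longrightarrow> cyc_word u (rotate k w)"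
  using cyc_red_rotate[of w k] elt_rotate[of k w] unfolding cyc_word_def
  by (metis inn_inn inn_uminus_inn(1))

text \<open>The cycle is opened at a letter other than \<open>S1\<close> and that letter is repeated
  at the end; the two equal corrections of the resulting path then turn into a conjugation. A single
  letter is treated apart because its repetition is not reduced.\<close>

lemma aut_a_cyc_red:
  assumes "cyc_red w" "hd w \<noteq> S1"
  shows "\<exists>v g. cyc_red v \<and> aut_a (elt w) = inn g (elt v) \<and> edges S1 v = turns S1 w \<and> turns S1 v = edges S1 w"
proof (cases "length w = 1")
  case True
  then obtain x where x: "w = [x]" by (cases w) auto
  then have "aut_a (elt w) = inn (corr x) (elt [swap23 x])"
    using assms by (cases x) (auto simp: corr_def inn_def add.assoc)
  then show ?thesis
    by (intro exI[of _ "[swap23 x]"] exI[of _ "corr x"])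
      (auto simp: x cyc_red_def edges_def turns_def cyc_sum_def)
next
  case False
  define p where "p = w @ [hd w]"
  have w: "w \<noteq> []" "distinct_adj w" "hd w \<noteq> last w" using assms False by (auto simp: cyc_red_def)
  then have "path p" "length p > 1" "hd p = hd w" "last p = hd w"
    using assms by (auto simp: path_def p_def distinct_adj_append_iff)
  note tp = toggle_path[OF \<open>path p\<close>, unfolded this(3,4)]
  define v where "v = butlast (toggle p)"
  have ne: "toggle p \<noteq> []" "v \<noteq> []" using tp \<open>length p > 1\<close> by (auto simp: v_def butlast_conv_take)
  have "hd (toggle p) = hd v" using ne by (metis append_butlast_last_id hd_append2 v_def)
  then have tv: "toggle p = v @ [hd v]" using tp ne by (metis append_butlast_last_id v_def)
  have hv: "hd v = swap23 (hd w)" using tp tv ne by simp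
  have "distinct_adj (v @ [hd v])" using tp unfolding tv path_def by blast
  then have "cyc_red v" using ne by (auto simp: cyc_red_def distinct_adj_append_iff)
  moreover have "edges S1 v = turns S1 w \<and> turns S1 v = edges S1 w"
    using tp cyc_counts_path[of v] cyc_counts_path[of w] ne w assms hv
    unfolding p_def[symmetric] tv by (cases "hd w") auto
  moreover have "aut_a (elt w) = inn (corr (hd w)) (elt v)"
  proof -
    have "elt w = elt p + gen (hd w)" by (simp add: p_def add.assoc)
    then have "aut_a (elt w) = aut_a (elt p) + aut_a (gen (hd w))" by simp
    also have "\<dots> = corr (hd w) + elt (v @ [hd v]) + corr (hd w) + aut_a (gen (hd w))"
      using tp tv by metis
    also have "\<dots> = inn (corr (hd w)) (elt v)"
      using hv assms by (cases "hd w") (simp_all add: corr_def inn_def add.assoc)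
    finally show ?thesis .
  qed
  ultimately show ?thesis by blast
qed

lemma cyc_word_aut_a:
  assumes "cyc_word u w"
  shows "\<exists>v. cyc_word (aut_a u) v \<and> edges S1 v = turns S1 w \<and> turns S1 v = edges S1 w"
proof (cases "\<exists>l\<in>set w. l \<noteq> S1")
  case True
  then obtain i where i: "i < length w" "w ! i \<noteq> S1" by (auto simp: in_set_conv_nth)
  define w' where "w' = rotate i w"
  have "hd w' \<noteq> S1" using i by (cases "w = []") (auto simp: w'_def hd_rotate_conv_nth)
  moreover have w': "cyc_word u w'" using assms cyc_word_rotate w'_def by blast
  ultimately obtain v g where v: "cyc_red v" "aut_a (elt w') = inn g (elt v)"
      "edges S1 v = turns S1 w'" "turns S1 v = edges S1 w'"
    using aut_a_cyc_red unfolding cyc_word_def by blast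
  obtain h where "u = inn h (elt w')" using w' by (auto simp: cyc_word_def)
  then have "cyc_word (aut_a u) v" using v by (auto simp: cyc_word_def aut_inn inn_inn)
  then show ?thesis using v by (auto simp: w'_def edges_rotate)
next
  case False
  have w: "w \<noteq> []" "distinct_adj w" using assms by (auto simp: cyc_word_def cyc_red_def)
  then obtain x v where "w = x # v" by (cases w) auto
  then have "w = [S1]" using w False by (cases v) auto
  then show ?thesis using assms
    by (intro exI[of _ w]) (auto simp: cyc_word_def aut_inn edges_def turns_def cyc_sum_def)
qed

lemma cyc_word_aut_e:
  assumes "cyc_word u w"
  shows "cyc_word (aut_e u) (map rot w)"
proof -
  have "aut_e (elt w) = elt (map rot w)" by (induction w) simp_all
  moreover have "cyc_red (map rot w)"
    using assms inj_rot unfolding cyc_word_def cyc_red_def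
    by (auto simp: hd_map last_map inj_eq intro!: distinct_adj_mapI intro: inj_on_subset)
  ultimately show ?thesis using assms by (auto simp: cyc_word_def aut_inn)
qed

text \<open>The change of the cyclic length under \<open>aut_a\<close>. The automorphisms \<open>aut_a\<close> and \<open>aut_e\<close> cross an
  edge and turn around a vertex of the trivalent tree of \<open>PSL\<^sub>2(\<int>)\<close>, and the cyclic length is
  convex along paths without backtracking: this is \<open>slope_mono\<close>.\<close>

definition slope :: "letter ucox \<Rightarrow> int" where
  "slope u = (let w = SOME w. cyc_word u w in int (edges S1 w) - int (turns S1 w))"

lemma slope_eq:
  assumes "cyc_word u w"
  shows "slope u = int (edges S1 w) - int (turns S1 w)"
proof -
  have "cyc_word u (SOME w. cyc_word u w)" using assms by (rule someI)
  then obtain k where "w = rotate k (SOME w. cyc_word u w)" using cyc_word_unique assms by blast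
  then show ?thesis unfolding slope_def Let_def by (simp add: edges_rotate)
qed

lemma slope_inn [simp]: "u \<noteq> 0 \<Longrightarrow> slope (inn g u) = slope u"
  by (metis cyc_word_exists cyc_word_inn slope_eq)

lemma slope_aut_a: "u \<noteq> 0 \<Longrightarrow> slope (aut_a u) = - slope u"
  using cyc_word_exists[of u] cyc_word_aut_a[of u] by (force simp: slope_eq)

text \<open>Crossing the edge exchanges \<open>edges S1\<close> and \<open>turns S1\<close>, and the
  turn replaces \<open>S1\<close> by \<open>S3\<close> or \<open>S2\<close>. The difference of the
  slopes is then a sum of two terms of the form edges minus turns for distinct letters, both
  nonnegative by \<open>turns_le_edges\<close>.\<close>

lemma slope_mono:
  assumes "u \<noteq> 0"
  shows "slope u \<le> slope (aut_e (aut_a u))" "slope u \<le> slope (aut_e (aut_e (aut_a u)))"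
proof -
  obtain w where w: "cyc_word u w" using assms cyc_word_exists by blast
  obtain v where v: "cyc_word (aut_a u) v" "edges S1 v = turns S1 w" "turns S1 v = edges S1 w"
    using cyc_word_aut_a[OF w] by blast
  have "cyc_word (aut_e (aut_a u)) (map rot v)" using cyc_word_aut_e v by blast
  then have "slope (aut_e (aut_a u)) = int (edges S3 v) - int (turns S3 v)"
    using edges_map_rot[of S3 v] by (simp add: slope_eq)
  then show "slope u \<le> slope (aut_e (aut_a u))"
    using v slope_eq[OF w] turns_le_edges[of S1 S3 v] turns_le_edges[of S3 S1 v] by simp
  have "cyc_word (aut_e (aut_e (aut_a u))) (map rot (map rot v))" using cyc_word_aut_e v by blast
  then have "slope (aut_e (aut_e (aut_a u))) = int (edges S2 v) - int (turns S2 v)"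
    using edges_map_rot[of S2 v] edges_map_rot[of S3 "map rot v"] by (simp add: slope_eq del: map_map)
  then show "slope u \<le> slope (aut_e (aut_e (aut_a u)))"
    using v slope_eq[OF w] turns_le_edges[of S1 S2 v] turns_le_edges[of S2 S1 v] by simp
qed

text \<open>A class invariant under \<open>aut_e\<close> has a cyclic word that rotates into its
  image under \<open>rot\<close>, so all three letters have equal counts.\<close>

lemma counts_rotation_invariant:
  assumes "cyc_word u w" "aut_e u = inn g u"
  shows "edges x w = edges S1 w" "turns x w = turns S1 w"
proof -
  have "cyc_word (inn g u) (map rot w)" using cyc_word_aut_e[OF assms(1)] assms(2) by simp
  then have "cyc_word u (map rot w)" by (metis cyc_word_inn inn_uminus_inn(1))
  then obtain k where "map rot w = rotate k w" using cyc_word_unique assms by blast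
  then have "edges (rot x) w = edges x w \<and> turns (rot x) w = turns x w" for x
    using edges_map_rot[of x w] by (simp add: edges_rotate)
  from this[of S1] this[of S2] show "edges x w = edges S1 w" "turns x w = turns S1 w"
    by (cases x; simp)+
qed

lemma slope_nonneg:
  assumes "u \<noteq> 0" "aut_e u = inn g u"
  shows "slope u \<ge> 0"
proof -
  obtain w where w: "cyc_word u w" using assms cyc_word_exists by blast
  then show ?thesis using turns_le_edges[of S1 S2 w] counts_rotation_invariant[OF w assms(2), of S2]
    by (simp add: slope_eq)
qed

text \<open>One tour around the word applies \<open>f\<close> \<open>n\<close> times and comes back
  to the first letter; as \<open>f\<close> moves all letters in cycles of length three, three
  divides \<open>n\<close>.\<close>

lemma rotate_word:
  assumes n: "length w = n" "n > 0" and step: "\<And>i. i < n \<Longrightarrow> w ! (Suc i mod n) = f (w ! i)"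
    and f: "\<And>l::'a. f (f (f l)) = l" "\<And>l. f l \<noteq> l"
  shows "\<exists>k x. k > 0 \<and> w = concat (replicate k [x, f x, f (f x)])"
proof -
  have nth: "w ! i = (f ^^ i) (w ! 0)" if "i < n" for i
    using that
  proof (induction i)
    case (Suc i)
    then show ?case using step[of i] by simp
  qed simp
  have f3: "(f ^^ (3 * k)) l = l" for k l
    by (induction k) (simp_all add: f numeral_3_eq_3)
  have "(f ^^ (n mod 3 + 3 * (n div 3))) l = (f ^^ (n mod 3)) l" for l
    by (simp only: funpow_add comp_apply f3)
  then have "(f ^^ n) l = (f ^^ (n mod 3)) l" for l
    by simp
  moreover have "(f ^^ n) (w ! 0) = w ! 0"
    using step[of "n - 1"] nth[of "n - 1"] n by (cases n) simp_all
  ultimately have "(f ^^ (n mod 3)) (w ! 0) = w ! 0" by simp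
  moreover have "n mod 3 = 0 \<or> n mod 3 = 1 \<or> n mod 3 = 2" by linarith
  moreover have "f (f (w ! 0)) \<noteq> w ! 0" using f by metis
  ultimately have "n mod 3 = 0" using f(2) by (auto simp: numeral_2_eq_2)
  then obtain k where k: "n = 3 * k" by auto
  have "w = map (\<lambda>i. (f ^^ i) (w ! 0)) [0..<n]"
  proof (rule nth_equalityI)
    fix i assume "i < length w"
    then show "w ! i = map (\<lambda>i. (f ^^ i) (w ! 0)) [0..<n] ! i" using nth[of i] n(1) by simp
  qed (simp add: n)
  also have "\<dots> = concat (replicate k [w ! 0, f (w ! 0), f (f (w ! 0))])"
    unfolding k
  proof (induction k)
    case (Suc k)
    have "3 * Suc k = Suc (Suc (Suc (3 * k)))" by simp
    then have "[0..<3 * Suc k] = [0..<3 * k] @ [3 * k, Suc (3 * k), Suc (Suc (3 * k))]"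
      by (simp only: upt_Suc) simp
    then show ?case using Suc f3[of k] by (simp add: replicate_append_same[symmetric] del: upt_Suc)
  qed simp
  finally have "w = concat (replicate k [w ! 0, f (w ! 0), f (f (w ! 0))])" .
  moreover have "k > 0" using k n by simp
  ultimately show ?thesis by blast
qed

lemma rot_third:
  "rot x \<noteq> y \<Longrightarrow> x \<noteq> y \<Longrightarrow> y = rot (rot x)"
  "rot (rot x) \<noteq> y \<Longrightarrow> x \<noteq> y \<Longrightarrow> y = rot x"
  by (cases x; cases y; simp)+

text \<open>Every adjacent pair omits one letter, so the three edge counts add up to the length. By
  symmetry and slope zero so do the turn counts, hence every window of three consists of distinct
  letters. The direction around the three letters therefore never changes, and the word is a power
  of one cyclic order of the letters.\<close>

lemma slope_zero:
  assumes u: "u \<noteq> 0" "aut_e u = inn g u" and "slope u = 0"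
  shows "\<exists>h n. n > 0 \<and> (u = inn h (ntimes n (elt [S2, S1, S3])) \<or> u = inn h (- ntimes n (elt [S2, S1, S3])))"
proof -
  obtain w where w: "cyc_word u w" using u cyc_word_exists by blast
  note inv = counts_rotation_invariant[OF w u(2)]
  have eq: "edges S1 w = turns S1 w" using slope_eq[OF w] assms by simp
  let ?n = "length w"
  have n: "?n > 0" and dw: "distinct_adj w" using w by (auto simp: cyc_word_def cyc_red_def)
  have "?n \<noteq> 1"
  proof
    assume "?n = 1"
    then obtain x where x: "w = [x]" by (cases w) auto
    have "cyc_word u [rot x]" using cyc_word_aut_e[OF w] u(2) x
      by (metis cyc_word_inn inn_uminus_inn(1) list.simps(8,9))
    then obtain k where "[rot x] = rotate k [x]" using cyc_word_unique w x by blast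
    then show False by (induction k) auto
  qed
  then have hl: "hd w \<noteq> last w" using w by (auto simp: cyc_word_def cyc_red_def)
  have adj: "w ! (i mod ?n) \<noteq> w ! (Suc i mod ?n)" if "i < ?n" for i
  proof (cases "Suc i < ?n")
    case True
    then show ?thesis using dw that by (simp add: distinct_adj_conv_nth)
  next
    case False
    then have "i = ?n - 1" using that by simp
    then show ?thesis using hl n by (simp add: hd_conv_nth last_conv_nth)
  qed
  let ?g = "\<lambda>u v t :: letter. of_bool (u \<noteq> t) :: nat"
  have "?n = (\<Sum>i<?n. 1)" by simp
  also have "\<dots> = edges S1 w + edges S2 w + edges S3 w"
    unfolding edges_def cyc_sum_def sum.distrib[symmetric]
  proof (intro sum.cong HOL.refl)
    fix i assume "i \<in> {..<?n}"
    then have "w ! (i mod ?n) \<noteq> w ! (Suc i mod ?n)" using adj by simp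
    then show "1 = of_bool (w ! (i mod ?n) \<noteq> S1 \<and> w ! (Suc i mod ?n) \<noteq> S1 \<and> w ! (i mod ?n) \<noteq> w ! (Suc i mod ?n)) +
      of_bool (w ! (i mod ?n) \<noteq> S2 \<and> w ! (Suc i mod ?n) \<noteq> S2 \<and> w ! (i mod ?n) \<noteq> w ! (Suc i mod ?n)) +
      (of_bool (w ! (i mod ?n) \<noteq> S3 \<and> w ! (Suc i mod ?n) \<noteq> S3 \<and> w ! (i mod ?n) \<noteq> w ! (Suc i mod ?n)) :: nat)"
      by (cases "w ! (i mod ?n)"; cases "w ! (Suc i mod ?n)") auto
  qed
  also have "\<dots> = turns S1 w + turns S2 w + turns S3 w"
    using eq inv(1)[of S2] inv(1)[of S3] inv(2)[of S2] inv(2)[of S3] by simp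
  also have "\<dots> \<le> cyc_sum ?g w"
    unfolding turns_def cyc_sum_add[symmetric]
  proof (rule cyc_sum_mono)
    fix u v t
    show "of_bool (v = S1 \<and> u \<noteq> S1 \<and> t \<noteq> S1 \<and> u \<noteq> t) + of_bool (v = S2 \<and> u \<noteq> S2 \<and> t \<noteq> S2 \<and> u \<noteq> t) +
      of_bool (v = S3 \<and> u \<noteq> S3 \<and> t \<noteq> S3 \<and> u \<noteq> t) \<le> ?g u v t"
      by (cases v) auto
  qed
  finally have sum_ge: "?n \<le> cyc_sum ?g w" .
  have turn: "w ! i \<noteq> w ! (Suc (Suc i) mod ?n)" if "i < ?n" for i
  proof
    assume *: "w ! i = w ! (Suc (Suc i) mod ?n)"
    have "cyc_sum ?g w < (\<Sum>i<?n. 1)"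
      unfolding cyc_sum_def using that * by (intro sum_strict_mono_ex1) auto
    then show False using sum_ge by simp
  qed
  define W where "W i = w ! (i mod ?n)" for i
  have adjW: "W i \<noteq> W (Suc i)" for i
    using adj[of "i mod ?n"] n by (simp add: W_def mod_Suc_eq)
  have turnW: "W i \<noteq> W (Suc (Suc i))" for i
    using turn[of "i mod ?n"] n unfolding W_def by (metis mod_Suc_eq mod_less_divisor)
  have dir: "W (Suc (Suc i)) = f (W (Suc i))" if "W (Suc i) = f (W i)" "f = rot \<or> f = rot \<circ> rot" for i f
    using that adjW[of "Suc i"] turnW[of i] rot_third[of "W i" "W (Suc (Suc i))"] by auto
  have "W 1 = rot (W 0) \<or> W 1 = rot (rot (W 0))"
    using adjW[of 0] by (cases "W 0"; cases "W 1") auto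
  then obtain f where f: "f = rot \<or> f = rot \<circ> rot" "W 1 = f (W 0)" by (metis comp_apply)
  have all: "W (Suc i) = f (W i)" for i
    by (induction i) (use f dir in auto)
  have f3: "f (f (f l)) = l" and fn: "f l \<noteq> l" for l using f by auto
  obtain k x where k: "k > 0" and wk: "w = concat (replicate k [x, f x, f (f x)])"
    using rotate_word[OF HOL.refl n _ f3 fn] all unfolding W_def by (metis mod_less)
  define \<delta> where "\<delta> = elt [S2, S1, S3]"
  have "\<exists>h. elt [x, f x, f (f x)] = inn h \<delta> \<or> elt [x, f x, f (f x)] = inn h (- \<delta>)"
  proof -
    \<comment> \<open>The six arrangements of the letters are the rotations of
      \<open>\<delta>\<close> and of its inverse.\<close>
    have "inn 0 \<delta> = elt [S2, S1, S3]" "inn (gen S2) \<delta> = elt [S1, S3, S2]"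
      "inn (gen S3) \<delta> = elt [S3, S2, S1]" "inn 0 (- \<delta>) = elt [S3, S1, S2]"
      "inn (gen S3) (- \<delta>) = elt [S1, S2, S3]" "inn (gen S2) (- \<delta>) = elt [S2, S3, S1]"
      by (simp_all add: \<delta>_def inn_def add.assoc minus_add del: add_uminus_conv_diff)
    then show ?thesis using f(1) by (cases x) (auto, (metis inn_zero)+)
  qed
  then obtain h where h: "elt [x, f x, f (f x)] = inn h \<delta> \<or> elt [x, f x, f (f x)] = inn h (- \<delta>)" ..
  obtain h' where h': "u = inn h' (elt w)" using w by (auto simp: cyc_word_def)
  have "u = inn h' (ntimes k (elt [x, f x, f (f x)]))"
    unfolding h' wk ntimes_elt ..
  then have "u = inn (h' + h) (ntimes k \<delta>) \<or> u = inn (h' + h) (- ntimes k \<delta>)"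
    using h by (auto simp: inn_ntimes[symmetric] inn_inn ntimes_uminus)
  then show ?thesis using k unfolding \<delta>_def by blast
qed

section \<open>Magnus coefficients\<close>

text \<open>Magnus coefficients: the letters are sent alternately to the factors \<open>1 + X\<^sub>l\<close> and
  \<open>(1 + X\<^sub>l)\<^sup>-\<^sup>1\<close> of the free associative algebra, starting with the former if the flag is set,
  and a list of linear functionals of the \<open>X\<^sub>l\<close> selects a combination of the coefficients of the
  monomials of that degree. The second recursive call solves \<open>(1 + X\<^sub>l) E = D\<close> for \<open>E\<close>.\<close>

fun magnus :: "bool \<Rightarrow> ('a \<Rightarrow> real) list \<Rightarrow> 'a list \<Rightarrow> real" where
  "magnus s [] u = 1"
| "magnus s (f # w) [] = 0"
| "magnus True (f # w) (l # u) = magnus False (f # w) u + f l * magnus False w u"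
| "magnus False (f # w) (l # u) = magnus True (f # w) u - f l * magnus False w (l # u)"

text \<open>The exponents alternate for this reason: a letter is its own inverse but
  \<open>1 + X\<^sub>l\<close> is not, and two equal adjacent letters now stand for a factor and its
  inverse.\<close>

lemma magnus_cancel_pair: "magnus s w (l # l # u) = magnus s w u"
proof -
  have "magnus True w (l # l # u) = magnus True w u \<and> magnus False w (l # l # u) = magnus False w u"
    by (induction w arbitrary: u) (auto)
  then show ?thesis by (cases s) auto
qed

lemma magnus_push: "magnus s w (push l u) = magnus s w (l # u)"
  by (cases u) (auto simp: magnus_cancel_pair)

lemma magnus_Cons_cong:
  assumes "\<And>s w. magnus s w u = magnus s w v"
  shows "magnus s w (l # u) = magnus s w (l # v)"
proof (induction w)
  case (Cons f w)
  then show ?case by (cases s) (simp_all add: assms)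
qed simp

lemma magnus_foldr_push: "magnus s w (foldr push u v) = magnus s w (u @ v)"
proof (induction u arbitrary: s w)
  case (Cons l u)
  then show ?case using magnus_Cons_cong[of "foldr push u v" "u @ v"] by (simp add: magnus_push)
qed simp

text \<open>The degree is distributed over the two factors. The alternation continues through
  \<open>v\<close>, so its starting flag is \<open>s\<close> after an even \<open>u\<close> and the
  opposite after an odd one.\<close>

lemma magnus_append:
  "magnus s w (u @ v) = (\<Sum>k\<le>length w. magnus s (take k w) u * magnus (s = even (length u)) (drop k w) v)"
proof (induction u arbitrary: s w)
  case Nil
  have "magnus s (take k w) [] = (if k = 0 then 1 else 0)" if "k \<le> length w" for k
    using that by (cases w; cases k) auto
  then have "(\<Sum>k\<le>length w. magnus s (take k w) [] * magnus s (drop k w) v)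
      = (\<Sum>k\<le>length w. if k = 0 then magnus s w v else 0)"
    by (intro sum.cong) auto
  then show ?case by simp
next
  case (Cons l u)
  note IHu = Cons.IH
  show ?case
  proof (induction w)
    case Nil
    show ?case by simp
  next
    case (Cons f w)
    let ?M = "\<lambda>s k. magnus (s = even (length u)) (drop k w) v"
    have flag: "(s = even (length (l # u))) = ((\<not> s) = even (length u))" by auto
    have shift: "(\<Sum>k\<le>length (f # w). magnus s (take k (f # w)) (l # u) *
          magnus (s = even (length (l # u))) (drop k (f # w)) v) =
        magnus ((\<not> s) = even (length u)) (f # w) v +
        (\<Sum>k\<le>length w. magnus s (f # take k w) (l # u) * ?M (\<not> s) k)"
      unfolding flag by (simp add: sum.atMost_Suc_shift del: sum.atMost_Suc)
    have IH: "magnus (\<not> s) (f # w) (u @ v) = magnus ((\<not> s) = even (length u)) (f # w) v +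
        (\<Sum>k\<le>length w. magnus (\<not> s) (f # take k w) u * ?M (\<not> s) k)"
      unfolding IHu by (simp add: sum.atMost_Suc_shift del: sum.atMost_Suc)
    show ?case
    proof (cases s)
      case True
      have "magnus True (f # w) (l # u @ v) = magnus False (f # w) (u @ v) + f l * magnus False w (u @ v)"
        by simp
      then show ?thesis
        using IH IHu[of False w] unfolding shift
        by (simp add: True ring_distribs sum.distrib sum_distrib_left ac_simps)
    next
      case False
      have "magnus False (f # w) (l # u @ v) = magnus True (f # w) (u @ v) - f l * magnus False w (l # u @ v)"
        by simp
      then show ?thesis
        using IH Cons.IH unfolding shift
        by (simp add: False ring_distribs sum.distrib sum_distrib_left sum_subtractf ac_simps)
    qed
  qed
qed


lemma magnus_add:
  "magnus s w (word (u + v)) = (\<Sum>k\<le>length w. magnus s (take k w) (word u) *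
     magnus (s = even (length (word u))) (drop k w) (word v))"
  by (simp add: plus_ucox.rep_eq magnus_foldr_push magnus_append)

lemma magnus_multilinear:
  "magnus s (w @ (\<lambda>l. \<Sum>i<n. m i * b i l) # w') u = (\<Sum>i<(n::nat). m i * magnus s (w @ b i # w') u)"
proof (induction w arbitrary: s u)
  case Nil
  show ?case
  proof (induction u arbitrary: s)
    case (Cons l u)
    then show ?case
      by (cases s) (simp_all add: sum.distrib sum_subtractf sum_distrib_left sum_distrib_right
          ring_distribs ac_simps)
  qed simp
next
  case (Cons f w)
  note IHw = Cons.IH
  show ?case
  proof (induction u arbitrary: s)
    case (Cons l u)
    then show ?case using IHw
      by (cases s) (simp_all add: sum.distrib sum_subtractf sum_distrib_left ring_distribs ac_simps)
  qed simp
qed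

definition indic :: "'a \<Rightarrow> 'a \<Rightarrow> real" where
  "indic i l = (if i = l then 1 else 0)"

text \<open>Neighbouring letters of the monomial differ, so of the series
  \<open>(1 + X\<^sub>l)\<^sup>-\<^sup>1\<close> only the terms of degree at most one
  contribute.\<close>

lemma magnus_indic_Cons:
  assumes "distinct_adj (i # v)"
  shows "magnus s (map indic (i # v)) (l # u) = magnus (\<not> s) (map indic (i # v)) u +
    (if i = l then (if s then magnus False (map indic v) u else - magnus True (map indic v) u) else 0)"
proof -
  have "magnus False (map indic v) (l # u) = magnus True (map indic v) u" if "i = l"
    using assms that by (cases v) (auto simp: indic_def)
  then show ?thesis by (cases s) (auto simp: indic_def)
qed

lemma magnus_indic_long: "distinct_adj v \<Longrightarrow> length u < length v \<Longrightarrow> magnus s (map indic v) u = 0"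
proof (induction u arbitrary: s v)
  case Nil
  then show ?case by (cases v) auto
next
  case (Cons l u)
  then obtain i v' where v: "v = i # v'" by (cases v) auto
  then show ?case using Cons.IH[of v] Cons.IH[of v'] Cons.prems magnus_indic_Cons[of i v' s l u]
      distinct_adj_ConsD by fastforce
qed

text \<open>The monomial spelled by the reduced word arises only by taking one variable from every
  factor, since a shorter word cannot produce it.\<close>

lemma magnus_indic_self: "distinct_adj u \<Longrightarrow> \<bar>magnus s (map indic u) u\<bar> = 1"
proof (induction u arbitrary: s)
  case (Cons l u)
  then have "\<bar>magnus s (map indic u) u\<bar> = 1" for s by (blast dest: distinct_adj_ConsD)
  moreover have "magnus s (map indic (l # u)) u = 0" for s
    using Cons.prems by (intro magnus_indic_long) auto
  ultimately show ?case using magnus_indic_Cons[OF Cons.prems] by simp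
qed simp

text \<open>Injectivity of the Magnus map relative to any spanning functionals: if all coefficients
  in terms of \<open>b\<close> vanished, multilinearity would replace them one after the other by
  the indicators of the letters of \<open>u\<close>, whose coefficient is 1 or -1.\<close>

lemma magnus_separating:
  fixes u :: "'a ucox"
  assumes span: "\<And>g::'a \<Rightarrow> real. \<exists>m. \<forall>l. g l = (\<Sum>i<n. m i * b i l)" and "u \<noteq> 0"
  shows "\<exists>w. w \<noteq> [] \<and> set w \<subseteq> {..<n::nat} \<and> magnus True (map b w) (word u) \<noteq> 0"
proof (rule ccontr)
  assume "\<not> ?thesis"
  then have zero: "magnus True (map b w) (word u) = 0" if "w \<noteq> []" "set w \<subseteq> {..<n}" for w
    using that by blast
  have "magnus True (w1 @ map b w2) (word u) = 0" if "w1 @ map b w2 \<noteq> []" "set w2 \<subseteq> {..<n}" for w1 w2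
    using that
  proof (induction w1 arbitrary: w2 rule: rev_induct)
    case Nil
    then show ?case using zero by simp
  next
    case (snoc f w1)
    obtain m where "\<forall>l. f l = (\<Sum>i<n. m i * b i l)" using span by blast
    then have "f = (\<lambda>l. \<Sum>i<n. m i * b i l)" by auto
    moreover have "magnus True (w1 @ b i # map b w2) (word u) = 0" if "i < n" for i
      using snoc.IH[of "i # w2"] snoc.prems that by simp
    ultimately show ?case by (simp add: magnus_multilinear)
  qed
  from this[of "map indic (word u)" "[]"] show False
    using magnus_indic_self[of "word u" True] \<open>u \<noteq> 0\<close> by simp
qed

definition lists_upto :: "nat \<Rightarrow> nat \<Rightarrow> nat list set" where
  "lists_upto n N = {v. set v \<subseteq> {..<n} \<and> length v \<le> N}"

lemma finite_lists_upto [simp]: "finite (lists_upto n N)"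
  unfolding lists_upto_def by (rule finite_lists_length_le) simp

lemma Nil_in_lists_upto [simp]: "[] \<in> lists_upto n N"
  by (simp add: lists_upto_def)

lemma sum_lists_upto_Suc:
  "(\<Sum>v\<in>lists_upto n (Suc N). g v) = g [] + (\<Sum>j<n. \<Sum>v\<in>lists_upto n N. g (j # v) :: real)"
proof -
  have eq: "lists_upto n (Suc N) = insert [] ((\<lambda>(j, v). j # v) ` ({..<n} \<times> lists_upto n N))"
  proof (intro equalityI subsetI)
    fix v assume "v \<in> lists_upto n (Suc N)"
    then show "v \<in> insert [] ((\<lambda>(j, v). j # v) ` ({..<n} \<times> lists_upto n N))"
      by (cases v) (auto simp: lists_upto_def)
  qed (auto simp: lists_upto_def)
  have "sum g ((\<lambda>(j, v). j # v) ` ({..<n} \<times> lists_upto n N)) =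
      (\<Sum>(j, v)\<in>{..<n} \<times> lists_upto n N. g (j # v))"
    by (subst sum.reindex) (auto simp: inj_on_def intro!: sum.cong)
  then show ?thesis unfolding eq
    by (subst sum.insert) (auto simp: sum.cartesian_product)
qed

text \<open>The matrix of a substitution on monomials: the row \<open>m w\<close> expands the coefficient of the
  monomial \<open>w\<close> in the image of \<open>1 + X\<^sub>l\<close>.\<close>

primrec subst_coeff :: "(nat list \<Rightarrow> nat \<Rightarrow> real) \<Rightarrow> nat list \<Rightarrow> nat list \<Rightarrow> real" where
  "subst_coeff m [] w = (if w = [] then 1 else 0)"
| "subst_coeff m (j # v) w = (\<Sum>k = 1..length w. m (take k w) j * subst_coeff m v (drop k w))"

lemma subst_coeff_long: "length w < length v \<Longrightarrow> subst_coeff m v w = 0"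
  by (induction v arbitrary: w) (auto intro!: sum.neutral)

text \<open>Both sides obey the same recursion when a letter is put in front of \<open>u\<close>.
  Images of letters have odd length, so the alternation of flags survives; and whenever such an
  image contributes a positive degree, the rest of the monomial is shorter, hence the outer
  induction on \<open>length w\<close>.\<close>

lemma magnus_add_hom:
  fixes \<theta> :: "'a ucox \<Rightarrow> 'a ucox"
  assumes \<theta>: "add_hom \<theta>" and odd: "\<And>l. odd (length (word (\<theta> (gen l))))"
    and m: "\<And>w l. w \<noteq> [] \<Longrightarrow> magnus True (map b w) (word (\<theta> (gen l))) = (\<Sum>j<n. m w j * b j l)"
    and "length w \<le> N"
  shows "magnus s (map b w) (word (\<theta> u)) =
    (\<Sum>v\<in>lists_upto n N. subst_coeff m v w * magnus s (map b v) (word u))"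
  using \<open>length w \<le> N\<close>
proof (induction "length w" arbitrary: w N s u rule: less_induct)
  case less
  show ?case
  proof (cases "w = []")
    case True
    have "subst_coeff m v [] = (if v = [] then 1 else 0)" for v by (cases v) auto
    then have "(\<Sum>v\<in>lists_upto n N. subst_coeff m v w * magnus s (map b v) (word u)) =
        (\<Sum>v\<in>lists_upto n N. if v = [] then 1 else 0)"
      using True by (intro sum.cong) auto
    then show ?thesis using True by simp
  next
    case False
    then obtain N' where N': "N = Suc N'" using less.prems by (cases N) auto
    define F where "F s u = (\<Sum>v\<in>lists_upto n N. subst_coeff m v w * magnus s (map b v) (word u))" for s u
    define X where "X l u = (\<Sum>k = 1..length w. magnus True (map b (take k w)) (word (\<theta> (gen l))) *
        magnus False (map b (drop k w)) (word (\<theta> u)))" for l u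
    have split: "(\<Sum>k\<le>length w. g k) = g 0 + (\<Sum>k = 1..length w. g k)" for g :: "nat \<Rightarrow> real"
      by (simp add: atMost_atLeast0 sum.atLeast_Suc_atMost)
    have stepG: "magnus True (map b w) (word (\<theta> (gen l + u))) = magnus False (map b w) (word (\<theta> u)) + X l u"
      for l u
      by (simp add: add_hom_add[OF \<theta>] magnus_add odd split X_def take_map drop_map)
    have push: "magnus True (map b (j # v)) (word (gen l + u)) =
        magnus False (map b (j # v)) (word u) + b j l * magnus False (map b v) (word u)" for l u j v
      by (simp add: word_gen_add magnus_push)
    have stepF: "F True (gen l + u) = F False u + X l u" for l u
    proof -
      have "X l u = (\<Sum>k = 1..length w. (\<Sum>j<n. m (take k w) j * b j l) *
          (\<Sum>v\<in>lists_upto n N'. subst_coeff m v (drop k w) * magnus False (map b v) (word u)))"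
        unfolding X_def
      proof (intro sum.cong HOL.refl arg_cong2[where f = "(*)"])
        fix k assume k: "k \<in> {1..length w}"
        show "magnus True (map b (take k w)) (word (\<theta> (gen l))) = (\<Sum>j<n. m (take k w) j * b j l)"
          using k False by (intro m) auto
        show "magnus False (map b (drop k w)) (word (\<theta> u)) =
          (\<Sum>v\<in>lists_upto n N'. subst_coeff m v (drop k w) * magnus False (map b v) (word u))"
          using k False N' less.prems by (intro less.hyps) auto
      qed
      also have "\<dots> = (\<Sum>k = 1..length w. \<Sum>j<n. \<Sum>v\<in>lists_upto n N'. m (take k w) j *
          subst_coeff m v (drop k w) * (b j l * magnus False (map b v) (word u)))"
        by (simp add: sum_product ac_simps)
      also have "\<dots> = (\<Sum>j<n. \<Sum>k = 1..length w. \<Sum>v\<in>lists_upto n N'. m (take k w) j *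
          subst_coeff m v (drop k w) * (b j l * magnus False (map b v) (word u)))"
        by (rule sum.swap)
      also have "\<dots> = (\<Sum>j<n. \<Sum>v\<in>lists_upto n N'. \<Sum>k = 1..length w. m (take k w) j *
          subst_coeff m v (drop k w) * (b j l * magnus False (map b v) (word u)))"
        by (intro sum.cong HOL.refl sum.swap)
      also have "\<dots> = (\<Sum>j<n. \<Sum>v\<in>lists_upto n N'. subst_coeff m (j # v) w *
          (b j l * magnus False (map b v) (word u)))"
        by (simp add: sum_distrib_right)
      finally have X: "X l u = (\<Sum>j<n. \<Sum>v\<in>lists_upto n N'. subst_coeff m (j # v) w *
          (b j l * magnus False (map b v) (word u)))" .
      show ?thesis
        unfolding F_def N' sum_lists_upto_Suc push X
        by (simp add: ring_distribs sum.distrib del: subst_coeff.simps(2) list.map(2))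
    qed
    have "\<forall>s. magnus s (map b w) (word (\<theta> u)) = F s u"
    proof (induction u rule: ucox_induct)
      case zero
      have "magnus s (map b v) [] = (if v = [] then 1 else 0)" for v s by (cases v) auto
      then have "F s 0 = (\<Sum>v\<in>lists_upto n N. if v = [] then subst_coeff m v w else 0)" for s
        unfolding F_def by (intro sum.cong) auto
      then show ?case using False
        by (cases w) (auto simp: add_hom_zero[OF \<theta>])
    next
      case (gen_add l u)
      \<comment> \<open>The recursion concerns the flag \<open>True\<close> only. For
        \<open>False\<close> it is read backwards, from
        \<open>u = gen l + (gen l + u)\<close>.\<close>
      have "magnus True (map b w) (word (\<theta> u)) = magnus False (map b w) (word (\<theta> (gen l + u))) + X l (gen l + u)"
        using stepG[of l "gen l + u"] by simp
      moreover have "F True u = F False (gen l + u) + X l (gen l + u)"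
        using stepF[of l "gen l + u"] by simp
      ultimately have "magnus False (map b w) (word (\<theta> (gen l + u))) = F False (gen l + u)"
        using gen_add.IH by simp
      moreover have "magnus True (map b w) (word (\<theta> (gen l + u))) = F True (gen l + u)"
        using stepG stepF gen_add.IH by simp
      ultimately show ?case by (metis (full_types))
    qed
    then show ?thesis by (simp add: F_def)
  qed
qed

text \<open>A substitution without constant terms never lowers the degree, and in equal degree only
  its linear part acts, which is triangular letter by letter. The order by length and then
  lexicographically fits both facts.\<close>

lemma subst_coeff_triangular:
  assumes "subst_coeff m v w \<noteq> 0" "set w \<subseteq> {..<n}"
    and m: "\<And>i j. i < n \<Longrightarrow> i < j \<Longrightarrow> m [i] j = 0"
  shows "v = w \<or> (v, w) \<in> lenlex less_than"
  using assms(1,2)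
proof (induction v arbitrary: w)
  case Nil
  then show ?case by (auto split: if_splits)
next
  case (Cons j v)
  then obtain k where k: "k \<in> {1..length w}" "m (take k w) j \<noteq> 0" "subst_coeff m v (drop k w) \<noteq> 0"
    by (auto elim: sum.not_neutral_contains_not_neutral)
  have v: "v = drop k w \<or> (v, drop k w) \<in> lenlex less_than"
    using Cons k set_drop_subset[of k w] by blast
  then have len: "length v \<le> length w - k" by (metis length_drop lenlex_length order_refl)
  show ?case
  proof (cases "k = 1")
    case True
    then obtain i w' where w: "w = i # w'" using k by (cases w) auto
    then have "j \<le> i" using k True m Cons.prems by (auto simp: not_le[symmetric])
    then show ?thesis using v len w True by (auto simp: Cons_lenlex_iff)
  next
    case False
    then have "length (j # v) < length w" using k len by auto
    then show ?thesis by (auto simp: lenlex_conv)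
  qed
qed

text \<open>The least monomial with nonzero coefficient in \<open>u\<close> is an eigenvector of \<open>\<theta>\<close> with a real
  eigenvalue \<open>d\<close>, for which the hypothesis says \<open>d = 1 + d\<^sup>2\<close>.\<close>

lemma no_braid_relation_triangular:
  fixes \<theta> :: "'a ucox \<Rightarrow> 'a ucox" and n :: nat
  assumes \<theta>: "add_hom \<theta>" and odd: "\<And>l. odd (length (word (\<theta> (gen l))))"
    and span: "\<And>g::'a \<Rightarrow> real. \<exists>m. \<forall>l. g l = (\<Sum>i<n. m i * b i l)"
    and tri: "\<And>i. i < n \<Longrightarrow> \<exists>m. (\<forall>j>i. m j = 0) \<and>
      (\<forall>l. magnus True [b i] (word (\<theta> (gen l))) = (\<Sum>j<n. m j * b j l))"
    and even: "even (length (word u))"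
    and u: "\<theta> u = u + \<theta> (\<theta> u)"
  shows "u = 0"
proof (rule ccontr)
  assume "u \<noteq> 0"
  \<comment> \<open>Rows of single variables are taken from \<open>tri\<close>, all longer ones from
    \<open>span\<close>.\<close>
  have "\<exists>m. (\<forall>l. w \<noteq> [] \<longrightarrow> magnus True (map b w) (word (\<theta> (gen l))) = (\<Sum>j<n. m j * b j l)) \<and>
      (\<forall>i<n. w = [i] \<longrightarrow> (\<forall>j>i. m j = 0))" for w
  proof (cases "\<exists>i<n. w = [i]")
    case True
    then show ?thesis using tri by force
  next
    case False
    then show ?thesis using span[of "\<lambda>l. magnus True (map b w) (word (\<theta> (gen l)))"] by metis
  qed
  then obtain m where m: "\<And>w l. w \<noteq> [] \<Longrightarrow>
      magnus True (map b w) (word (\<theta> (gen l))) = (\<Sum>j<n. m w j * b j l)"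
    and m0: "\<And>i j. i < n \<Longrightarrow> i < j \<Longrightarrow> m [i] j = 0"
    by metis
  define c where "c w v = magnus True (map b w) (word v)" for w v
  define W where "W = {w. w \<noteq> [] \<and> set w \<subseteq> {..<n} \<and> c w u \<noteq> 0}"
  have "W \<noteq> {}" using magnus_separating[where n = n and b = b and u = u] span \<open>u \<noteq> 0\<close> unfolding W_def c_def by blast
  then obtain w where w: "w \<in> W" and min: "\<And>v. (v, w) \<in> lenlex less_than \<Longrightarrow> v \<notin> W"
    using wfE_min'[OF wf_lenlex[OF wf_less_than]] by metis
  have wn: "w \<noteq> []" "set w \<subseteq> {..<n}" "c w u \<noteq> 0" using w by (auto simp: W_def)
  define P where "P v \<longleftrightarrow> (\<forall>w'. w' \<noteq> [] \<and> set w' \<subseteq> {..<n} \<and> (w', w) \<in> lenlex less_than \<longrightarrow> c w' v = 0)"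
    for v
  have Pu: "P u" using min by (auto simp: P_def W_def)
  define d where "d = subst_coeff m w w"
  have expand: "c w' (\<theta> v) = subst_coeff m w' w' * c w' v"
    if "P v" "w' \<noteq> []" "set w' \<subseteq> {..<n}" "w' = w \<or> (w', w) \<in> lenlex less_than" for v w'
  proof -
    have "c w' (\<theta> v) = (\<Sum>x\<in>lists_upto n (length w'). subst_coeff m x w' * c x v)"
      unfolding c_def by (rule magnus_add_hom[OF \<theta> odd m order_refl])
    also have "\<dots> = (\<Sum>x\<in>lists_upto n (length w'). if x = w' then subst_coeff m x w' * c x v else 0)"
    proof (intro sum.cong HOL.refl)
      fix x assume x: "x \<in> lists_upto n (length w')"
      show "subst_coeff m x w' * c x v = (if x = w' then subst_coeff m x w' * c x v else 0)"
      proof (cases "x = w' \<or> subst_coeff m x w' = 0")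
        case False
        then have "(x, w') \<in> lenlex less_than"
          using subst_coeff_triangular[of m x w' n] that(3) m0 by blast
        then have "(x, w) \<in> lenlex less_than"
          using that(4) by (auto intro: lenlex_trans)
        moreover have "x \<noteq> []" using False that(2) by auto
        ultimately show ?thesis using that(1) x by (auto simp: P_def lists_upto_def)
      qed auto
    qed
    also have "w' \<in> lists_upto n (length w')" using that by (simp add: lists_upto_def)
    then have "(\<Sum>x\<in>lists_upto n (length w'). if x = w' then subst_coeff m x w' * c x v else 0) =
        subst_coeff m w' w' * c w' v" by simp
    finally show ?thesis .
  qed
  have P\<theta>: "P (\<theta> v)" if "P v" for v
    unfolding P_def using expand[OF that] that by (auto simp: P_def)
  have "c w (u + \<theta> (\<theta> u)) = (\<Sum>k\<le>length w. c (take k w) u * c (drop k w) (\<theta> (\<theta> u)))"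
    using even by (simp add: c_def magnus_add take_map drop_map)
  \<comment> \<open>A proper nonempty prefix is smaller than the minimal monomial, so its
    coefficient in \<open>u\<close> vanishes and only the two trivial cuts remain.\<close>
  also have "\<dots> = (\<Sum>k\<in>{0, length w}. c (take k w) u * c (drop k w) (\<theta> (\<theta> u)))"
  proof (rule sum.mono_neutral_right)
    show "\<forall>k\<in>{..length w} - {0, length w}. c (take k w) u * c (drop k w) (\<theta> (\<theta> u)) = 0"
    proof
      fix k assume k: "k \<in> {..length w} - {0, length w}"
      then have "length (take k w) < length w" by auto
      then have "(take k w, w) \<in> lenlex less_than" by (auto simp: lenlex_conv)
      moreover have "take k w \<noteq> []" "set (take k w) \<subseteq> {..<n}"
        using k wn set_take_subset[of k w] by auto
      ultimately show "c (take k w) u * c (drop k w) (\<theta> (\<theta> u)) = 0" using Pu by (simp add: P_def)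
    qed
  qed auto
  also have "\<dots> = c w (\<theta> (\<theta> u)) + c w u"
    using wn(1) by (simp add: c_def)
  finally have "c w (\<theta> u) = c w (\<theta> (\<theta> u)) + c w u" using u by simp
  then have "d * c w u = d * (d * c w u) + c w u"
    using expand[OF Pu] expand[OF P\<theta>[OF Pu]] wn by (simp add: d_def)
  then have "c w u * (d * d - d + 1) = 0" by (simp add: algebra_simps)
  then have "d * d - d + 1 = 0" using wn by simp
  moreover have "d * d - d + 1 = (d - 1/2)\<^sup>2 + 3/4" by (simp add: power2_eq_square algebra_simps)
  ultimately show False using zero_le_power2[of "d - 1/2"] by linarith
qed

section \<open>The linear part of an automorphism\<close>

subsection \<open>Two by two integer matrices\<close>

datatype mat2 = Mat int int int int

instantiation mat2 :: ring_1
begin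
definition "0 = Mat 0 0 0 0"
definition "1 = Mat 1 0 0 1"
fun plus_mat2 where "Mat p q r s + Mat p' q' r' s' = Mat (p + p') (q + q') (r + r') (s + s')"
fun minus_mat2 where "Mat p q r s - Mat p' q' r' s' = Mat (p - p') (q - q') (r - r') (s - s')"
fun uminus_mat2 where "- Mat p q r s = Mat (- p) (- q) (- r) (- s)"
fun times_mat2 where "Mat p q r s * Mat p' q' r' s' =
  Mat (p * p' + q * r') (p * q' + q * s') (r * p' + s * r') (r * q' + s * s')"
instance
proof
  fix A B C :: mat2
  show "A * B * C = A * (B * C)" "(A + B) * C = A * C + B * C" "A * (B + C) = A * B + A * C"
    "A + B + C = A + (B + C)"
    by (cases A; cases B; cases C; simp add: algebra_simps)+
  show "A + B = B + A" "A - B = A + - B"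
    by (cases A; cases B; simp)+
  show "1 * A = A" "A * 1 = A" "0 + A = A" "- A + A = 0"
    by (cases A; simp add: one_mat2_def zero_mat2_def)+
  show "(0::mat2) \<noteq> 1"
    by (simp add: one_mat2_def zero_mat2_def)
qed
end

fun det :: "mat2 \<Rightarrow> int" where "det (Mat p q r s) = p * s - q * r"
fun tr :: "mat2 \<Rightarrow> int" where "tr (Mat p q r s) = p + s"

lemma det_mult: "det (A * B) = det A * det B"
  by (cases A; cases B) (simp add: algebra_simps)

lemma det_one [simp]: "det 1 = 1"
  by (simp add: one_mat2_def)

lemma tr_mult_commute: "tr (A * B) = tr (B * A)"
  by (cases A; cases B) (simp add: algebra_simps)

lemma tr_uminus [simp]: "tr (- A) = - tr A"
  by (cases A) simp

lemma tr_one [simp]: "tr 1 = 2"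
  by (simp add: one_mat2_def)

lemma cayley_hamilton:
  assumes "det A = 1"
  shows "tr A = 0 \<Longrightarrow> A * A = - 1" "tr A = 1 \<Longrightarrow> A * A = A - 1" "tr A = - 1 \<Longrightarrow> A * A = - A - 1"
proof -
  obtain p q r s where A: "A = Mat p q r s" by (cases A)
  have d: "p * s - q * r = 1" using assms A by simp
  show "tr A = 0 \<Longrightarrow> A * A = - 1"
  proof -
    assume "tr A = 0"
    then have "s = - p" using A by simp
    then have A': "A = Mat p q r (- p)" "p * (- p) - q * r = 1" using A d by simp_all
    then show ?thesis by (simp add: A'(1) one_mat2_def algebra_simps)
  qed
  show "tr A = 1 \<Longrightarrow> A * A = A - 1"
  proof -
    assume "tr A = 1"
    then have "s = 1 - p" using A by simp
    then have A': "A = Mat p q r (1 - p)" "p * (1 - p) - q * r = 1" using A d by simp_all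
    then show ?thesis by (simp add: A'(1) one_mat2_def algebra_simps)
  qed
  show "tr A = - 1 \<Longrightarrow> A * A = - A - 1"
  proof -
    assume "tr A = - 1"
    then have "s = - 1 - p" using A by simp
    then have A': "A = Mat p q r (- 1 - p)" "p * (- 1 - p) - q * r = 1" using A d by simp_all
    then show ?thesis by (simp add: A'(1) one_mat2_def algebra_simps)
  qed
qed

definition scalar :: "mat2 \<Rightarrow> bool" where
  "scalar A \<longleftrightarrow> (\<exists>k. A = Mat k 0 0 k)"

text \<open>Two matrices commute exactly when their vectors \<open>(p - s, q, r)\<close> are
  parallel, and being parallel to a common nonzero vector is transitive.\<close>

lemma commute_transitive:
  assumes "\<not> scalar C" "A * C = C * A" "B * C = C * B"
  shows "A * B = B * A"
proof -
  obtain p q r s where A: "A = Mat p q r s" by (cases A)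
  obtain p' q' r' s' where B: "B = Mat p' q' r' s'" by (cases B)
  obtain x y z w where C: "C = Mat x y z w" by (cases C)
  have 1: "q * z = y * r" "(p - s) * y = q * (x - w)" "(p - s) * z = r * (x - w)"
  proof -
    have "p * x + q * z = x * p + y * r" "p * y + q * w = x * q + y * s" "r * x + s * z = z * p + w * r"
      using assms(2) by (simp_all add: A C)
    then show "q * z = y * r" "(p - s) * y = q * (x - w)" "(p - s) * z = r * (x - w)" by algebra+
  qed
  have 2: "q' * z = y * r'" "(p' - s') * y = q' * (x - w)" "(p' - s') * z = r' * (x - w)"
  proof -
    have "p' * x + q' * z = x * p' + y * r'" "p' * y + q' * w = x * q' + y * s'"
      "r' * x + s' * z = z * p' + w * r'"
      using assms(3) by (simp_all add: B C)
    then show "q' * z = y * r'" "(p' - s') * y = q' * (x - w)" "(p' - s') * z = r' * (x - w)" by algebra+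
  qed
  have "y \<noteq> 0 \<or> z \<noteq> 0 \<or> x - w \<noteq> 0" using assms(1) by (auto simp: C scalar_def)
  moreover have "y * (q * r' - q' * r) = 0" "y * ((p - s) * q' - (p' - s') * q) = 0"
      "y * ((p - s) * r' - (p' - s') * r) = 0"
    using 1 2 by algebra+
  moreover have "z * (q * r' - q' * r) = 0" "z * ((p - s) * q' - (p' - s') * q) = 0"
      "z * ((p - s) * r' - (p' - s') * r) = 0"
    using 1 2 by algebra+
  moreover have "(x - w) * (q * r' - q' * r) = 0" "(x - w) * ((p - s) * q' - (p' - s') * q) = 0"
      "(x - w) * ((p - s) * r' - (p' - s') * r) = 0"
    using 1 2 by algebra+
  ultimately have "q * r' = q' * r" "(p - s) * q' = (p' - s') * q" "(p - s) * r' = (p' - s') * r"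
    by auto
  then show ?thesis by (simp add: A B algebra_simps)
qed

lemma scalar_commute: "scalar A \<Longrightarrow> A * B = B * A"
  by (cases B) (auto simp: scalar_def algebra_simps)

text \<open>The common power commutes with \<open>A\<close> and \<open>B\<close>, so it is scalar by
  \<open>commute_transitive\<close>. A nonscalar matrix with scalar square has trace zero; this
  settles \<open>B\<close>, and the formula for the cube then settles \<open>A\<close>.\<close>

lemma noncommuting_cube_eq_square:
  assumes det: "det A = 1" "det B = 1" and eq: "A * A * A = B * B" and nc: "A * B \<noteq> B * A"
  shows "tr A = 1" "tr B = 0" "B * B = - 1"
proof -
  obtain p q r s where A: "A = Mat p q r s" by (cases A)
  obtain p' q' r' s' where B: "B = Mat p' q' r' s'" by (cases B)
  have sc: "scalar (B * B)"
  proof (rule ccontr)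
    assume "\<not> ?thesis"
    moreover have "A * (B * B) = (B * B) * A" unfolding eq[symmetric] by (simp add: mult.assoc)
    ultimately show False using nc commute_transitive[of "B * B" A B] by (simp add: mult.assoc)
  qed
  have nA: "\<not> scalar A" and nB: "\<not> scalar B" using nc scalar_commute by metis+
  have dB: "p' * s' - q' * r' = 1" and dA: "p * s - q * r = 1" using det A B by simp_all
  have "q' * (p' + s') = 0" "r' * (p' + s') = 0" "(p' - s') * (p' + s') = 0"
    using sc by (auto simp: B scalar_def algebra_simps)
  then show trB: "tr B = 0" using nB by (auto simp: B scalar_def)
  then show BB: "B * B = - 1" using cayley_hamilton det by blast
  have "A * A * A = - 1" using eq BB by simp
  \<comment> \<open>Cayley-Hamilton for determinant one: the cube is \<open>(t * t - 1)\<close>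
    times \<open>A\<close> minus \<open>t\<close>, where \<open>t\<close> is the trace.\<close>
  have A3: "A * A * A = Mat (((p+s)*(p+s) - 1) * p - (p+s)) (((p+s)*(p+s) - 1) * q)
      (((p+s)*(p+s) - 1) * r) (((p+s)*(p+s) - 1) * s - (p+s))"
  proof -
    have "q * r = p * s - 1" using dA by simp
    then show ?thesis unfolding A times_mat2.simps mat2.inject by algebra
  qed
  let ?t = "(p+s)*(p+s) - 1"
  have 0: "?t * q = 0" "?t * r = 0" "?t * p - (p+s) = -1" "?t * s - (p+s) = -1"
  proof -
    have "Mat (?t * p - (p+s)) (?t * q) (?t * r) (?t * s - (p+s)) = Mat (- 1) 0 0 (- 1)"
      using A3 \<open>A * A * A = - 1\<close> by (simp only: one_mat2_def uminus_mat2.simps minus_zero)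
    then show "?t * q = 0" "?t * r = 0" "?t * p - (p+s) = -1" "?t * s - (p+s) = -1"
      using mat2.inject by blast+
  qed
  then have "?t * p = ?t * s" by linarith
  have "?t = 0"
  proof (rule ccontr)
    assume "?t \<noteq> 0"
    then have "q = 0" "r = 0" "p = s"
      using 0(1,2) \<open>?t * p = ?t * s\<close> mult_eq_0_iff mult_cancel_left by metis+
    then show False using nA by (auto simp: A scalar_def)
  qed
  then show "tr A = 1" using 0 by (simp add: A)
qed

lemma real_eigen_functional:
  assumes "\<bar>tr (Mat p q r s)\<bar> \<ge> 2" "det (Mat p q r s) = 1"
  shows "\<exists>(x::real) y \<kappa>. (x \<noteq> 0 \<or> y \<noteq> 0) \<and> x * p + y * r = \<kappa> * x \<and> x * q + y * s = \<kappa> * y"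
proof -
  define t where "t = real_of_int (p + s)"
  define \<kappa> where "\<kappa> = (t + sqrt (t\<^sup>2 - 4)) / 2"
  have "\<bar>t\<bar> \<ge> 2" using assms unfolding t_def tr.simps by linarith
  then have "t\<^sup>2 \<ge> 4" using power_mono[of 2 "\<bar>t\<bar>" 2] by simp
  moreover have "2 * \<kappa> - t = sqrt (t\<^sup>2 - 4)" by (simp add: \<kappa>_def field_simps)
  ultimately have "(2 * \<kappa> - t)\<^sup>2 = t\<^sup>2 - 4" by simp
  then have l: "\<kappa> * \<kappa> = t * \<kappa> - 1" by (simp add: power2_eq_square algebra_simps)
  have "real_of_int (p * s - q * r) = 1" using assms by (simp only: det.simps)
  then have d: "real_of_int p * s - real_of_int q * r = 1" by simp
  have l': "\<kappa> * \<kappa> = (p + s) * \<kappa> - (real_of_int p * s - real_of_int q * r)"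
    using l d by (simp add: t_def)
  show ?thesis
  \<comment> \<open>The rows \<open>(r, \<kappa> - p)\<close> and \<open>(\<kappa> - s, q)\<close>
    are both left eigenvectors. If both vanish, the matrix is scalar and any row will do.\<close>
  proof (cases "r = 0 \<and> \<kappa> = p")
    case False
    show ?thesis
      using False l' by (intro exI[of _ "real_of_int r"] exI[of _ "\<kappa> - p"] exI[of _ \<kappa>])
        (auto simp: algebra_simps)
  next
    case True
    show ?thesis
    proof (cases "q = 0 \<and> \<kappa> = s")
      case False
      then show ?thesis
        using True l' by (intro exI[of _ "\<kappa> - s"] exI[of _ "real_of_int q"] exI[of _ \<kappa>])
          (auto simp: algebra_simps)
    next
      case q: True
      then show ?thesis using True by (intro exI[of _ 1] exI[of _ 0] exI[of _ \<kappa>]) auto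
    qed
  qed
qed

subsection \<open>The linear action on words of even length\<close>

text \<open>The alternating sum along a word is its Magnus coefficient of degree one, see
  \<open>magnus_single\<close>.\<close>

primrec alt :: "('a \<Rightarrow> 'b::ab_group_add) \<Rightarrow> 'a list \<Rightarrow> 'b" where
  "alt f [] = 0"
| "alt f (l # w) = f l - alt f w"

definition altu :: "('a \<Rightarrow> 'b::ab_group_add) \<Rightarrow> 'a ucox \<Rightarrow> 'b" where
  "altu f u = alt f (word u)"

lemma alt_append: "alt f (u @ v) = alt f u + (if even (length u) then alt f v else - alt f v)"
  by (induction u) auto

lemma alt_push: "alt f (push l w) = f l - alt f w"
  by (cases w) auto

definition odd_len :: "'a ucox \<Rightarrow> bool" where
  "odd_len u \<longleftrightarrow> odd (length (word u))"

lemma odd_len_push: "odd (length (push l w)) \<longleftrightarrow> even (length w)"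
  by (cases w) auto

lemma odd_len_add [simp]: "odd_len (u + v) \<longleftrightarrow> odd_len u \<noteq> odd_len v"
proof -
  have "odd (length (foldr push u v)) \<longleftrightarrow> odd (length u) \<noteq> odd (length v)" for u v :: "'a list"
    by (induction u) (auto simp: odd_len_push)
  then show ?thesis by (simp add: odd_len_def plus_ucox.rep_eq)
qed

lemma odd_len_simps [simp]: "odd_len (gen l)" "\<not> odd_len 0" "odd_len (- u) = odd_len u"
  by (simp_all add: odd_len_def)

lemma altu_add: "altu f (u + v) = altu f u + (if odd_len u then - altu f v else altu f v)"
proof -
  have "alt f (foldr push u v) = alt f (u @ v)" for u v
    by (induction u) (simp_all add: alt_push)
  then show ?thesis by (simp add: altu_def odd_len_def plus_ucox.rep_eq alt_append)
qed

lemma altu_simps [simp]: "altu f 0 = 0" "altu f (gen l) = f l"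
  by (simp_all add: altu_def)

definition parity_hom :: "(letter ucox \<Rightarrow> letter ucox) \<Rightarrow> bool" where
  "parity_hom \<theta> \<longleftrightarrow> add_hom \<theta> \<and> (\<forall>u. odd_len (\<theta> u) = odd_len u)"

lemma parity_homI:
  assumes "add_hom \<theta>" "\<And>l. odd_len (\<theta> (gen l))"
  shows "parity_hom \<theta>"
proof -
  have "odd_len (\<theta> u) = odd_len u" for u
    by (induction u rule: ucox_induct) (simp_all add: assms add_hom_zero add_hom_add)
  then show ?thesis using assms by (simp add: parity_hom_def)
qed

definition fx :: "letter \<Rightarrow> 'b::comm_ring_1" where "fx l = of_bool (l = S2)"
definition fy :: "letter \<Rightarrow> 'b::comm_ring_1" where "fy l = of_bool (l = S3)"

lemma fxy_simps [simp]: "fx S1 = 0" "fx S2 = 1" "fx S3 = 0" "fy S1 = 0" "fy S2 = 0" "fy S3 = 1"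
  by (simp_all add: fx_def fy_def)

text \<open>In the picture of point reflections the homomorphism is affine: it is known from the
  images of the two translations and from the image of the base point \<open>gen S1\<close>, which
  only odd words see.\<close>

lemma altu_parity_hom:
  fixes f :: "letter \<Rightarrow> 'b::comm_ring_1"
  assumes "parity_hom \<theta>"
  shows "altu f (\<theta> u) = altu f (\<theta> (gen S2 + gen S1)) * altu fx u +
    altu f (\<theta> (gen S3 + gen S1)) * altu fy u + (if odd_len u then altu f (\<theta> (gen S1)) else 0)"
proof (induction u rule: ucox_induct)
  case zero
  then show ?case using assms by (simp add: parity_hom_def add_hom_zero)
next
  case (gen_add l u)
  have \<theta>: "add_hom \<theta>" "\<And>u. odd_len (\<theta> u) = odd_len u" using assms by (auto simp: parity_hom_def)
  show ?case
    by (cases l) (simp_all add: add_hom_add[OF \<theta>(1)] altu_add \<theta>(2) gen_add.IH algebra_simps)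
qed

text \<open>Letter \<open>l\<close> acts on the plane as the point reflection in half of \<open>(fx l, fy l)\<close>, so words of
  even length act as translations, and an automorphism acts linearly on their translation vectors.\<close>

definition mat :: "(letter ucox \<Rightarrow> letter ucox) \<Rightarrow> mat2" where
  "mat \<theta> = Mat (altu fx (\<theta> (gen S2 + gen S1))) (altu fx (\<theta> (gen S3 + gen S1)))
     (altu fy (\<theta> (gen S2 + gen S1))) (altu fy (\<theta> (gen S3 + gen S1)))"

lemma mat_comp:
  assumes "parity_hom \<theta>" "parity_hom \<eta>"
  shows "mat (\<theta> \<circ> \<eta>) = mat \<theta> * mat \<eta>"
proof -
  have "altu f (\<theta> (\<eta> (gen l + gen S1))) =
    altu f (\<theta> (gen S2 + gen S1)) * altu fx (\<eta> (gen l + gen S1)) +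
    altu f (\<theta> (gen S3 + gen S1)) * altu fy (\<eta> (gen l + gen S1))" for f :: "letter \<Rightarrow> int" and l
    using altu_parity_hom[OF assms(1), of f "\<eta> (gen l + gen S1)"] assms(2)
    by (simp add: parity_hom_def)
  then show ?thesis by (simp add: mat_def)
qed

lemma mat_inn: "mat (inn u) = (if odd_len u then - 1 else 1)"
proof -
  have "altu f (- u) = (if odd_len u then altu f u else - altu f u)" for f :: "letter \<Rightarrow> int"
    using altu_add[of f "- u" u] by (auto split: if_splits)
  then show ?thesis by (simp add: mat_def inn_def altu_add one_mat2_def del: add_uminus_conv_diff)
qed

lemma parity_hom_comp: "parity_hom \<theta> \<Longrightarrow> parity_hom \<eta> \<Longrightarrow> parity_hom (\<theta> \<circ> \<eta>)"
  by (simp add: parity_hom_def add_hom_comp)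

lemma parity_hom_aut: "parity_hom aut_e" "parity_hom aut_a" "parity_hom (inn u)" "parity_hom id"
proof -
  show "parity_hom aut_a"
  proof (rule parity_homI)
    fix l show "odd_len (aut_a (gen l))" by (cases l) simp_all
  qed (rule add_hom_aut)
qed (auto intro!: parity_homI add_hom_aut add_hom_inn add_hom_id simp: inn_def simp del: add_uminus_conv_diff)

lemma mat_aut: "mat aut_a = Mat 0 (- 1) 1 0" "mat aut_e = Mat (- 1) (- 1) 1 0" "mat id = 1"
  by (simp_all add: mat_def altu_add one_mat2_def)

lemma magnus_single: "magnus True [f] w = alt f w" "magnus False [f] w = - alt f w"
  by (induction w) auto

lemma no_braid_relation:
  assumes \<theta>: "parity_hom \<theta>" and tr: "\<bar>tr (mat \<theta>)\<bar> \<ge> 2" "det (mat \<theta>) = 1"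
    and u: "\<not> odd_len u" "\<theta> u = u + \<theta> (\<theta> u)"
  shows "u = 0"
proof -
  obtain p q r s where M: "mat \<theta> = Mat p q r s" by (cases "mat \<theta>")
  obtain x y \<kappa> :: real where xy: "x \<noteq> 0 \<or> y \<noteq> 0" "x * p + y * r = \<kappa> * x" "x * q + y * s = \<kappa> * y"
    using real_eigen_functional tr M by metis
  \<comment> \<open>The constant functional comes first and only records parity. The second is the
    eigenfunctional, and the third is orthogonal to it in the plane, so that the change of basis has
    determinant \<open>x * x + y * y\<close>. The last row of a triangular matrix of size three is
    unrestricted.\<close>
  define b :: "nat \<Rightarrow> letter \<Rightarrow> real" where
    "b i l = (if i = 0 then 1 else if i = 1 then x * fx l + y * fy l else - y * fx l + x * fy l)" for i l
  have sum3: "(\<Sum>i<3. g i) = g 0 + g 1 + g 2" for g :: "nat \<Rightarrow> real"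
    by (simp add: numeral_3_eq_3 numeral_2_eq_2)
  have xx: "x * x + y * y \<noteq> 0" using xy(1) by (simp add: sum_squares_eq_zero_iff)
  have span: "\<exists>m. \<forall>l. g l = (\<Sum>i<3. m i * b i l)" for g
  proof -
    define X where "X = g S2 - g S1"
    define Y where "Y = g S3 - g S1"
    define D where "D = x * x + y * y"
    define \<alpha> where "\<alpha> = (x * X + y * Y) / D"
    define \<beta> where "\<beta> = (x * Y - y * X) / D"
    have "(x * X + y * Y) * x - (x * Y - y * X) * y = X * D"
      "(x * X + y * Y) * y + (x * Y - y * X) * x = Y * D"
      unfolding D_def by algebra+
    then have *: "\<alpha> * x - \<beta> * y = X" "\<alpha> * y + \<beta> * x = Y"
      using xx by (simp_all add: \<alpha>_def \<beta>_def D_def flip: diff_divide_distrib add_divide_distrib)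
    show ?thesis
    proof (intro exI allI)
      fix l
      show "g l = (\<Sum>i<3. (if i = 0 then g S1 else if i = 1 then \<alpha> else \<beta>) * b i l)"
        using * by (cases l) (simp_all add: sum3 b_def X_def Y_def)
    qed
  qed
  show ?thesis
  proof (rule no_braid_relation_triangular[where \<theta> = \<theta> and n = 3 and b = b])
    show "add_hom \<theta>" using \<theta> by (simp add: parity_hom_def)
    show "odd (length (word (\<theta> (gen l))))" for l
      using \<theta> by (simp add: parity_hom_def flip: odd_len_def)
    show "even (length (word u))" using u by (simp add: odd_len_def)
    show "\<theta> u = u + \<theta> (\<theta> u)" by fact
    show "\<exists>m. \<forall>l. g l = (\<Sum>i<3. m i * b i l)" for g by (rule span)
    fix i :: nat assume i: "i < 3"
    consider "i = 0" | "i = 1" | "i = 2" using i by linarith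
    then show "\<exists>m. (\<forall>j>i. m j = 0) \<and> (\<forall>l. magnus True [b i] (word (\<theta> (gen l))) = (\<Sum>j<3. m j * b j l))"
    proof cases
      case 1
      have "alt (b 0) w = of_bool (odd (length w))" for w by (induction w) (auto simp: b_def)
      then have "magnus True [b 0] (word (\<theta> (gen l))) = 1" for l
        using \<theta> odd_len_simps(1) unfolding parity_hom_def odd_len_def magnus_single by auto
      then show ?thesis using 1
        by (intro exI[of _ "\<lambda>j. of_bool (j = 0)"]) (simp add: sum3 b_def)
    next
      case 2
      have of_int: "altu (fx :: letter \<Rightarrow> real) v = real_of_int (altu fx v)"
        "altu (fy :: letter \<Rightarrow> real) v = real_of_int (altu fy v)" for v
      proof -
        have "alt (fx :: letter \<Rightarrow> real) w = real_of_int (alt fx w)"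
          "alt (fy :: letter \<Rightarrow> real) w = real_of_int (alt fy w)" for w
          by (induction w) (auto simp: fx_def fy_def)
        then show "altu (fx :: letter \<Rightarrow> real) v = real_of_int (altu fx v)"
          "altu (fy :: letter \<Rightarrow> real) v = real_of_int (altu fy v)" by (simp_all add: altu_def)
      qed
      have lin: "altu (b 1) v = x * altu fx v + y * altu fy v" for v
      proof -
        have "alt (b 1) w = x * alt fx w + y * alt fy w" for w
          by (induction w) (auto simp: b_def algebra_simps)
        then show ?thesis by (simp add: altu_def)
      qed
      have "altu (b 1) (\<theta> (gen l)) = \<kappa> * b 1 l + altu (b 1) (\<theta> (gen S1))" for l
      proof -
        have "altu (b 1) (\<theta> (gen S2 + gen S1)) = \<kappa> * x" "altu (b 1) (\<theta> (gen S3 + gen S1)) = \<kappa> * y"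
          using M xy(2,3) by (simp_all add: lin mat_def of_int del: One_nat_def)
        then show ?thesis
          by (subst altu_parity_hom[OF \<theta>]) (simp add: b_def algebra_simps)
      qed
      then have "magnus True [b 1] (word (\<theta> (gen l))) = \<kappa> * b 1 l + altu (b 1) (\<theta> (gen S1))" for l
        unfolding magnus_single altu_def[symmetric] .
      then show ?thesis using 2
        by (intro exI[of _ "\<lambda>j. if j = 0 then altu (b 1) (\<theta> (gen S1)) else if j = 1 then \<kappa> else 0"])
          (simp add: sum3 b_def)
    next
      case 3
      obtain m where "\<forall>l. magnus True [b i] (word (\<theta> (gen l))) = (\<Sum>j<3. m j * b j l)"
        using span[of "\<lambda>l. magnus True [b i] (word (\<theta> (gen l)))"] by auto
      then show ?thesis using 3
        by (intro exI[of _ "\<lambda>j. if j < 3 then m j else 0"]) simp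
    qed
  qed
qed

section \<open>Groups acting like the braid group on four strands\<close>

definition conjugate :: "'a::group_add \<Rightarrow> 'a \<Rightarrow> bool" where
  "conjugate u v \<longleftrightarrow> (\<exists>g. u = inn g v)"

lemma conjugate_refl [simp]: "conjugate u u"
  unfolding conjugate_def by (metis inn_zero)

lemma conjugate_sym: "conjugate u v \<Longrightarrow> conjugate v u"
  unfolding conjugate_def by (metis inn_uminus_inn(1))

lemma conjugate_trans: "conjugate u v \<Longrightarrow> conjugate v w \<Longrightarrow> conjugate u w"
  unfolding conjugate_def by (metis inn_inn)

lemma conjugate_inn [simp]: "conjugate (inn g u) u"
  unfolding conjugate_def by blast

lemma conjugate_hom: "add_hom \<theta> \<Longrightarrow> conjugate u v \<Longrightarrow> conjugate (\<theta> u) (\<theta> v)"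
  unfolding conjugate_def by (metis add_hom_apply_inn)

lemma conjugate_slope: "conjugate u v \<Longrightarrow> v \<noteq> 0 \<Longrightarrow> slope u = slope v"
  by (auto simp: conjugate_def)

lemma inn_letter_eq_iff: "inn u = inn v \<longleftrightarrow> u = (v :: letter ucox)"
  by (rule inn_eq_iff) (rule third_letter)

lemma (in group) inv_cancel [simp]:
  "x \<in> carrier G \<Longrightarrow> y \<in> carrier G \<Longrightarrow> inv x \<otimes> (x \<otimes> y) = y"
  "x \<in> carrier G \<Longrightarrow> y \<in> carrier G \<Longrightarrow> x \<otimes> (inv x \<otimes> y) = y"
  by (simp_all flip: m_assoc)

text \<open>The elements \<open>a\<close> and \<open>e\<close> stand for \<open>\<alpha>\<^sub>4\<close> and \<open>\<beta>\<^sub>4\<close>.\<close>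

locale braid4 = group G for G (structure) +
  fixes a e :: 'a and act :: "'a \<Rightarrow> letter ucox \<Rightarrow> letter ucox" and deg :: "'a \<Rightarrow> int"
  assumes a_closed [simp]: "a \<in> carrier G" and e_closed [simp]: "e \<in> carrier G"
    and e_cube: "e \<otimes> e \<otimes> e = a \<otimes> a \<otimes> (a \<otimes> a)"
    and aa_eae: "a \<otimes> a \<otimes> (e \<otimes> a \<otimes> e) = e \<otimes> a \<otimes> e \<otimes> (a \<otimes> a)"
    and generated: "carrier G \<subseteq> generate G {a, e}"
    and act_mult: "\<And>x y. x \<in> carrier G \<Longrightarrow> y \<in> carrier G \<Longrightarrow> act (x \<otimes> y) = act x \<circ> act y"
    and act_one [simp]: "act \<one> = id"
    and act_a: "act a = aut_a" and act_e: "act e = aut_e"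
    and deg_mult: "\<And>x y. x \<in> carrier G \<Longrightarrow> y \<in> carrier G \<Longrightarrow> deg (x \<otimes> y) = deg x + deg y"
    and deg_a: "deg a = 3"
begin

lemma generators_induct [consumes 1, case_names one a inv_a e inv_e mult]:
  assumes "x \<in> carrier G" "P \<one>" "P a" "P (inv a)" "P e" "P (inv e)"
    "\<And>x y. x \<in> carrier G \<Longrightarrow> y \<in> carrier G \<Longrightarrow> P x \<Longrightarrow> P y \<Longrightarrow> P (x \<otimes> y)"
  shows "P x"
proof -
  have "x \<in> generate G {a, e}" using assms(1) generated by blast
  then show ?thesis
  proof (induction rule: generate.induct)
    case (eng x y)
    moreover have "generate G {a, e} \<subseteq> carrier G" by (intro generate_incl) auto
    ultimately show ?case using assms(7) by blast
  qed (use assms in auto)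
qed

lemma act_mult_apply: "x \<in> carrier G \<Longrightarrow> y \<in> carrier G \<Longrightarrow> act (x \<otimes> y) u = act x (act y u)"
  by (simp add: act_mult)

lemma act_inv_act [simp]:
  "x \<in> carrier G \<Longrightarrow> act (inv x) (act x u) = u" "x \<in> carrier G \<Longrightarrow> act x (act (inv x) u) = u"
  by (simp_all flip: act_mult_apply)

lemma act_inv_e: "act (inv e) u = aut_e (aut_e u)"
  using act_inv_act(1)[of e "aut_e (aut_e u)"] by (simp add: act_e aut_e_cube)

lemma act_inv_a: "act (inv a) u = inn (gen S1) (aut_a u)"
proof -
  have "aut_a (inn (gen S1) (aut_a u)) = u"
    by (simp add: aut_inn aut_a_square inn_inn)
  then show ?thesis
    using act_inv_act(1)[of a "inn (gen S1) (aut_a u)"] by (simp add: act_a)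
qed

lemma parity_hom_act: "x \<in> carrier G \<Longrightarrow> parity_hom (act x)"
proof (induction rule: generators_induct)
  case inv_a
  have "act (inv a) = inn (gen S1) \<circ> aut_a" by (simp add: fun_eq_iff act_inv_a)
  then show ?case using parity_hom_comp parity_hom_aut by metis
next
  case inv_e
  have "act (inv e) = aut_e \<circ> aut_e" by (simp add: fun_eq_iff act_inv_e)
  then show ?case using parity_hom_comp parity_hom_aut by metis
qed (simp_all only: act_one parity_hom_aut act_a act_e act_mult parity_hom_comp)

lemma add_hom_act: "x \<in> carrier G \<Longrightarrow> add_hom (act x)"
  using parity_hom_act by (simp add: parity_hom_def)

lemma act_inn: "x \<in> carrier G \<Longrightarrow> act x (inn u v) = inn (act x u) (act x v)"
  by (simp add: add_hom_apply_inn add_hom_act)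

lemma act_conj_inn:
  assumes "x \<in> carrier G" "y \<in> carrier G" "act y = inn u"
  shows "act (x \<otimes> y \<otimes> inv x) = inn (act x u)"
  using assms by (auto simp: fun_eq_iff act_mult_apply act_inn)

lemma deg_one [simp]: "deg \<one> = 0"
  using deg_mult[of \<one> \<one>] by simp

lemma deg_inv: "x \<in> carrier G \<Longrightarrow> deg (inv x) = - deg x"
  using deg_mult[of "inv x" x] by simp

definition zeta :: 'a where "zeta = a \<otimes> a \<otimes> (a \<otimes> a)"

lemma zeta_closed [simp]: "zeta \<in> carrier G"
  by (simp add: zeta_def)

lemma zeta_eq_e: "zeta = e \<otimes> e \<otimes> e"
  by (simp add: zeta_def e_cube)

lemma deg_zeta_pow: "deg (zeta [^] (k::int)) = 12 * k"
proof -
  have z: "deg zeta = 12" by (simp add: zeta_def deg_mult deg_a)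
  have nat: "deg (zeta [^] n) = 12 * int n" for n :: nat
    by (induction n) (simp_all add: deg_mult z)
  show ?thesis
    by (cases k rule: int_cases2) (simp_all add: int_pow_int int_pow_neg_int nat deg_inv)
qed

lemma zeta_commute:
  assumes "x \<in> carrier G"
  shows "zeta \<otimes> x = x \<otimes> zeta"
  using assms
proof (induction rule: generators_induct)
  case a
  show ?case by (simp add: zeta_def m_assoc)
next
  case e
  show ?case by (simp add: zeta_eq_e m_assoc)
next
  case inv_a
  have "zeta \<otimes> a = a \<otimes> zeta" by (simp add: zeta_def m_assoc)
  then show ?case by (metis a_closed inv_closed inv_solve_left inv_solve_right m_assoc m_closed zeta_closed)
next
  case inv_e
  have "zeta \<otimes> e = e \<otimes> zeta" by (simp add: zeta_eq_e m_assoc)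
  then show ?case by (metis e_closed inv_closed inv_solve_left inv_solve_right m_assoc m_closed zeta_closed)
next
  case (mult x y)
  then show ?case by (metis m_assoc zeta_closed)
qed simp

lemma zeta_pow_closed [simp]: "zeta [^] (k::int) \<in> carrier G"
  by simp

lemma zeta_pow_commute:
  assumes "x \<in> carrier G"
  shows "x \<otimes> zeta [^] (k::int) = zeta [^] k \<otimes> x"
proof -
  have nat: "x \<otimes> zeta [^] n = zeta [^] n \<otimes> x" for n :: nat
    by (induction n) (use assms zeta_commute[OF assms] in \<open>simp_all add: m_assoc[symmetric]\<close>,
      simp add: m_assoc)
  show ?thesis
  proof (cases k rule: int_cases2)
    case (nonneg n)
    then show ?thesis using nat by (simp add: int_pow_int)
  next
    case (nonpos n)
    have "x \<otimes> inv (zeta [^] n) = inv (zeta [^] n) \<otimes> x"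
      using nat[of n] assms
      by (metis inv_closed inv_solve_left inv_solve_right m_assoc m_closed nat_pow_closed zeta_closed)
    then show ?thesis using nonpos by (simp add: int_pow_neg_int)
  qed
qed

lemma zeta_pow_lcomm:
  assumes "x \<in> carrier G" "y \<in> carrier G"
  shows "x \<otimes> (zeta [^] (k::int) \<otimes> y) = zeta [^] k \<otimes> (x \<otimes> y)"
  using assms zeta_pow_commute[of x k] by (simp flip: m_assoc)

lemma zeta_pow_mult: "zeta [^] (k::int) \<otimes> zeta [^] (l::int) = zeta [^] (k + l)"
  by (simp add: int_pow_mult)

lemma zeta_pow_mult_assoc:
  "x \<in> carrier G \<Longrightarrow> zeta [^] (k::int) \<otimes> (zeta [^] (l::int) \<otimes> x) = zeta [^] (k + l) \<otimes> x"
  by (simp add: int_pow_mult m_assoc)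

text \<open>Equality modulo the center, kept as a relation on the group itself so that
  \<open>deg\<close> remains available to remove the ambiguity.\<close>

definition zeq :: "'a \<Rightarrow> 'a \<Rightarrow> bool" (infix "\<approx>" 50) where
  "x \<approx> y \<longleftrightarrow> (\<exists>k::int. x = zeta [^] k \<otimes> y)"

lemma zeq_refl [simp]: "x \<in> carrier G \<Longrightarrow> x \<approx> x"
  unfolding zeq_def by (intro exI[of _ 0]) simp

lemma zeq_sym: "x \<approx> y \<Longrightarrow> y \<in> carrier G \<Longrightarrow> y \<approx> x"
  unfolding zeq_def
proof (elim exE)
  fix k :: int assume "x = zeta [^] k \<otimes> y" "y \<in> carrier G"
  then show "\<exists>k::int. y = zeta [^] k \<otimes> x"
    by (intro exI[of _ "- k"]) (simp add: zeta_pow_mult_assoc)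
qed

lemma zeq_trans: "x \<approx> y \<Longrightarrow> y \<approx> z \<Longrightarrow> z \<in> carrier G \<Longrightarrow> x \<approx> z"
  unfolding zeq_def by (metis zeta_pow_mult_assoc)

lemma zeq_mult:
  assumes "x \<approx> x'" "y \<approx> y'" "x' \<in> carrier G" "y' \<in> carrier G"
  shows "x \<otimes> y \<approx> x' \<otimes> y'"
proof -
  obtain k l :: int where "x = zeta [^] k \<otimes> x'" "y = zeta [^] l \<otimes> y'"
    using assms by (auto simp: zeq_def)
  then have "x \<otimes> y = zeta [^] k \<otimes> (x' \<otimes> (zeta [^] l \<otimes> y'))"
    using assms(3,4) by (simp add: m_assoc)
  also have "x' \<otimes> (zeta [^] l \<otimes> y') = zeta [^] l \<otimes> (x' \<otimes> y')"
    using assms(3,4) by (rule zeta_pow_lcomm)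
  finally have "x \<otimes> y = zeta [^] (k + l) \<otimes> (x' \<otimes> y')"
    using assms(3,4) by (simp add: zeta_pow_mult_assoc)
  then show ?thesis by (auto simp: zeq_def)
qed

lemma zeq_closed: "x \<approx> y \<Longrightarrow> y \<in> carrier G \<Longrightarrow> x \<in> carrier G"
  by (auto simp: zeq_def)

lemma act_zeta_pow: "act (zeta [^] (k::int)) = id"
proof -
  have z: "act zeta = id" by (simp add: fun_eq_iff zeta_eq_e act_mult act_e aut_e_cube)
  then have nat: "act (zeta [^] n) = id" for n :: nat
    by (induction n) (simp_all add: act_mult)
  have "act (inv x) = id" if "x \<in> carrier G" "act x = id" for x
    using act_inv_act(1)[OF that(1)] that(2) by (simp add: fun_eq_iff)
  then show ?thesis using nat
    by (cases k rule: int_cases2) (simp_all add: int_pow_int int_pow_neg_int)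
qed

lemma act_zeq: "x \<approx> y \<Longrightarrow> y \<in> carrier G \<Longrightarrow> act x = act y"
  by (auto simp: zeq_def act_mult act_zeta_pow)

text \<open>Lifts of the inner automorphisms given by the letters, up to powers of the central element.\<close>

primrec T :: "letter \<Rightarrow> 'a" where
  "T S1 = a \<otimes> a"
| "T S2 = e \<otimes> (a \<otimes> a) \<otimes> inv e"
| "T S3 = inv e \<otimes> (a \<otimes> a) \<otimes> e"

primrec TW :: "letter list \<Rightarrow> 'a" where
  "TW [] = \<one>"
| "TW (l # w) = T l \<otimes> TW w"

lemma T_closed [simp]: "T l \<in> carrier G"
  by (cases l) simp_all

lemma TW_closed [simp]: "TW w \<in> carrier G"
  by (induction w) simp_all

lemma TW_append: "TW (v @ w) = TW v \<otimes> TW w"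
  by (induction v) (simp_all add: m_assoc)

lemma T_square: "T l \<otimes> T l = zeta"
proof (cases l)
  case S1
  then show ?thesis by (simp add: zeta_def)
next
  case S2
  have "T S2 \<otimes> T S2 = e \<otimes> zeta \<otimes> inv e" by (simp add: zeta_def m_assoc)
  then show ?thesis unfolding S2 zeta_commute[OF e_closed, symmetric] by (simp add: m_assoc)
next
  case S3
  have "T S3 \<otimes> T S3 = inv e \<otimes> zeta \<otimes> e" by (simp add: zeta_def m_assoc)
  then show ?thesis unfolding S3 zeta_commute[OF inv_closed[OF e_closed], symmetric] by (simp add: m_assoc)
qed

lemma act_T: "act (T l) = inn (gen l)"
proof -
  have 1: "act (a \<otimes> a) = inn (gen S1)" by (simp add: fun_eq_iff act_mult act_a aut_a_square)
  show ?thesis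
  proof (cases l)
    case S2
    then show ?thesis using act_conj_inn[OF e_closed _ 1] by (simp add: act_e)
  next
    case S3
    then show ?thesis using act_conj_inn[of "inv e", OF _ _ 1] by (simp add: act_inv_e)
  qed (use 1 in simp)
qed

lemma act_TW: "act (TW w) = inn (elt w)"
  by (induction w) (simp_all add: fun_eq_iff act_mult act_T inn_inn)

lemma TW_push: "TW (push l w) \<approx> T l \<otimes> TW w"
proof (cases w)
  case (Cons m v)
  show ?thesis
  proof (cases "l = m")
    case True
    then have "T l \<otimes> TW w = zeta [^] (1::int) \<otimes> TW v"
      using Cons T_square[of m] by (simp add: int_pow_1 flip: m_assoc)
    then have "T l \<otimes> TW w \<approx> TW v" unfolding zeq_def by blast
    then have "T l \<otimes> TW w \<approx> TW (push l w)" using Cons True by simp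
    then show ?thesis by (rule zeq_sym) simp
  qed (use Cons in simp)
qed simp

lemma TW_word_elt: "TW (word (elt w)) \<approx> TW w"
proof (induction w)
  case (Cons l w)
  have "TW (word (elt (l # w))) \<approx> T l \<otimes> TW (word (elt w))"
    using TW_push by (simp add: word_gen_add)
  moreover have "T l \<otimes> TW (word (elt w)) \<approx> T l \<otimes> TW w"
    using Cons by (intro zeq_mult) simp_all
  ultimately show ?case by (auto intro: zeq_trans)
qed simp

lemma TW_eq_one: "elt w = 0 \<Longrightarrow> TW w \<approx> \<one>"
  using TW_word_elt[of w] by (auto intro: zeq_sym)

text \<open>The elements acting as inner automorphisms. Words in the \<open>T l\<close> without
  inverses suffice, as each \<open>T l\<close> is inverse to itself up to
  \<open>zeta\<close>.\<close>

definition K :: "'a set" where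
  "K = {x. \<exists>w. x \<approx> TW w}"

lemma K_closed [simp]: "x \<in> K \<Longrightarrow> x \<in> carrier G"
  by (auto simp: K_def intro: zeq_closed)

lemma K_mult: "x \<in> K \<Longrightarrow> y \<in> K \<Longrightarrow> x \<otimes> y \<in> K"
proof -
  assume "x \<in> K" "y \<in> K"
  then obtain v w where "x \<approx> TW v" "y \<approx> TW w" by (auto simp: K_def)
  then have "x \<otimes> y \<approx> TW (v @ w)" unfolding TW_append by (intro zeq_mult) simp_all
  then show ?thesis by (auto simp: K_def)
qed

lemma zeta_pow_K [simp]: "zeta [^] (k::int) \<in> K"
proof -
  have "zeta [^] k \<approx> TW []" by (auto simp: zeq_def)
  then show ?thesis unfolding K_def by blast
qed

lemma zeta_K [simp]: "zeta \<in> K"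
  using zeta_pow_K[of 1] by (simp add: int_pow_1)

lemma one_K [simp]: "\<one> \<in> K"
  using zeta_pow_K[of 0] by simp

lemma T_K [simp]: "T l \<in> K"
proof -
  have "T l \<approx> TW [l]" by simp
  then show ?thesis unfolding K_def by blast
qed

lemma aa_K [simp]: "a \<otimes> a \<in> K"
  using T_K[of S1] by simp

lemma K_conj_aux:
  assumes x: "x \<in> carrier G" and T: "\<And>l. x \<otimes> T l \<otimes> inv x \<in> K" and k: "k \<in> K"
  shows "x \<otimes> k \<otimes> inv x \<in> K"
proof -
  obtain w and j :: int where k: "k = zeta [^] j \<otimes> TW w" using k by (auto simp: K_def zeq_def)
  have "x \<otimes> TW w \<otimes> inv x \<in> K"
  proof (induction w)
    case (Cons l w)
    have "x \<otimes> TW (l # w) \<otimes> inv x = (x \<otimes> T l \<otimes> inv x) \<otimes> (x \<otimes> TW w \<otimes> inv x)"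
      using x by (simp add: m_assoc)
    then show ?case using K_mult[OF T Cons] by simp
  qed (use x in simp)
  then have "zeta [^] j \<otimes> (x \<otimes> TW w \<otimes> inv x) \<in> K" using K_mult zeta_pow_K by blast
  moreover have "x \<otimes> (zeta [^] j \<otimes> TW w) = zeta [^] j \<otimes> (x \<otimes> TW w)"
    using x by (intro zeta_pow_lcomm) simp_all
  ultimately show ?thesis using x by (simp add: k m_assoc)
qed

lemma K_conj_e: "k \<in> K \<Longrightarrow> e \<otimes> k \<otimes> inv e \<in> K"
proof (rule K_conj_aux)
  fix l
  show "e \<otimes> T l \<otimes> inv e \<in> K"
  proof (cases l)
    case S1
    then show ?thesis using T_K[of S2] by simp
  next
    case S2
    \<comment> \<open>Conjugating twice by \<open>e\<close> is conjugating by its inverse; the two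
      factors \<open>zeta\<close> and \<open>inv zeta\<close> cancel.\<close>
    have "e \<otimes> e = zeta \<otimes> inv e" by (simp add: zeta_eq_e m_assoc)
    moreover have "inv e \<otimes> inv e = inv zeta \<otimes> e" 
      by (simp add: zeta_eq_e m_assoc inv_mult_group)
    moreover have "e \<otimes> T S2 \<otimes> inv e = (e \<otimes> e) \<otimes> (a \<otimes> a) \<otimes> (inv e \<otimes> inv e)"
      by (simp add: m_assoc)
    ultimately have "e \<otimes> T S2 \<otimes> inv e = zeta \<otimes> inv e \<otimes> (a \<otimes> a) \<otimes> (inv zeta \<otimes> e)" by simp
    also have "\<dots> = inv e \<otimes> (a \<otimes> a) \<otimes> (zeta \<otimes> (inv zeta \<otimes> e))"
      using zeta_commute[of "inv e \<otimes> (a \<otimes> a)"] by (simp add: m_assoc)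
    finally show ?thesis using S2 T_K[of S3] by simp
  next
    case S3
    have "e \<otimes> T S3 \<otimes> inv e = a \<otimes> a" by (simp add: m_assoc)
    then show ?thesis using S3 by simp
  qed
qed simp_all

text \<open>The relation \<open>aa_eae\<close> enters here: it lifts to the group the fact that
  \<open>aut_a\<close> sends \<open>S2\<close> to \<open>S3\<close>.\<close>

lemma T_conj_a: "a \<otimes> T S2 \<otimes> inv a = T S3"
proof -
  have "(e \<otimes> a \<otimes> e) \<otimes> (a \<otimes> a) = (a \<otimes> a) \<otimes> (e \<otimes> a \<otimes> e)" by (rule aa_eae[symmetric])
  then have "a \<otimes> e \<otimes> (a \<otimes> a) = inv e \<otimes> ((a \<otimes> a) \<otimes> (e \<otimes> a \<otimes> e))"
    by (simp add: m_assoc inv_solve_left)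
  then have "a \<otimes> e \<otimes> (a \<otimes> a) \<otimes> inv e \<otimes> inv a = inv e \<otimes> (a \<otimes> a) \<otimes> e"
    by (simp add: m_assoc)
  then show ?thesis by (simp add: m_assoc)
qed

lemma K_conj_a: "k \<in> K \<Longrightarrow> a \<otimes> k \<otimes> inv a \<in> K"
proof (rule K_conj_aux)
  fix l
  show "a \<otimes> T l \<otimes> inv a \<in> K"
  proof (cases l)
    case S1
    then show ?thesis by (simp add: m_assoc)
  next
    case S2
    then show ?thesis using T_K[of S3] T_conj_a by simp
  next
    case S3
    have "inv (a \<otimes> a) = inv zeta \<otimes> (a \<otimes> a)" by (simp add: zeta_def inv_mult_group m_assoc)
    then have "inv (a \<otimes> a) \<in> K" using K_mult[of "inv zeta" "a \<otimes> a"] zeta_pow_K[of "- 1"]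
      by (simp add: int_pow_neg int_pow_1)
    moreover have "a \<otimes> T S3 \<otimes> inv a = (a \<otimes> a) \<otimes> (T S2 \<otimes> inv (a \<otimes> a))"
      unfolding T_conj_a[symmetric] by (simp add: m_assoc inv_mult_group del: T.simps)
    ultimately show ?thesis using S3 K_mult[of "a \<otimes> a"] K_mult[of "T S2"] by (simp del: T.simps)
  qed
qed simp_all

lemma inv_a_eq: "inv a = inv zeta \<otimes> (a \<otimes> (a \<otimes> a))"
  by (simp add: zeta_def inv_mult_group m_assoc)

lemma inv_e_eq: "inv e = inv zeta \<otimes> (e \<otimes> e)"
  by (simp add: zeta_eq_e inv_mult_group m_assoc)

lemma inv_zeta_K [simp]: "inv zeta \<in> K"
  using zeta_pow_K[of "- 1"] by (simp add: int_pow_neg int_pow_1)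

lemma K_conj:
  assumes "x \<in> carrier G"
  shows "\<forall>k\<in>K. x \<otimes> k \<otimes> inv x \<in> K"
  using assms
proof (induction rule: generators_induct)
  case one
  then show ?case by simp
next
  case a
  then show ?case using K_conj_a by blast
next
  case e
  then show ?case using K_conj_e by blast
next
  case (mult x y)
  show ?case
  proof
    fix k assume "k \<in> K"
    then have "x \<otimes> (y \<otimes> k \<otimes> inv y) \<otimes> inv x \<in> K" using mult by blast
    then show "x \<otimes> y \<otimes> k \<otimes> inv (x \<otimes> y) \<in> K"
      using mult \<open>k \<in> K\<close> by (simp add: m_assoc inv_mult_group)
  qed
next
  case inv_a
  show ?case
  proof
    fix k assume k: "k \<in> K"
    \<comment> \<open>Up to the central \<open>zeta\<close> the inverse of \<open>a\<close> is its
      cube, so three conjugations by \<open>a\<close> do the work of one by its inverse.\<close>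
    have "inv a \<otimes> k \<otimes> inv (inv a) = a \<otimes> (a \<otimes> (a \<otimes> k \<otimes> inv a) \<otimes> inv a) \<otimes> inv a"
    proof -
      have "a \<otimes> (a \<otimes> (a \<otimes> k \<otimes> inv a) \<otimes> inv a) \<otimes> inv a = (a \<otimes> (a \<otimes> a)) \<otimes> k \<otimes> inv (a \<otimes> (a \<otimes> a))"
        using k by (simp add: m_assoc inv_mult_group)
      also have "a \<otimes> (a \<otimes> a) = zeta \<otimes> inv a" by (simp add: zeta_def m_assoc)
      also have "zeta \<otimes> inv a \<otimes> k \<otimes> inv (zeta \<otimes> inv a) = zeta \<otimes> (inv a \<otimes> k \<otimes> a) \<otimes> inv zeta"
        using k by (simp add: m_assoc inv_mult_group)
      also have "\<dots> = inv a \<otimes> k \<otimes> a"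
        using k by (simp add: zeta_commute m_assoc)
      finally show ?thesis using k by simp
    qed
    then show "inv a \<otimes> k \<otimes> inv (inv a) \<in> K" using K_conj_a k by presburger
  qed
next
  case inv_e
  show ?case
  proof
    fix k assume k: "k \<in> K"
    have "inv e \<otimes> k \<otimes> inv (inv e) = e \<otimes> (e \<otimes> k \<otimes> inv e) \<otimes> inv e"
    proof -
      have "e \<otimes> (e \<otimes> k \<otimes> inv e) \<otimes> inv e = (e \<otimes> e) \<otimes> k \<otimes> inv (e \<otimes> e)"
        using k by (simp add: m_assoc inv_mult_group)
      also have "e \<otimes> e = zeta \<otimes> inv e" by (simp add: zeta_eq_e m_assoc)
      also have "zeta \<otimes> inv e \<otimes> k \<otimes> inv (zeta \<otimes> inv e) = zeta \<otimes> (inv e \<otimes> k \<otimes> e) \<otimes> inv zeta"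
        using k by (simp add: m_assoc inv_mult_group)
      also have "\<dots> = inv e \<otimes> k \<otimes> e"
        using k by (simp add: zeta_commute m_assoc)
      finally show ?thesis using k by simp
    qed
    then show "inv e \<otimes> k \<otimes> inv (inv e) \<in> K" using K_conj_e k by presburger
  qed
qed

lemma K_move:
  assumes "x \<in> carrier G" "k \<in> K"
  obtains k' where "k' \<in> K" "x \<otimes> k = k' \<otimes> x"
proof
  show "x \<otimes> k \<otimes> inv x \<in> K" using K_conj assms by blast
  show "x \<otimes> k = x \<otimes> k \<otimes> inv x \<otimes> x" using assms by (simp add: m_assoc)
qed

subsection \<open>Normal forms\<close>

text \<open>Representatives modulo \<open>K\<close>, where \<open>a\<close> has order two and
  \<open>e\<close> order three. \<open>D\<close> is an alternating product of \<open>a\<close> with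
  \<open>e\<close> or its square, \<open>E\<close> a power of \<open>e\<close> in front, and
  \<open>A\<close> an optional final \<open>a\<close>: the normal form in a free product of cyclic
  groups of orders two and three.\<close>

definition E :: "nat \<Rightarrow> 'a" where
  "E i = (if i = 0 then \<one> else if i = 1 then e else e \<otimes> e)"

definition A :: "bool \<Rightarrow> 'a" where
  "A j = (if j then a else \<one>)"

primrec D :: "bool list \<Rightarrow> 'a" where
  "D [] = \<one>"
| "D (b # bs) = a \<otimes> (E (if b then 1 else 2) \<otimes> D bs)"

lemma EAD_closed [simp]: "E i \<in> carrier G" "A j \<in> carrier G" "D bs \<in> carrier G"
  by (auto simp: E_def A_def) (induction bs, auto simp: E_def)

lemma D_append: "D (bs @ cs) = D bs \<otimes> D cs"
  by (induction bs) (simp_all add: m_assoc)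

definition NF :: "'a set" where
  "NF = {k \<otimes> (E i \<otimes> (D bs \<otimes> A j)) | k i bs j. k \<in> K \<and> i < 3}"

lemma K_NF: "k \<in> K \<Longrightarrow> x \<in> NF \<Longrightarrow> k \<otimes> x \<in> NF"
proof -
  assume k: "k \<in> K" "x \<in> NF"
  then obtain k' i bs j where "x = k' \<otimes> (E i \<otimes> (D bs \<otimes> A j))" "k' \<in> K" "i < 3"
    unfolding NF_def by blast
  then have "k \<otimes> x = (k \<otimes> k') \<otimes> (E i \<otimes> (D bs \<otimes> A j))" using k by (simp add: m_assoc)
  then show ?thesis unfolding NF_def using K_mult k \<open>k' \<in> K\<close> \<open>i < 3\<close> by blast
qed

lemma NF_I: "k \<in> K \<Longrightarrow> i < 3 \<Longrightarrow> k \<otimes> (E i \<otimes> (D bs \<otimes> A j)) \<in> NF"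
  unfolding NF_def by blast

lemma NF_closed: "x \<in> NF \<Longrightarrow> x \<in> carrier G"
  unfolding NF_def by auto

lemma e_NF: "x \<in> NF \<Longrightarrow> e \<otimes> x \<in> NF"
proof -
  assume "x \<in> NF"
  then obtain k i bs j where x: "x = k \<otimes> (E i \<otimes> (D bs \<otimes> A j))" "k \<in> K" "i < 3"
    unfolding NF_def by blast
  obtain k' where k': "k' \<in> K" "e \<otimes> k = k' \<otimes> e" using K_move[OF e_closed x(2)] .
  have "e \<otimes> x = (e \<otimes> k) \<otimes> (E i \<otimes> (D bs \<otimes> A j))" using x by (simp add: m_assoc)
  also have "\<dots> = k' \<otimes> ((e \<otimes> E i) \<otimes> (D bs \<otimes> A j))" using k' by (simp add: m_assoc)
  finally have eq: "e \<otimes> x = k' \<otimes> ((e \<otimes> E i) \<otimes> (D bs \<otimes> A j))" .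
  consider "i = 0" | "i = 1" | "i = 2" using x(3) by linarith
  then show ?thesis
  proof cases
    case 1
    then have "e \<otimes> E i = E 1" by (simp add: E_def)
    then show ?thesis using eq k' NF_I[of k' 1] by simp
  next
    case 2
    then have "e \<otimes> E i = E 2" by (simp add: E_def)
    then show ?thesis using eq k' NF_I[of k' 2] by simp
  next
    case 3
    then have "e \<otimes> E i = zeta \<otimes> E 0" by (simp add: E_def zeta_eq_e m_assoc)
    then have "e \<otimes> x = (k' \<otimes> zeta) \<otimes> (E 0 \<otimes> (D bs \<otimes> A j))" using eq k' by (simp add: m_assoc)
    then show ?thesis using K_mult[OF k'(1) zeta_K] NF_I[of _ 0] by simp
  qed
qed

lemma a_NF: "x \<in> NF \<Longrightarrow> a \<otimes> x \<in> NF"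
proof -
  assume "x \<in> NF"
  then obtain k i bs j where x: "x = k \<otimes> (E i \<otimes> (D bs \<otimes> A j))" "k \<in> K" "i < 3"
    unfolding NF_def by blast
  obtain k' where k': "k' \<in> K" "a \<otimes> k = k' \<otimes> a" using K_move[OF a_closed x(2)] .
  have "a \<otimes> x = (a \<otimes> k) \<otimes> (E i \<otimes> (D bs \<otimes> A j))" using x by (simp add: m_assoc)
  also have "\<dots> = k' \<otimes> (a \<otimes> (E i \<otimes> (D bs \<otimes> A j)))" using k' by (simp add: m_assoc)
  finally have eq: "a \<otimes> x = k' \<otimes> (a \<otimes> (E i \<otimes> (D bs \<otimes> A j)))" .
  have "a \<otimes> (E i \<otimes> (D bs \<otimes> A j)) \<in> NF"
  proof (cases "i = 0")
    case False
    then have "E i = E (if (i = 1) then 1 else 2)" using x(3) by (auto simp: E_def)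
    then have "a \<otimes> (E i \<otimes> (D bs \<otimes> A j)) = \<one> \<otimes> (E 0 \<otimes> (D ((i = 1) # bs) \<otimes> A j))"
      by (simp add: E_def[of 0] m_assoc)
    then show ?thesis using NF_I[OF one_K, of 0 "(i = 1) # bs" j] by (simp del: D.simps)
  next
    case i: True
    show ?thesis
    proof (cases bs)
      case (Cons b cs)
      have "a \<otimes> (E i \<otimes> (D bs \<otimes> A j)) = (a \<otimes> a) \<otimes> (E (if b then 1 else 2) \<otimes> (D cs \<otimes> A j))"
        using i Cons by (simp add: E_def[of 0] m_assoc)
      then show ?thesis using NF_I[OF aa_K, of "if b then 1 else 2"] by simp
    next
      case Nil
      show ?thesis
      proof (cases j)
        case True
        then have "a \<otimes> (E i \<otimes> (D bs \<otimes> A j)) = (a \<otimes> a) \<otimes> (E 0 \<otimes> (D [] \<otimes> A False))"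
          using i Nil by (simp add: E_def A_def)
        then show ?thesis using NF_I[OF aa_K, of 0 "[]" False] by simp
      next
        case False
        then have "a \<otimes> (E i \<otimes> (D bs \<otimes> A j)) = \<one> \<otimes> (E 0 \<otimes> (D [] \<otimes> A True))"
          using i Nil by (simp add: E_def A_def)
        then show ?thesis using NF_I[OF one_K, of 0 "[]" True] by simp
      qed
    qed
  qed
  then show ?thesis using eq k' K_NF by simp
qed

lemma carrier_NF:
  assumes "x \<in> carrier G"
  shows "x \<in> NF"
proof -
  have "\<forall>y\<in>NF. x \<otimes> y \<in> NF"
    using assms
  proof (induction rule: generators_induct)
    case inv_a
    show ?case
    proof
      fix y assume y: "y \<in> NF"
      then have "inv a \<otimes> y = inv zeta \<otimes> (a \<otimes> (a \<otimes> (a \<otimes> y)))"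
        using NF_closed by (subst inv_a_eq) (simp add: m_assoc)
      then show "inv a \<otimes> y \<in> NF" using y a_NF K_NF by simp
    qed
  next
    case inv_e
    show ?case
    proof
      fix y assume y: "y \<in> NF"
      then have "inv e \<otimes> y = inv zeta \<otimes> (e \<otimes> (e \<otimes> y))"
        using NF_closed by (subst inv_e_eq) (simp add: m_assoc)
      then show "inv e \<otimes> y \<in> NF" using y e_NF K_NF by simp
    qed
  next
    case (mult x y)
    then show ?case using NF_closed by (simp add: m_assoc)
  qed (use a_NF e_NF NF_closed in auto)
  moreover have "\<one> \<in> NF" using NF_I[of \<one> 0 "[]" False] by (simp add: E_def A_def)
  ultimately show ?thesis using assms by fastforce
qed

end

section \<open>The kernel of the action\<close>

context braid4
begin

definition mg :: "'a \<Rightarrow> mat2" where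
  "mg x = mat (act x)"

lemma mg_mult: "x \<in> carrier G \<Longrightarrow> y \<in> carrier G \<Longrightarrow> mg (x \<otimes> y) = mg x * mg y"
  by (simp only: mg_def act_mult mat_comp parity_hom_act)

lemma mg_one [simp]: "mg \<one> = 1"
  by (simp only: mg_def act_one mat_aut)

lemma mg_inv: "x \<in> carrier G \<Longrightarrow> mg x * mg (inv x) = 1" "x \<in> carrier G \<Longrightarrow> mg (inv x) * mg x = 1"
  by (simp_all flip: mg_mult)

lemma det_mg: "x \<in> carrier G \<Longrightarrow> det (mg x) = 1"
proof (induction rule: generators_induct)
  case a
  show ?case by (simp add: mg_def act_a mat_aut)
next
  case e
  show ?case by (simp add: mg_def act_e mat_aut)
next
  case inv_a
  have "det (mg a) = 1" by (simp add: mg_def act_a mat_aut)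
  then show ?case using arg_cong[OF mg_inv(1)[OF a_closed], of det] by (simp add: det_mult)
next
  case inv_e
  have "det (mg e) = 1" by (simp add: mg_def act_e mat_aut)
  then show ?case using arg_cong[OF mg_inv(1)[OF e_closed], of det] by (simp add: det_mult)
qed (simp_all add: mg_mult det_mult)

lemma act_K:
  assumes "k \<in> K"
  obtains w where "k \<approx> TW w" "act k = inn (elt w)"
  using assms act_zeq act_TW unfolding K_def by fastforce

lemma mg_K: "k \<in> K \<Longrightarrow> mg k = 1 \<or> mg k = - 1"
  by (erule act_K) (auto simp: mg_def mat_inn)

definition positive :: "mat2 \<Rightarrow> bool" where
  "positive M \<longleftrightarrow> (\<exists>p q r s. M = Mat p q r s \<and> p \<ge> 1 \<and> q \<ge> 0 \<and> r \<ge> 0 \<and> s \<ge> 1)"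

text \<open>Up to sign the blocks of \<open>D\<close> have the matrices \<open>Mat 1 0 1 1\<close>
  and \<open>Mat 1 1 0 1\<close>. Multiplying a positive matrix by one of them keeps it positive and
  leaves a nonzero entry off the diagonal.\<close>

lemma mg_D:
  "\<exists>M. (mg (D bs) = M \<or> mg (D bs) = - M) \<and> positive M \<and> (M = 1 \<longrightarrow> bs = [])"
proof (induction bs)
  case Nil
  show ?case by (intro exI[of _ 1]) (auto simp: positive_def one_mat2_def)
next
  case (Cons b bs)
  then obtain M where M: "mg (D bs) = M \<or> mg (D bs) = - M" "positive M" by blast
  define N where "N = (if b then Mat 1 0 1 1 else Mat 1 1 0 1)"
  have "mg a * mg (E (if b then 1 else 2)) = N \<or> mg a * mg (E (if b then 1 else 2)) = - N"
    by (simp add: E_def mg_mult mg_def[of a] mg_def[of e] act_a act_e mat_aut N_def)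
  then have "mg (D (b # bs)) = N * M \<or> mg (D (b # bs)) = - (N * M)"
    using M(1) by (auto simp: mg_mult simp flip: mult.assoc)
  moreover have "positive (N * M)" "N * M \<noteq> 1"
    using M(2) by (auto simp: N_def positive_def one_mat2_def)
  ultimately show ?case by blast
qed

lemma mg_scalar_imp_K:
  assumes x: "x \<in> carrier G" and m: "mg x = 1 \<or> mg x = - 1"
  shows "x \<in> K"
proof -
  obtain k i bs j where xk: "x = k \<otimes> (E i \<otimes> (D bs \<otimes> A j))" "k \<in> K" "i < 3"
    using carrier_NF[OF x] unfolding NF_def by blast
  obtain M where M: "mg (D bs) = M \<or> mg (D bs) = - M" "positive M" "M = 1 \<longrightarrow> bs = []"
    using mg_D by blast
  obtain p q r s where pq: "M = Mat p q r s" "p \<ge> 1" "q \<ge> 0" "r \<ge> 0" "s \<ge> 1"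
    using M(2) by (auto simp: positive_def)
  define Y where "Y = mg (E i) * (M * mg (A j))"
  have "mg x = mg k * (mg (E i) * (mg (D bs) * mg (A j)))"
    using xk by (simp add: mg_mult)
  moreover have "mg (E i) * (mg (D bs) * mg (A j)) = Y \<or> mg (E i) * (mg (D bs) * mg (A j)) = - Y"
    using M(1) by (auto simp: Y_def)
  ultimately have "mg x = Y \<or> mg x = - Y"
    using mg_K[OF xk(2)] by auto
  then have EMA: "mg (E i) * (M * mg (A j)) = 1 \<or> mg (E i) * (M * mg (A j)) = - 1"
    using m unfolding Y_def by (metis minus_minus)
  have mE: "mg (E i) = (if i = 0 then 1 else if i = 1 then Mat (- 1) (- 1) 1 0 else Mat 0 1 (- 1) (- 1))" for i
    by (simp add: E_def mg_mult mg_def[of e] act_e mat_aut)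
  have mA: "mg (A j) = (if j then Mat 0 (- 1) 1 0 else 1)" for j
    by (simp add: A_def mg_def[of a] act_a mat_aut)
  \<comment> \<open>In each of the other five cases an entry off the diagonal is, up to sign,
    \<open>p\<close>, \<open>s\<close>, \<open>p + r\<close> or \<open>q + s\<close>, hence
    nonzero.\<close>
  have ij: "i = 0 \<and> \<not> j"
  proof (cases j)
    case True
    then show ?thesis using EMA pq xk(3) by (auto simp: mE mA one_mat2_def split: if_splits)
  next
    case False
    then show ?thesis using EMA pq xk(3) by (auto simp: mE mA one_mat2_def split: if_splits)
  qed
  then have "M = 1" using EMA pq by (auto simp: mE mA one_mat2_def)
  then show ?thesis using xk ij M(3) by (simp add: E_def A_def)
qed

text \<open>The trivial matrix puts \<open>x\<close> into \<open>K\<close>; as W has trivial center,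
  the word that lifts to \<open>x\<close> is trivial in W, and lifts of trivial words are powers of
  \<open>zeta\<close>.\<close>

lemma act_id_imp_zeta:
  assumes "x \<in> carrier G" "act x = id"
  shows "x \<approx> \<one>"
proof -
  have "x \<in> K" using assms by (intro mg_scalar_imp_K) (simp_all add: mg_def mat_aut(3))
  then obtain w where w: "x \<approx> TW w" "act x = inn (elt w)" by (rule act_K)
  then have "inn (elt w) = inn 0" using assms by (simp add: fun_eq_iff)
  then have "elt w = 0" by (simp add: inn_letter_eq_iff)
  then show ?thesis using TW_eq_one w zeq_trans by blast
qed

lemma act_eq_imp_zeq:
  assumes "x \<in> carrier G" "y \<in> carrier G" "act x = act y"
  shows "x \<approx> y"
proof -
  have "act (x \<otimes> inv y) = id" using assms by (simp add: fun_eq_iff act_mult_apply)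
  then have "x \<otimes> inv y \<approx> \<one>" using assms by (intro act_id_imp_zeta) simp_all
  then have "x \<otimes> inv y \<otimes> y \<approx> \<one> \<otimes> y" using assms by (intro zeq_mult) simp_all
  then show ?thesis using assms by (simp add: m_assoc)
qed

lemma zeq_deg: "x \<approx> y \<Longrightarrow> y \<in> carrier G \<Longrightarrow> deg x = deg y \<Longrightarrow> x = y"
  by (auto simp: zeq_def deg_mult deg_zeta_pow)

text \<open>Conjugation keeps the degree and \<open>zeta [^] k\<close> has degree
  \<open>12 * k\<close>, so agreement up to the center is already equality.\<close>

lemma commuteI:
  assumes "x \<in> carrier G" "y \<in> carrier G" "act (x \<otimes> y \<otimes> inv x) = act y"
  shows "x \<otimes> y = y \<otimes> x"
proof -
  have "x \<otimes> y \<otimes> inv x = y"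
    using assms by (intro zeq_deg act_eq_imp_zeq) (simp_all add: deg_mult deg_inv)
  then show ?thesis using assms by (metis inv_closed inv_solve_right' m_closed)
qed

lemma K_inner: "k \<in> K \<Longrightarrow> \<exists>u. act k = inn u"
  by (meson act_K)

lemma inner_realized: "act (TW (word u)) = inn u"
  by (simp add: act_TW)

subsection \<open>Elliptic elements\<close>

definition conjK :: "'a \<Rightarrow> 'a \<Rightarrow> bool" where
  "conjK x n \<longleftrightarrow> (\<exists>h\<in>carrier G. \<exists>k\<in>K. x = h \<otimes> (k \<otimes> n) \<otimes> inv h)"

lemma conjK_absorb:
  assumes "conjK x (k \<otimes> n)" "k \<in> K" "n \<in> carrier G"
  shows "conjK x n"
proof -
  obtain h k' where "h \<in> carrier G" "k' \<in> K" "x = h \<otimes> (k' \<otimes> (k \<otimes> n)) \<otimes> inv h"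
    using assms(1) by (auto simp: conjK_def)
  then have "x = h \<otimes> ((k' \<otimes> k) \<otimes> n) \<otimes> inv h" using assms by (simp add: m_assoc)
  then show ?thesis using K_mult[OF \<open>k' \<in> K\<close> assms(2)] \<open>h \<in> carrier G\<close> by (auto simp: conjK_def)
qed

lemma conjK_rotate:
  assumes "conjK x (y \<otimes> z)" "y \<in> carrier G" "z \<in> carrier G"
  shows "conjK x (z \<otimes> y)"
proof -
  obtain h k where hk: "h \<in> carrier G" "k \<in> K" "x = h \<otimes> (k \<otimes> (y \<otimes> z)) \<otimes> inv h"
    using assms(1) by (auto simp: conjK_def)
  obtain k' where k': "k' \<in> K" "z \<otimes> k = k' \<otimes> z" using K_move assms(3) hk(2) .
  have "(h \<otimes> k \<otimes> y) \<otimes> (k' \<otimes> (z \<otimes> y)) \<otimes> inv (h \<otimes> k \<otimes> y)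
      = (h \<otimes> k \<otimes> y) \<otimes> ((k' \<otimes> z) \<otimes> y) \<otimes> inv (h \<otimes> k \<otimes> y)"
    using hk k' assms by (simp add: m_assoc)
  also have "\<dots> = (h \<otimes> k \<otimes> y) \<otimes> ((z \<otimes> k) \<otimes> y) \<otimes> inv (h \<otimes> k \<otimes> y)" by (simp only: k')
  also have "\<dots> = x" using hk assms by (simp add: m_assoc inv_mult_group)
  finally have "x = (h \<otimes> k \<otimes> y) \<otimes> (k' \<otimes> (z \<otimes> y)) \<otimes> inv (h \<otimes> k \<otimes> y)" ..
  moreover have "h \<otimes> k \<otimes> y \<in> carrier G" using hk assms by simp
  ultimately show ?thesis unfolding conjK_def using k'(1) by blast
qed

text \<open>Cyclic reduction of the normal form modulo \<open>K\<close>: the last factor is moved to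
  the front, where it is absorbed, shortens the word, or completes a pure product
  \<open>D cs\<close>.\<close>

lemma conj_classification:
  assumes "conjK x (E i \<otimes> (D bs \<otimes> A j))" "i < 3"
  shows "conjK x (E 0) \<or> conjK x (E 1) \<or> conjK x (E 2) \<or> conjK x a \<or> (\<exists>cs. cs \<noteq> [] \<and> conjK x (D cs))"
  using assms
proof (induction "length bs" arbitrary: i bs j rule: less_induct)
  case less
  have E0: "E 0 = \<one>" by (simp add: E_def)
  have i: "i = 0 \<or> i = 1 \<or> i = 2" using less.prems by auto
  show ?case
  proof (cases j)
    case True
    have "conjK x ((E i \<otimes> D bs) \<otimes> a)" using less.prems True by (simp add: A_def m_assoc)
    then have c: "conjK x (a \<otimes> (E i \<otimes> D bs))" by (rule conjK_rotate) simp_all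
    show ?thesis
    proof (cases "i = 0")
      case False
      then have "a \<otimes> (E i \<otimes> D bs) = D ((i = 1) # bs)" using i by auto
      then show ?thesis using c by (metis list.distinct(1))
    next
      case i0: True
      show ?thesis
      proof (cases bs)
        case Nil
        then show ?thesis using c i0 by (simp add: E0)
      next
        case (Cons b cs)
        define i' :: nat where "i' = (if b then 1 else 2)"
        have "a \<otimes> (E i \<otimes> D bs) = (a \<otimes> a) \<otimes> (E i' \<otimes> (D cs \<otimes> A False))"
          using Cons i0 by (simp add: E0 i'_def m_assoc A_def)
        then have "conjK x (E i' \<otimes> (D cs \<otimes> A False))" using c conjK_absorb[OF _ aa_K] by simp
        then show ?thesis using less.hyps[of cs i' False] Cons by (simp add: i'_def)
      qed
    qed
  next
    case False
    then have c: "conjK x (E i \<otimes> D bs)" using less.prems by (simp add: A_def)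
    show ?thesis
    proof (cases "i = 0 \<or> bs = []")
      case True
      then show ?thesis using c i by (cases "bs = []") (auto simp: E0)
    next
      case False
      define b where "b = last bs"
      define cs where "cs = butlast bs"
      have bs: "bs = cs @ [b]" using False by (simp add: b_def cs_def)
      have "conjK x (D bs \<otimes> E i)" using c by (rule conjK_rotate) simp_all
      then have c': "conjK x (D cs \<otimes> (a \<otimes> (E (if b then 1 else 2) \<otimes> E i)))"
        unfolding bs D_append by (simp add: m_assoc)
      \<comment> \<open>Exponents of \<open>e\<close> add modulo three: 1 and 2 cancel, 1 and 1 give
        2, and 2 and 2 give 1, with \<open>zeta\<close> taking up the excess.\<close>
      have Em: "E (if b then 1 else 2) \<otimes> E i =
          (if b = (i = 2) then zeta else if b then E 2 else zeta \<otimes> E 1)"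
        using i False by (auto simp: E_def zeta_eq_e m_assoc)
      have zl: "D cs \<otimes> (a \<otimes> (zeta \<otimes> y)) = zeta \<otimes> (D cs \<otimes> (a \<otimes> y))" if "y \<in> carrier G" for y
        using that zeta_commute[of "D cs \<otimes> a"] by (simp flip: m_assoc)
      show ?thesis
      proof (cases "b = (i = 2)")
        case True
        have "conjK x (D cs \<otimes> (a \<otimes> (zeta \<otimes> \<one>)))" using c' unfolding Em using True by simp
        then have "conjK x (zeta \<otimes> (E 0 \<otimes> (D cs \<otimes> A True)))"
          unfolding zl[OF one_closed] by (simp add: E0 A_def)
        then have "conjK x (E 0 \<otimes> (D cs \<otimes> A True))" by (rule conjK_absorb) simp_all
        then show ?thesis using less.hyps[of cs 0 True] bs by simp
      next
        case ne: False
        show ?thesis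
        proof (cases b)
          case True
          then have "conjK x (D (cs @ [False]))" using c' ne unfolding Em D_append by simp
          then show ?thesis by blast
        next
          case False
          then have "conjK x (D cs \<otimes> (a \<otimes> (zeta \<otimes> E 1)))" using c' ne unfolding Em by simp
          then have "conjK x (zeta \<otimes> (D cs \<otimes> (a \<otimes> E 1)))" unfolding zl[OF EAD_closed(1)] .
          then have "conjK x (D cs \<otimes> (a \<otimes> E 1))" by (rule conjK_absorb) simp_all
          then have "conjK x (D (cs @ [True]))" unfolding D_append by simp
          then show ?thesis by blast
        qed
      qed
    qed
  qed
qed

lemma tr_conjK:
  assumes "conjK x n" "n \<in> carrier G"
  shows "\<bar>tr (mg x)\<bar> = \<bar>tr (mg n)\<bar>"
proof -
  obtain h k where hk: "h \<in> carrier G" "k \<in> K" "x = h \<otimes> (k \<otimes> n) \<otimes> inv h"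
    using assms(1) by (auto simp: conjK_def)
  have "tr (mg x) = tr (mg (inv h) * (mg h * mg (k \<otimes> n)))"
    using hk assms by (simp add: mg_mult tr_mult_commute[of _ "mg (inv h)"])
  also have "\<dots> = tr (mg k * mg n)"
    using hk assms mg_inv(2)[OF hk(1)] by (simp add: mg_mult flip: mult.assoc)
  finally show ?thesis using mg_K[OF hk(2)] by auto
qed

lemma carrier_conj_classification:
  assumes "x \<in> carrier G"
  shows "conjK x (E 0) \<or> conjK x (E 1) \<or> conjK x (E 2) \<or> conjK x a \<or> (\<exists>cs. cs \<noteq> [] \<and> conjK x (D cs))"
proof -
  obtain k i bs j where xk: "x = k \<otimes> (E i \<otimes> (D bs \<otimes> A j))" "k \<in> K" "i < 3"
    using carrier_NF[OF assms] unfolding NF_def by blast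
  then have "conjK x (E i \<otimes> (D bs \<otimes> A j))"
    unfolding conjK_def by (intro bexI[of _ \<one>] bexI[of _ k]) simp_all
  then show ?thesis using conj_classification xk by blast
qed

lemma tr_mg_normal:
  "\<bar>tr (mg (E 0))\<bar> = 2" "\<bar>tr (mg (E 1))\<bar> = 1" "\<bar>tr (mg (E 2))\<bar> = 1" "\<bar>tr (mg a)\<bar> = 0"
  "\<bar>tr (mg (D bs))\<bar> \<ge> 2"
proof -
  obtain M where "mg (D bs) = M \<or> mg (D bs) = - M" "positive M"
    using mg_D by blast
  then show "\<bar>tr (mg (D bs))\<bar> \<ge> 2" by (auto simp: positive_def)
qed (simp_all add: E_def mg_mult mg_def[of e] mg_def[of a] act_e act_a mat_aut)

text \<open>The absolute value of the trace is invariant under \<open>conjK\<close>, and among the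
  representatives it is 1 only for the two nontrivial powers of \<open>e\<close>.\<close>

lemma elliptic_trace_one:
  assumes "x \<in> carrier G" "\<bar>tr (mg x)\<bar> = 1"
  shows "conjK x (E 1) \<or> conjK x (E 2)"
  using carrier_conj_classification[OF assms(1)] assms(2) tr_conjK[of x] tr_mg_normal
  by (metis EAD_closed a_closed abs_ge_zero less_irrefl numeral_eq_one_iff one_add_one
      zero_neq_one semiring_norm(85) linorder_not_less one_less_numeral_iff semiring_norm(76))

lemma elliptic_trace_zero:
  assumes "x \<in> carrier G" "tr (mg x) = 0"
  shows "conjK x a"
  using carrier_conj_classification[OF assms(1)] assms(2) tr_conjK[of x] tr_mg_normal
  by (metis EAD_closed a_closed abs_zero linorder_not_less one_neq_zero zero_less_numeral zero_neq_numeral)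

end

section \<open>Pairs of elements in which a cube equals a square\<close>

context braid4
begin

abbreviation delta :: "letter ucox" where
  "delta \<equiv> elt [S2, S1, S3]"

lemma act_ntimes: "x \<in> carrier G \<Longrightarrow> act x (ntimes n u) = ntimes n (act x u)"
  by (intro add_hom_ntimes add_hom_act)

lemma act_conj_fixed:
  assumes "x \<in> carrier G" "k \<in> carrier G" "act k = inn u"
  shows "act (x \<otimes> k \<otimes> inv x) = act k \<longleftrightarrow> act x u = u"
  using act_conj_inn[OF assms] assms(3) by (simp add: inn_letter_eq_iff)

text \<open>By uniqueness of roots in W, fixing a nonzero multiple of \<open>u\<close> means fixing
  \<open>u\<close>; then conjugation by \<open>x\<close> does not change the action of
  \<open>k\<close>, and \<open>commuteI\<close> applies.\<close>

lemma commute_root: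
  assumes x: "x \<in> carrier G" and k: "k \<in> carrier G" and u: "act k = inn u"
    and fixed: "act x (ntimes n u) = ntimes n u" and nz: "ntimes n u \<noteq> 0"
  shows "x \<otimes> k = k \<otimes> x"
proof (rule commuteI[OF x k])
  have "ntimes n u = ntimes n (act x u)" using fixed x by (simp add: act_ntimes)
  then have "u = act x u" using nz by (rule ntimes_inject)
  then show "act (x \<otimes> k \<otimes> inv x) = act k" using act_conj_fixed[OF x k u] by simp
qed

lemma fixes_of_commute:
  assumes "x \<in> carrier G" "k \<in> carrier G" "act k = inn u" "x \<otimes> k = k \<otimes> x"
  shows "act x u = u"
proof -
  have "x \<otimes> k \<otimes> inv x = k" using assms by (simp add: m_assoc)
  then show ?thesis using act_conj_fixed[OF assms(1-3)] by simp
qed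

text \<open>\<open>X = S T\<close> and \<open>Y = S T S = T S T\<close> for \<open>S = X\<^sup>-\<^sup>1 Y\<close> and \<open>T = X S X\<^sup>-\<^sup>1\<close>.\<close>

lemma braid_pair:
  assumes "X \<in> carrier G" "Y \<in> carrier G" "X \<otimes> X \<otimes> X = Y \<otimes> Y"
  defines "S \<equiv> inv X \<otimes> Y"
  shows "S \<otimes> (X \<otimes> S \<otimes> inv X) = X" "X \<otimes> S = Y"
proof -
  have "S \<otimes> (X \<otimes> S \<otimes> inv X) = inv X \<otimes> (Y \<otimes> Y) \<otimes> inv X"
    using assms(1,2) by (simp add: S_def m_assoc)
  also have "\<dots> = X" using assms(1,2) unfolding assms(3)[symmetric] by (simp add: m_assoc)
  finally show "S \<otimes> (X \<otimes> S \<otimes> inv X) = X" .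
  show "X \<otimes> S = Y" using assms(1,2) by (simp add: S_def)
qed

text \<open>Once the matrices of \<open>X\<close> and \<open>S\<close> commute, the conjugate
  \<open>X \<otimes> S \<otimes> inv X\<close> has the matrix of \<open>S\<close>, and
  \<open>braid_pair\<close> turns into a square and a cube.\<close>

lemma commuting_matrices:
  assumes X: "X \<in> carrier G" and Y: "Y \<in> carrier G" and eq: "X \<otimes> X \<otimes> X = Y \<otimes> Y"
    and comm: "mg X * mg Y = mg Y * mg X"
  defines "S \<equiv> inv X \<otimes> Y"
  shows "mg (X \<otimes> S \<otimes> inv X) = mg S" "mg X = mg S * mg S" "mg Y = mg S * mg S * mg S"
proof -
  have S: "S \<in> carrier G" using X Y by (simp add: S_def)
  have "mg X * mg S = mg S * mg X"
  proof -
    have "mg S * mg X = mg (inv X) * (mg X * mg Y)"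
      using X Y comm by (simp add: S_def mg_mult mult.assoc)
    also have "\<dots> = mg Y" using mg_inv(2)[OF X] by (simp flip: mult.assoc)
    also have "\<dots> = mg X * mg S" using braid_pair(2)[OF X Y eq] X S by (simp add: S_def flip: mg_mult)
    finally show ?thesis ..
  qed
  then have "mg (X \<otimes> S \<otimes> inv X) = mg S * (mg X * mg (inv X))"
    using X S by (simp add: mg_mult mult.assoc)
  then show 1: "mg (X \<otimes> S \<otimes> inv X) = mg S" using mg_inv(1)[OF X] by simp
  have "mg (S \<otimes> (X \<otimes> S \<otimes> inv X)) = mg S * mg S"
    using 1 S X by (simp add: mg_mult[of S "X \<otimes> S \<otimes> inv X"])
  then show 2: "mg X = mg S * mg S" using braid_pair(1)[OF X Y eq] by (simp add: S_def)
  have "mg Y = mg X * mg S" using braid_pair(2)[OF X Y eq] X S by (simp add: S_def flip: mg_mult)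
  then show "mg Y = mg S * mg S * mg S" using 2 by simp
qed

lemma real_trace_commute:
  assumes X: "X \<in> carrier G" and Y: "Y \<in> carrier G" and eq: "X \<otimes> X \<otimes> X = Y \<otimes> Y"
    and comm: "mg X * mg Y = mg Y * mg X" and tr: "\<bar>tr (mg (inv X \<otimes> Y))\<bar> \<ge> 2"
  shows "X \<otimes> Y = Y \<otimes> X"
proof -
  define S where "S = inv X \<otimes> Y"
  define S' where "S' = X \<otimes> S \<otimes> inv X"
  have S: "S \<in> carrier G" "S' \<in> carrier G" using X Y by (simp_all add: S_def S'_def)
  note bp = braid_pair[OF X Y eq, folded S_def, folded S'_def]
  have "mg (S' \<otimes> inv S) = mg S * mg (inv S)"
    using commuting_matrices(1)[OF X Y eq comm] S unfolding S_def[symmetric] S'_def[symmetric]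
    by (simp add: mg_mult)
  then have mp: "mg (S' \<otimes> inv S) = 1" using mg_inv(1) S by simp
  then have "S' \<otimes> inv S \<in> K" using S by (intro mg_scalar_imp_K) simp_all
  then obtain u where u: "act (S' \<otimes> inv S) = inn u" using K_inner by blast
  \<comment> \<open>An odd word would act on the plane as a point reflection, with matrix
    -1.\<close>
  have even: "\<not> odd_len u" using mp mat_inn[of u] by (auto simp: mg_def u one_mat2_def)
  have S'_act: "act S' v = inn u (act S v)" for v
  proof -
    have "S' = (S' \<otimes> inv S) \<otimes> S" using S by (simp add: m_assoc)
    then have "act S' v = act (S' \<otimes> inv S) (act S v)" using act_mult_apply S by (metis inv_closed m_closed)
    then show ?thesis by (simp add: u)
  qed
  have "S \<otimes> (S' \<otimes> S) = S' \<otimes> (S \<otimes> S')"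
  proof -
    have "S \<otimes> (S' \<otimes> S) = X \<otimes> S" using bp S by (simp flip: m_assoc)
    also have "\<dots> = S' \<otimes> X" using X S by (simp add: S'_def m_assoc)
    finally show ?thesis using bp by simp
  qed
  then have "act S (act S' (act S v)) = act S' (act S (act S' v))" for v
    using S by (simp flip: act_mult_apply)
  \<comment> \<open>Moving the copies of \<open>inn u\<close> to the front leaves the third power of
    \<open>act S\<close> on both sides; since it is surjective, the inner automorphisms in front
    agree.\<close>
  then have "inn (act S u) (act S (act S (act S v))) = inn (u + act S (act S u)) (act S (act S (act S v)))" for v
    using S by (simp add: S'_act act_inn inn_inn)
  moreover have "\<exists>v. act S (act S (act S v)) = w" for w
    using S by (intro exI[of _ "act (inv S) (act (inv S) (act (inv S) w))"]) simp
  ultimately have "inn (act S u) = inn (u + act S (act S u))" by (metis ext)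
  then have "act S u = u + act S (act S u)" by (simp add: inn_letter_eq_iff)
  then have "u = 0"
    using no_braid_relation[OF parity_hom_act[OF S(1)] _ _ even] tr det_mg[OF S(1)]
    by (simp add: mg_def S_def)
  then have "act S' = act S" using S'_act by (simp add: fun_eq_iff)
  then have "X \<otimes> S = S \<otimes> X"
    using commuteI[OF X S(1)] by (simp add: S'_def)
  then show ?thesis using bp X S by (metis m_assoc)
qed

lemma ntimes_odd_nonzero:
  fixes u :: "letter ucox"
  assumes "odd n" "u \<noteq> 0"
  shows "ntimes n u \<noteq> 0"
proof
  assume z: "ntimes n u = 0"
  moreover have "n > 0" using assms by (cases n) auto
  ultimately obtain g l where "u = inn g (gen l)" using torsion_imp_conj_gen assms(2) by blast
  then show False using z assms ntimes_conj_gen[of n g l] by simp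
qed

lemma act_cube: "x \<in> carrier G \<Longrightarrow> act x = inn u \<Longrightarrow> act (x \<otimes> x \<otimes> x) = inn (ntimes 3 u)"
  by (simp add: fun_eq_iff act_mult_apply inn_inn numeral_3_eq_3 add.assoc)

lemma act_square: "x \<in> carrier G \<Longrightarrow> act x = inn u \<Longrightarrow> act (x \<otimes> x) = inn (ntimes 2 u)"
  by (simp add: fun_eq_iff act_mult_apply inn_inn numeral_2_eq_2)

text \<open>Write \<open>x\<close> as a conjugate of \<open>k \<otimes> E i\<close>, where
  \<open>k\<close> acts as \<open>inn f\<close>. Triviality of the cube says that \<open>f\<close>
  is a cocycle for the rotation \<open>r\<close>; by \<open>rotation_cocycle_trivial\<close> it is a
  coboundary, so a lift of \<open>g\<close> conjugates \<open>E i\<close> to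
  \<open>k \<otimes> E i\<close> up to the center.\<close>

lemma order_three_form:
  assumes x: "x \<in> carrier G" and c: "conjK x (E 1) \<or> conjK x (E 2)" and triv: "act (x \<otimes> x \<otimes> x) = id"
  shows "\<exists>h\<in>carrier G. x \<approx> h \<otimes> e \<otimes> inv h \<or> x \<approx> h \<otimes> inv e \<otimes> inv h"
proof -
  obtain i h k where i: "i = 1 \<or> i = 2" and hk: "h \<in> carrier G" "k \<in> K" "x = h \<otimes> (k \<otimes> E i) \<otimes> inv h"
    using c unfolding conjK_def by blast
  obtain f where f: "act k = inn f" using K_inner hk by blast
  define \<rho> where "\<rho> l = (if i = 1 then rot l else rot (rot l))" for l
  define r where "r = hom_ext (\<lambda>l. gen (\<rho> l))"
  have r: "add_hom r" unfolding r_def by (rule add_hom_hom_ext) simp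
  have "act (E i) = r"
  proof (rule add_hom_eqI)
    show "act (E i) (gen l) = r (gen l)" for l
      using i by (auto simp: E_def r_def \<rho>_def act_e act_mult)
  qed (use r add_hom_act in simp_all)
  then have y: "act (k \<otimes> E i) v = inn f (r v)" for v
    using hk f by (simp add: act_mult_apply)
  have r3: "r (r (r v)) = v" for v
  proof -
    have "r \<circ> (r \<circ> r) = id"
      by (intro add_hom_eqI add_hom_comp r add_hom_id) (simp add: r_def \<rho>_def)
    then show ?thesis by (simp add: fun_eq_iff)
  qed
  define y where "y = k \<otimes> E i"
  have yc: "y \<in> carrier G" using hk by (simp add: y_def)
  have "y = inv h \<otimes> x \<otimes> h" using hk yc by (simp add: y_def m_assoc)
  then have "y \<otimes> y \<otimes> y = inv h \<otimes> (x \<otimes> x \<otimes> x) \<otimes> h" using hk x by (simp add: m_assoc)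
  moreover have "act (inv h \<otimes> c \<otimes> h) = id" if "c \<in> carrier G" "act c = id" for c
    using that hk by (simp add: fun_eq_iff act_mult_apply)
  ultimately have "act (y \<otimes> y \<otimes> y) = id" using x triv by (metis m_closed)
  then have "inn f (r (inn f (r (inn f (r v))))) = v" for v
    using yc \<open>\<And>v. act (k \<otimes> E i) v = inn f (r v)\<close> by (simp add: fun_eq_iff act_mult_apply y_def)
  then have "inn (f + r f + r (r f)) v = inn 0 v" for v
    by (simp add: add_hom_apply_inn[OF r] add_hom_add[OF r] inn_inn r3 add.assoc)
  then have "f + r f + r (r f) = 0" using inn_letter_eq_iff by blast
  then obtain g where g: "f = g + - r g"
  proof -
    have "\<rho> (\<rho> (\<rho> l)) = l" "\<rho> l \<noteq> l" for l by (simp_all add: \<rho>_def)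
    from rotation_cocycle_trivial[of \<rho> f, folded r_def, OF this] show ?thesis
      using that \<open>f + r f + r (r f) = 0\<close> by blast
  qed
  define t where "t = TW (word g)"
  have t: "t \<in> carrier G" "act t = inn g" by (simp_all add: t_def inner_realized)
  have "act (inv t) v = inn (- g) v" for v
    using act_inv_act(1)[OF t(1), of "inn (- g) v"] t(2) by simp
  then have "act (t \<otimes> E i \<otimes> inv t) v = inn g (r (inn (- g) v))" for v
    using t by (simp only: act_mult_apply m_closed inv_closed EAD_closed \<open>act (E i) = r\<close>)
  also have "inn g (r (inn (- g) v)) = act y v" for v
    by (simp only: y_def y g add_hom_apply_inn[OF r] inn_inn add_hom_uminus[OF r])
  finally have "act y = act (t \<otimes> E i \<otimes> inv t)" by (intro ext) simp
  then have "y \<approx> t \<otimes> E i \<otimes> inv t"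
    using yc t by (intro act_eq_imp_zeq) simp_all
  then have "h \<otimes> y \<otimes> inv h \<approx> h \<otimes> (t \<otimes> E i \<otimes> inv t) \<otimes> inv h"
    using hk t by (intro zeq_mult) simp_all
  then have x1: "x \<approx> (h \<otimes> t) \<otimes> E i \<otimes> inv (h \<otimes> t)"
    using hk t by (simp add: y_def m_assoc inv_mult_group)
  show ?thesis
  proof (cases "i = 1")
    case True
    then show ?thesis using x1 hk t by (intro bexI[of _ "h \<otimes> t"]) (simp_all add: E_def)
  next
    case False
    have "E 2 = zeta [^] (1::int) \<otimes> inv e" by (simp add: E_def zeta_eq_e m_assoc)
    then have "E 2 \<approx> inv e" unfolding zeq_def by blast
    then have "(h \<otimes> t) \<otimes> E i \<otimes> inv (h \<otimes> t) \<approx> (h \<otimes> t) \<otimes> inv e \<otimes> inv (h \<otimes> t)"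
      using False i hk t by (intro zeq_mult) simp_all
    then have "x \<approx> (h \<otimes> t) \<otimes> inv e \<otimes> inv (h \<otimes> t)" using zeq_trans[OF x1] hk t by simp
    then show ?thesis using hk t by (intro bexI[of _ "h \<otimes> t"]) simp_all
  qed
qed

lemma involution_form:
  assumes y: "y \<in> carrier G" "act y = inn u" and u: "ntimes 2 u = 0" "u \<noteq> 0"
  shows "\<exists>h\<in>carrier G. y \<approx> h \<otimes> (a \<otimes> a) \<otimes> inv h"
proof -
  obtain g l where g: "u = inn g (gen l)" using torsion_imp_conj_gen u by (metis zero_less_numeral)
  define t where "t = TW (word g)"
  have t: "t \<in> carrier G" "act t = inn g" by (simp_all add: t_def inner_realized)
  have "act (t \<otimes> T l \<otimes> inv t) = inn u" using act_conj_inn[OF t(1) T_closed act_T] t(2) g by simp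
  then have yt: "y \<approx> t \<otimes> T l \<otimes> inv t" using y t by (intro act_eq_imp_zeq) simp_all
  obtain s where s: "s \<in> carrier G" "T l = s \<otimes> (a \<otimes> a) \<otimes> inv s"
  proof (cases l)
    case S1
    then show ?thesis using that[of \<one>] by simp
  next
    case S2
    then show ?thesis using that[of e] by simp
  next
    case S3
    then show ?thesis using that[of "inv e"] by simp
  qed
  have "t \<otimes> T l \<otimes> inv t = (t \<otimes> s) \<otimes> (a \<otimes> a) \<otimes> inv (t \<otimes> s)"
    using t s by (simp add: m_assoc inv_mult_group)
  then show ?thesis using yt t s by (intro bexI[of _ "t \<otimes> s"]) simp_all
qed

lemma inn_eq_id_iff: "inn u = id \<longleftrightarrow> u = (0 :: letter ucox)"
proof -
  have "inn (0 :: letter ucox) = id" by (simp add: fun_eq_iff)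
  then show ?thesis using inn_letter_eq_iff by metis
qed

lemma commuting_case:
  assumes X: "X \<in> carrier G" and Y: "Y \<in> carrier G" and eq: "X \<otimes> X \<otimes> X = Y \<otimes> Y"
    and comm: "mg X * mg Y = mg Y * mg X"
  shows "X \<otimes> Y = Y \<otimes> X \<or>
    (\<exists>g\<in>carrier G. \<exists>h\<in>carrier G. (X \<approx> g \<otimes> e \<otimes> inv g \<or> X \<approx> g \<otimes> inv e \<otimes> inv g) \<and>
      Y \<approx> h \<otimes> (a \<otimes> a) \<otimes> inv h)"
proof -
  define M where "M = mg (inv X \<otimes> Y)"
  have det: "det M = 1" using X Y by (simp add: M_def det_mg)
  have MX: "mg X = M * M" and MY: "mg Y = M * M * M"
    using commuting_matrices[OF X Y eq comm] by (simp_all add: M_def)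
  have comm3: "Y \<otimes> (X \<otimes> X \<otimes> X) = X \<otimes> X \<otimes> X \<otimes> Y" unfolding eq using Y by (simp add: m_assoc)
  have comm2: "X \<otimes> (Y \<otimes> Y) = Y \<otimes> Y \<otimes> X" unfolding eq[symmetric] using X by (simp add: m_assoc)
  consider "\<bar>tr M\<bar> \<ge> 2" | "tr M = 0" | "tr M = - 1" | "tr M = 1" by linarith
  then show ?thesis
  proof cases
    case 1
    then show ?thesis using real_trace_commute[OF X Y eq comm] by (simp add: M_def)
  next
    case 2
    then have m: "mg X = - 1" using cayley_hamilton(1)[OF det] MX by simp
    then have "X \<in> K" using X mg_scalar_imp_K by blast
    then obtain u where u: "act X = inn u" using K_inner by blast
    have "u \<noteq> 0"
    proof
      assume "u = 0"
      then have "mg X = 1" using mat_inn[of u] by (simp add: mg_def u)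
      then show False using m by (simp add: one_mat2_def)
    qed
    then have nz: "ntimes 3 u \<noteq> 0" using ntimes_odd_nonzero[of 3 u] by simp
    have "act Y (ntimes 3 u) = ntimes 3 u"
      using fixes_of_commute[OF Y _ act_cube[OF X u] comm3] X by simp
    then show ?thesis using commute_root[OF Y X u] nz by metis
  next
    case 3
    have MM: "M * M = - M - 1" using cayley_hamilton(3)[OF det 3] .
    have "M * M * M = (- M - 1) * M" unfolding MM ..
    also have "\<dots> = - (M * M) - M" by (simp add: algebra_simps)
    also have "\<dots> = 1" by (simp add: MM)
    finally have "M * M * M = 1" .
    then have m: "mg Y = 1" using MY by simp
    then have "Y \<in> K" using Y mg_scalar_imp_K by blast
    then obtain u where u: "act Y = inn u" using K_inner by blast
    have even: "\<not> odd_len u" using m mat_inn[of u] by (auto simp: mg_def u one_mat2_def)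
    have fixed: "act X (ntimes 2 u) = ntimes 2 u"
      using fixes_of_commute[OF X _ act_square[OF Y u] comm2] Y by simp
    show ?thesis
    proof (cases "u = 0")
      case True
      then have "act (X \<otimes> Y \<otimes> inv X) = act Y"
        using act_conj_inn[OF X Y u] u X by (simp add: add_hom_zero[OF add_hom_act[OF X]])
      then show ?thesis using commuteI[OF X Y] by blast
    next
      case False
      \<comment> \<open>An involution is conjugate to a letter and has odd length, whereas
        \<open>u\<close> has even length because the matrix of \<open>Y\<close> is 1.\<close>
      have "ntimes 2 u \<noteq> 0"
      proof
        assume "ntimes 2 u = 0"
        then obtain g l where "u = inn g (gen l)" using torsion_imp_conj_gen False by (metis zero_less_numeral)
        then show False using even by (simp add: inn_def del: add_uminus_conv_diff)
      qed
      then show ?thesis using commute_root[OF X Y u fixed] by blast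
    qed
  next
    case 4
    have MM: "M * M = M - 1" using cayley_hamilton(2)[OF det 4] .
    have "M * M * M = (M - 1) * M" unfolding MM ..
    also have "\<dots> = M * M - M" by (simp add: algebra_simps)
    also have "\<dots> = - 1" by (simp add: MM)
    finally have "M * M * M = - 1" .
    then have m: "mg Y = - 1" using MY by simp
    then have "Y \<in> K" using Y mg_scalar_imp_K by blast
    then obtain u where u: "act Y = inn u" using K_inner by blast
    have u0: "u \<noteq> 0"
    proof
      assume "u = 0"
      then have "mg Y = 1" using mat_inn[of u] by (simp add: mg_def u)
      then show False using m by (simp add: one_mat2_def)
    qed
    have fixed: "act X (ntimes 2 u) = ntimes 2 u"
      using fixes_of_commute[OF X _ act_square[OF Y u] comm2] Y by simp
    show ?thesis
    proof (cases "ntimes 2 u = 0")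
      case False
      then show ?thesis using commute_root[OF X Y u fixed] by blast
    next
      case True
      \<comment> \<open>The case in which uniqueness of roots says nothing: \<open>Y\<close> acts by
        an involution of W and \<open>X\<close> has order three modulo the center, with unrelated
        conjugators.\<close>
      then have "act (X \<otimes> X \<otimes> X) = id"
        using act_square[OF Y u] unfolding eq by (simp add: inn_eq_id_iff)
      moreover have "tr (mg X) = - 1" using 4 unfolding MX MM by (cases M) (simp add: one_mat2_def)
      then have "conjK X (E 1) \<or> conjK X (E 2)" by (intro elliptic_trace_one X) simp
      ultimately have "\<exists>h\<in>carrier G. X \<approx> h \<otimes> e \<otimes> inv h \<or> X \<approx> h \<otimes> inv e \<otimes> inv h"
        using order_three_form X by blast
      then show ?thesis using involution_form[OF Y u True u0] by blast
    qed
  qed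
qed

text \<open>Each block of \<open>D bs\<close> crosses an edge and then turns at the next vertex, so
  the path never turns back and \<open>slope_mono\<close> applies to every block. Taking inverses
  makes the blocks act in the order of the list.\<close>

lemma slope_D:
  assumes "u \<noteq> 0"
  shows "act (inv (D bs)) u \<noteq> 0 \<and> slope u \<le> slope (act (inv (D bs)) u)"
  using assms
proof (induction bs arbitrary: u)
  case (Cons b bs)
  define v where "v = act (inv (E (if b then 1 else 2))) (act (inv a) u)"
  have "inv (D (b # bs)) = inv (D bs) \<otimes> (inv (E (if b then 1 else 2)) \<otimes> inv a)"
    by (simp add: inv_mult_group m_assoc)
  then have eq: "act (inv (D (b # bs))) u = act (inv (D bs)) v"
    by (simp add: act_mult_apply v_def)
  have v: "v = (if b then aut_e (aut_e (inn (gen S1) (aut_a u))) else aut_e (inn (gen S1) (aut_a u)))"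
    by (simp add: v_def E_def act_inv_a act_inv_e inv_mult_group act_mult_apply aut_e_cube)
  have "v \<noteq> 0" using Cons.prems by (simp add: v inn_eq_zero_iff)
  moreover have "slope u \<le> slope v"
    using slope_mono[OF Cons.prems] Cons.prems by (simp add: v aut_inn)
  ultimately show ?case using Cons.IH[of v] eq by simp
qed simp

lemma noncommuting_case:
  assumes X: "X \<in> carrier G" and Y: "Y \<in> carrier G" and eq: "X \<otimes> X \<otimes> X = Y \<otimes> Y"
    and nc: "mg X * mg Y \<noteq> mg Y * mg X"
  shows "\<exists>h\<in>carrier G. act (inv h \<otimes> X \<otimes> h) delta = delta \<and> act (inv h \<otimes> Y \<otimes> h) delta = delta"
proof -
  have eqm: "mg X * mg X * mg X = mg Y * mg Y"
    using X Y arg_cong[OF eq, of mg] by (simp add: mg_mult)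
  note nce = noncommuting_cube_eq_square[OF det_mg[OF X] det_mg[OF Y] eqm nc]
  have "mg (Y \<otimes> Y) = - 1" using nce(3) Y by (simp add: mg_mult)
  then have m: "mg (Y \<otimes> Y) = - 1" "Y \<otimes> Y \<in> K" using mg_scalar_imp_K Y by auto
  then obtain u where u: "act (Y \<otimes> Y) = inn u" using K_inner by blast
  have u0: "u \<noteq> 0"
  proof
    assume "u = 0"
    then have "mg (Y \<otimes> Y) = 1" using mat_inn[of u] by (simp add: mg_def u)
    then show False using m by (simp add: one_mat2_def)
  qed
  have fX: "act X u = u"
    using fixes_of_commute[OF X _ u] X Y unfolding eq[symmetric] by (simp add: m_assoc)
  have fY: "act Y u = u"
    using fixes_of_commute[OF Y _ u] Y by (simp add: m_assoc)
  have "conjK X (E 1) \<or> conjK X (E 2)" using nce(1) by (intro elliptic_trace_one X) simp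
  then obtain i h k where i: "i = 1 \<or> i = 2" and hk: "h \<in> carrier G" "k \<in> K" "X = h \<otimes> (k \<otimes> E i) \<otimes> inv h"
    unfolding conjK_def by blast
  define v where "v = act (inv h) u"
  have v0: "v \<noteq> 0" using u0 hk unfolding v_def
    by (metis act_inv_act(2) add_hom_act add_hom_zero)
  obtain f where f: "act k = inn f" using K_inner hk by blast
  have "act (k \<otimes> E i) v = v"
  proof -
    have "act h (act (k \<otimes> E i) v) = act X u"
      using hk by (simp add: v_def act_mult_apply)
    then have "act (inv h) (act h (act (k \<otimes> E i) v)) = act (inv h) u" using fX by simp
    then show ?thesis using hk by (simp add: v_def)
  qed
  then have "inn f (act (E i) v) = v" using hk f by (simp add: act_mult_apply)
  then have cE: "conjugate (act (E i) v) v" by (metis conjugate_def conjugate_sym)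
  have ce: "conjugate (aut_e v) v"
  proof (cases "i = 1")
    case True
    then show ?thesis using cE by (simp add: E_def act_e)
  next
    case False
    then have c2: "conjugate (aut_e (aut_e v)) v" using cE i by (simp add: E_def act_e act_mult)
    \<comment> \<open>The rotation is the fourth power of itself, that is, the square of its
      square.\<close>
    have "conjugate (aut_e (aut_e (aut_e (aut_e v)))) (aut_e (aut_e v))"
      by (rule conjugate_hom[OF add_hom_aut(1) conjugate_hom[OF add_hom_aut(1) c2]])
    then show ?thesis using c2 conjugate_trans by (simp add: aut_e_cube) blast
  qed
  then obtain g where "aut_e v = inn g v" unfolding conjugate_def by blast
  note v_inv = this
  define Z where "Z = inv h \<otimes> Y \<otimes> h"
  have Z: "Z \<in> carrier G" using hk Y by (simp add: Z_def)
  have fZ: "act Z v = v" using hk Y fY by (simp add: Z_def v_def act_mult_apply)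
  have "conjK Y a" using elliptic_trace_zero Y nce(2) by blast
  then obtain d' k' where d': "d' \<in> carrier G" "k' \<in> K" "Y = d' \<otimes> (k' \<otimes> a) \<otimes> inv d'"
    unfolding conjK_def by blast
  define d where "d = inv h \<otimes> d'"
  have d: "d \<in> carrier G" using d' hk by (simp add: d_def)
  have Zd: "Z = d \<otimes> (k' \<otimes> a) \<otimes> inv d" using d' hk by (simp add: Z_def d_def m_assoc inv_mult_group)
  obtain f' where f': "act k' = inn f'" using K_inner d' by blast
  define w where "w = act (inv d) v"
  have "act (k' \<otimes> a) w = w"
  proof -
    have "act d (act (k' \<otimes> a) w) = v"
      using fZ d d' unfolding Zd by (simp add: w_def act_mult_apply)
    then have "act (inv d) (act d (act (k' \<otimes> a) w)) = act (inv d) v" by simp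
    then show ?thesis using d d' by (simp add: w_def)
  qed
  then have "inn f' (aut_a w) = w" using d' f' by (simp add: act_mult_apply act_a)
  then have ca: "conjugate (aut_a w) w" by (metis conjugate_def conjugate_sym)
  \<comment> \<open>The normal form of \<open>d\<close> describes the path from the vertex fixed by
    the rotation to the edge inverted by \<open>Z\<close>. The inner part and \<open>E i2\<close> at
    its start keep the class of \<open>v\<close>, and a final \<open>a\<close> keeps the invariance
    under \<open>aut_a\<close>, so only \<open>D bs\<close> matters.\<close>
  obtain k2 i2 bs j where nf: "d = k2 \<otimes> (E i2 \<otimes> (D bs \<otimes> A j))" "k2 \<in> K" "i2 < 3"
    using carrier_NF[OF d] unfolding NF_def by blast
  obtain f2 where f2: "act k2 = inn f2" using K_inner nf by blast
  have f2': "act (inv k2) x = inn (- f2) x" for x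
    using act_inv_act(1)[of k2 "inn (- f2) x"] nf f2 by simp
  define y where "y = act (inv (E i2)) (act (inv k2) v)"
  define w' where "w' = act (inv (D bs)) y"
  have "inv d = inv (A j) \<otimes> (inv (D bs) \<otimes> (inv (E i2) \<otimes> inv k2))"
    using nf by (simp add: inv_mult_group m_assoc)
  then have w: "w = act (inv (A j)) w'"
    using nf by (simp add: w_def w'_def y_def act_mult_apply)
  have cy: "conjugate y v"
  proof -
    have ce2: "conjugate (aut_e (aut_e v)) v" using ce conjugate_hom[OF add_hom_aut(1) ce] conjugate_trans by blast
    have "act (inv (E i2)) v = v \<or> act (inv (E i2)) v = aut_e v \<or> act (inv (E i2)) v = aut_e (aut_e v)"
      by (auto simp: E_def act_inv_e inv_mult_group act_mult_apply aut_e_cube)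
    then have "conjugate (act (inv (E i2)) v) v" using ce ce2 by auto
    moreover have "conjugate y (act (inv (E i2)) v)"
      unfolding y_def f2' by (rule conjugate_hom[OF add_hom_act conjugate_inn]) simp
    ultimately show ?thesis using conjugate_trans by blast
  qed
  then have y0: "y \<noteq> 0" using v0 by (auto simp: conjugate_def inn_eq_zero_iff)
  have w': "w' \<noteq> 0" "slope y \<le> slope w'" using slope_D[OF y0] by (simp_all add: w'_def)
  have "conjugate (aut_a w') w'"
  proof (cases j)
    case True
    then have "w = inn (gen S1) (aut_a w')" by (simp add: w A_def act_inv_a)
    then have 1: "conjugate w (aut_a w')" by simp
    then have "conjugate (aut_a w) (aut_a (aut_a w'))" by (rule conjugate_hom[OF add_hom_aut(2)])
    then have "conjugate (aut_a w) w'" unfolding aut_a_square using conjugate_trans conjugate_inn by blast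
    then show ?thesis using 1 ca conjugate_trans conjugate_sym by blast
  next
    case False
    then show ?thesis using ca by (simp add: w A_def)
  qed
  \<comment> \<open>An \<open>aut_a\<close>-invariant class has slope equal to its negative.
    Monotonicity along \<open>bs\<close> bounds the slope of \<open>v\<close> above by 0, and the
    rotation symmetry bounds it below.\<close>
  then have "slope w' = 0" using conjugate_slope[of "aut_a w'" w'] slope_aut_a[OF w'(1)] w'(1) by simp
  then have "slope v \<le> 0" using w'(2) conjugate_slope[OF cy v0] by simp
  moreover have "slope v \<ge> 0" using slope_nonneg v0 v_inv by blast
  ultimately have "slope v = 0" by simp
  then obtain g n where gn: "n > 0" "v = inn g (ntimes n delta) \<or> v = inn g (- ntimes n delta)"
    using slope_zero[OF v0 v_inv] by blast
  define t where "t = TW (word g)"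
  have t: "t \<in> carrier G" "act t = inn g" by (simp_all add: t_def inner_realized)
  \<comment> \<open>Fixing a nonzero multiple of \<open>delta\<close>, of either sign, is fixing
    \<open>delta\<close> by uniqueness of roots.\<close>
  have fixed: "act (inv (h \<otimes> t) \<otimes> W \<otimes> (h \<otimes> t)) delta = delta" if W: "W \<in> carrier G" "act W u = u" for W
  proof -
    define W' where "W' = inv (h \<otimes> t) \<otimes> W \<otimes> (h \<otimes> t)"
    have W': "W' \<in> carrier G" using W hk t by (simp add: W'_def)
    define s where "s = act (inv t) v"
    have "act W' s = s"
      using W hk t(1) by (simp add: W'_def s_def v_def act_mult_apply inv_mult_group)
    moreover have "s = ntimes n delta \<or> s = - ntimes n delta"
    proof -
      have "act (inv t) (inn g x) = x" for x using act_inv_act(1)[OF t(1), of x] t(2) by simp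
      then show ?thesis using gn(2) by (auto simp: s_def)
    qed
    ultimately have "act W' (ntimes n delta) = ntimes n delta"
      using add_hom_uminus[OF add_hom_act[OF W']] by (metis add.inverse_inverse)
    then have "ntimes n delta = ntimes n (act W' delta)" using act_ntimes[OF W'] by metis
    moreover have "ntimes n delta \<noteq> 0"
    proof
      assume "ntimes n delta = 0"
      then have "v = 0" using gn(2) inn_eq_zero_iff by (metis add.inverse_neutral)
      then show False using v0 by simp
    qed
    ultimately have "delta = act W' delta" using ntimes_inject by blast
    then show ?thesis by (simp add: W'_def)
  qed
  show ?thesis using fixed[OF X fX] fixed[OF Y fY] hk t by (intro bexI[of _ "h \<otimes> t"]) simp_all
qed

end

section \<open>Braid groups\<close>

subsection \<open>Homomorphisms out of presented groups\<close>

context group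
begin

definition word_val :: "('c \<Rightarrow> 'a) \<Rightarrow> 'c gword \<Rightarrow> 'a" where
  "word_val h w = foldr (\<lambda>(x, b) y. (if b then h x else inv h x) \<otimes> y) w \<one>"

lemma word_val_simps [simp]:
  "word_val h [] = \<one>" "word_val h ((x, b) # w) = (if b then h x else inv h x) \<otimes> word_val h w"
  by (simp_all add: word_val_def)

lemma word_val_closed [simp]:
  "h \<in> X \<rightarrow> carrier G \<Longrightarrow> w \<in> gwords X \<Longrightarrow> word_val h w \<in> carrier G"
proof (induction w)
  case (Cons xb w)
  then show ?case by (cases xb) (auto simp: Pi_iff)
qed simp

lemma word_val_append:
  assumes h: "h \<in> X \<rightarrow> carrier G" and "v \<in> gwords X" "w \<in> gwords X"
  shows "word_val h (v @ w) = word_val h v \<otimes> word_val h w"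
  using assms(2)
proof (induction v)
  case Nil
  then show ?case using word_val_closed[OF h assms(3)] by simp
next
  case (Cons xb v)
  then show ?case using word_val_closed[OF h assms(3)] word_val_closed[OF h, of v] h
    by (cases xb) (auto simp: m_assoc Pi_iff)
qed

lemma word_val_pres_rel:
  assumes h: "h \<in> X \<rightarrow> carrier G"
    and R: "\<And>r s. (r, s) \<in> R \<Longrightarrow> r \<in> gwords X \<Longrightarrow> s \<in> gwords X \<Longrightarrow> word_val h r = word_val h s"
    and "(v, w) \<in> pres_rel X R"
  shows "word_val h v = word_val h w"
  using assms(3)
proof (induction rule: pres_rel.induct)
  case (cancel u v x b)
  have hx: "h x \<in> carrier G" using cancel h by auto
  have "word_val h ([(x, b), (x, \<not> b)] @ v) = word_val h v"
    using hx word_val_closed[OF h, of v] cancel by simp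
  then show ?case using cancel word_val_append[OF h, of u "[(x, b), (x, \<not> b)] @ v"]
      word_val_append[OF h, of u v] by simp
next
  case (relation u v r s)
  then show ?case using R[of r s] word_val_append[OF h] by simp
qed simp_all

lemma presented_group_hom:
  assumes h: "h \<in> X \<rightarrow> carrier G"
    and R: "\<And>r s. (r, s) \<in> R \<Longrightarrow> r \<in> gwords X \<Longrightarrow> s \<in> gwords X \<Longrightarrow> word_val h r = word_val h s"
  shows "\<exists>\<Phi>\<in>hom (presented_group X R) G. \<forall>w\<in>gwords X. \<Phi> (pres_rel X R `` {w}) = word_val h w"
proof -
  define \<Phi> where "\<Phi> C = word_val h (SOME w. w \<in> C)" for C
  have val: "\<Phi> (pres_rel X R `` {w}) = word_val h w" if "w \<in> gwords X" for w
  proof -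
    have "w \<in> pres_rel X R `` {w}" using that by (simp add: pres_rel.refl)
    then have "(SOME v. v \<in> pres_rel X R `` {w}) \<in> pres_rel X R `` {w}" by (rule someI)
    then have "(w, SOME v. v \<in> pres_rel X R `` {w}) \<in> pres_rel X R" by simp
    from word_val_pres_rel[OF h R this] show ?thesis by (simp add: \<Phi>_def)
  qed
  have "\<Phi> \<in> hom (presented_group X R) G"
  proof (rule homI)
    fix C assume C: "C \<in> carrier (presented_group X R)"
    then obtain v where v: "v \<in> gwords X" "C = pres_rel X R `` {v}" by (rule presented_group_cases)
    then show "\<Phi> C \<in> carrier G" using val word_val_closed[OF h] by simp
    fix D assume "D \<in> carrier (presented_group X R)"
    then obtain w where w: "w \<in> gwords X" "D = pres_rel X R `` {w}" by (rule presented_group_cases)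
    show "\<Phi> (C \<otimes>\<^bsub>presented_group X R\<^esub> D) = \<Phi> C \<otimes> \<Phi> D"
      using v w by (simp add: presented_group_mult val word_val_append[OF h])
  qed
  then show ?thesis using val by blast
qed

lemma braid_group_hom:
  assumes h: "\<And>i. i \<in> {1..<n} \<Longrightarrow> h i \<in> carrier G"
    and comm: "\<And>i j. i \<in> {1..<n} \<Longrightarrow> j \<in> {1..<n} \<Longrightarrow> i + 2 \<le> j \<Longrightarrow> h i \<otimes> h j = h j \<otimes> h i"
    and braid: "\<And>i. i \<in> {1..<n} \<Longrightarrow> Suc i \<in> {1..<n} \<Longrightarrow>
      h i \<otimes> (h (Suc i) \<otimes> h i) = h (Suc i) \<otimes> (h i \<otimes> h (Suc i))"
  shows "\<exists>\<Phi>\<in>hom (braid_group n) G. \<forall>i\<in>{1..<n}. \<Phi> (braid_gen n i) = h i"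
proof -
  have hX: "h \<in> {1..<n} \<rightarrow> carrier G" using h by auto
  have "word_val h r = word_val h s" if "(r, s) \<in> braid_relations n" for r s
    using that unfolding braid_relations_def
  proof (elim UnE CollectE exE conjE)
    fix i j assume "(r, s) = ([(i, True), (j, True)], [(j, True), (i, True)])"
      "i \<in> {1..<n}" "j \<in> {1..<n}" "i + 2 \<le> j"
    then show ?thesis using h[of i] h[of j] comm[of i j] by (simp del: One_nat_def)
  next
    fix i assume "(r, s) = ([(i, True), (Suc i, True), (i, True)], [(Suc i, True), (i, True), (Suc i, True)])"
      "i \<in> {1..<n}" "Suc i \<in> {1..<n}"
    then show ?thesis using h[of i] h[of "Suc i"] braid[of i] by (simp del: One_nat_def)
  qed
  then obtain \<Phi> where \<Phi>: "\<Phi> \<in> hom (presented_group {1..<n} (braid_relations n)) G"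
      "\<forall>w\<in>gwords {1..<n}. \<Phi> (braid_eq n `` {w}) = word_val h w"
    using presented_group_hom[OF hX] by metis
  have "\<Phi> (braid_gen n i) = h i" if "i \<in> {1..<n}" for i
    using \<Phi>(2) that h by (simp add: braid_gen_def del: One_nat_def)
  then show ?thesis using \<Phi>(1) unfolding braid_group_def by blast
qed

end

lemma braid_group_generated:
  "carrier (braid_group n) \<subseteq> generate (braid_group n) (braid_gen n ` {1..<n})"
proof
  interpret group "braid_group n" by (rule group_braid_group)
  let ?X = "{1..<n}" and ?S = "braid_gen n ` {1..<n}"
  have S: "?S \<subseteq> carrier (braid_group n)" using braid_gen_closed by auto
  have letter: "braid_eq n `` {[(x, b)]} \<in> generate (braid_group n) ?S" if x: "x \<in> ?X" for x b
  proof (cases b)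
    case True
    then show ?thesis using x by (auto simp: braid_gen_def intro!: generate.incl)
  next
    case False
    have w: "[(x, True)] \<in> gwords ?X" "[(x, False)] \<in> gwords ?X" using x by simp_all
    have "(([] @ [(x, False), (x, \<not> False)] @ [], [] @ []) \<in> braid_eq n)"
      using x by (intro pres_rel.cancel) simp_all
    then have "braid_eq n `` {[(x, False)] @ [(x, True)]} = braid_eq n `` {[]}"
      using equiv_class_eq[OF equiv_pres_rel] by simp
    then have "braid_eq n `` {[(x, False)]} \<otimes>\<^bsub>braid_group n\<^esub> braid_gen n x = \<one>\<^bsub>braid_group n\<^esub>"
      using w by (simp add: braid_gen_def braid_group_def presented_group_mult presented_group_one)
    then have "braid_eq n `` {[(x, False)]} = inv\<^bsub>braid_group n\<^esub> braid_gen n x"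
      using w braid_gen_closed[OF x]
      by (intro inv_equality[symmetric]) (simp_all add: braid_group_def presented_group_carrierI)
    then show ?thesis using False x by (auto intro!: generate.inv)
  qed
  fix C assume "C \<in> carrier (braid_group n)"
  then obtain w where w: "w \<in> gwords ?X" "C = braid_eq n `` {w}"
    unfolding braid_group_def by (rule presented_group_cases)
  have "braid_eq n `` {w} \<in> generate (braid_group n) ?S" if "w \<in> gwords ?X" for w
    using that
  proof (induction w)
    case Nil
    show ?case using generate.one[of "braid_group n" ?S]
      by (simp add: braid_group_def presented_group_one)
  next
    case (Cons xb w)
    obtain x b where xb: "xb = (x, b)" by (cases xb)
    then have "x \<in> ?X" "w \<in> gwords ?X" "[(x, b)] \<in> gwords ?X" using Cons.prems by simp_all
    moreover from this have "braid_eq n `` {xb # w} =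
        braid_eq n `` {[(x, b)]} \<otimes>\<^bsub>braid_group n\<^esub> braid_eq n `` {w}"
      unfolding braid_group_def using xb
      by (subst presented_group_mult) simp_all
    ultimately show ?case using Cons.IH letter generate.eng by metis
  qed
  then show "C \<in> generate (braid_group n) ?S" using w by simp
qed

lemma hom_eq_on_generate:
  assumes "group G" "group H" "f \<in> hom G H" "g \<in> hom G H" "S \<subseteq> carrier G"
    and "\<And>x. x \<in> S \<Longrightarrow> f x = g x" and "x \<in> generate G S"
  shows "f x = g x"
proof -
  interpret f: group_hom G H f using assms by (simp add: group_hom_def group_hom_axioms_def)
  interpret g: group_hom G H g using assms by (simp add: group_hom_def group_hom_axioms_def)
  have "x \<in> carrier G \<and> f x = g x"
    using assms(7)
    by (induction rule: generate.induct) (use assms(5,6) in auto)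
  then show ?thesis by simp
qed

lemma atLeastLessThan_3: "{1..<3} = {1, 2::nat}" and atLeastLessThan_4: "{1..<4} = {1, 2, 3::nat}"
  by auto

lemma braid_group_hom_eq:
  assumes "group H" "f \<in> hom (braid_group n) H" "g \<in> hom (braid_group n) H"
    and "\<And>i. i \<in> {1..<n} \<Longrightarrow> f (braid_gen n i) = g (braid_gen n i)"
    and "x \<in> carrier (braid_group n)"
  shows "f x = g x"
proof (rule hom_eq_on_generate[OF group_braid_group assms(1-3)])
  show "braid_gen n ` {1..<n} \<subseteq> carrier (braid_group n)" using braid_gen_closed by auto
  show "x \<in> generate (braid_group n) (braid_gen n ` {1..<n})"
    using assms(5) braid_group_generated by blast
qed (use assms(4) in auto)

subsection \<open>The generators alpha and beta\<close>

text \<open>Everything follows from the shift: conjugation by \<open>a\<close> carries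
  \<open>x\<close> to \<open>y\<close> and \<open>y\<close> to \<open>z\<close>.\<close>

lemma (in group) braid4_alpha_beta:
  assumes c [simp]: "x \<in> carrier G" "y \<in> carrier G" "z \<in> carrier G"
    and xz: "x \<otimes> z = z \<otimes> x" and xy: "x \<otimes> (y \<otimes> x) = y \<otimes> (x \<otimes> y)" and yz: "y \<otimes> (z \<otimes> y) = z \<otimes> (y \<otimes> z)"
  defines "a \<equiv> x \<otimes> (y \<otimes> z)"
  defines "e \<equiv> a \<otimes> x"
  shows "a \<otimes> x = y \<otimes> a" "a \<otimes> y = z \<otimes> a" "e \<otimes> e \<otimes> e = a \<otimes> a \<otimes> (a \<otimes> a)"
    "a \<otimes> a \<otimes> (e \<otimes> a \<otimes> e) = e \<otimes> a \<otimes> e \<otimes> (a \<otimes> a)"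
proof -
  have ac [simp]: "a \<in> carrier G" "e \<in> carrier G" by (simp_all add: a_def e_def)
  have "a \<otimes> x = x \<otimes> (y \<otimes> (z \<otimes> x))" by (simp add: a_def m_assoc)
  also have "\<dots> = (x \<otimes> (y \<otimes> x)) \<otimes> z" by (simp add: m_assoc flip: xz)
  also have "\<dots> = y \<otimes> a" unfolding xy by (simp add: a_def m_assoc)
  finally show ax: "a \<otimes> x = y \<otimes> a" .
  have "a \<otimes> y = x \<otimes> (y \<otimes> (z \<otimes> y))" by (simp add: a_def m_assoc)
  also have "\<dots> = (x \<otimes> z) \<otimes> (y \<otimes> z)" unfolding yz by (simp add: m_assoc)
  also have "\<dots> = z \<otimes> a" unfolding xz by (simp add: a_def m_assoc)
  finally show ay: "a \<otimes> y = z \<otimes> a" .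
  have aax: "a \<otimes> (a \<otimes> x) = z \<otimes> (a \<otimes> a)"
  proof -
    have "a \<otimes> (a \<otimes> x) = (a \<otimes> y) \<otimes> a" unfolding ax by (simp add: m_assoc)
    also have "\<dots> = z \<otimes> (a \<otimes> a)" unfolding ay by (simp add: m_assoc)
    finally show ?thesis .
  qed
  have yza: "y \<otimes> (z \<otimes> a) = a \<otimes> (x \<otimes> y)"
  proof -
    have "y \<otimes> (z \<otimes> a) = (y \<otimes> a) \<otimes> y" unfolding ay[symmetric] by (simp add: m_assoc)
    then show ?thesis unfolding ax[symmetric] by (simp add: m_assoc)
  qed
  have "e \<otimes> e \<otimes> e = (y \<otimes> a) \<otimes> (a \<otimes> x) \<otimes> (a \<otimes> x)" by (simp add: e_def ax)
  also have "\<dots> = y \<otimes> (a \<otimes> (a \<otimes> x)) \<otimes> (a \<otimes> x)" by (simp add: m_assoc)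
  also have "\<dots> = (y \<otimes> (z \<otimes> a)) \<otimes> (a \<otimes> (a \<otimes> x))" unfolding aax by (simp add: m_assoc aax)
  also have "\<dots> = (a \<otimes> (x \<otimes> y)) \<otimes> (z \<otimes> (a \<otimes> a))" unfolding aax yza ..
  also have "\<dots> = a \<otimes> (x \<otimes> (y \<otimes> z)) \<otimes> (a \<otimes> a)" by (simp add: m_assoc)
  finally show e3: "e \<otimes> e \<otimes> e = a \<otimes> a \<otimes> (a \<otimes> a)" unfolding a_def[symmetric] .
  define c where "c = a \<otimes> a \<otimes> (a \<otimes> a)"
  have cc [simp]: "c \<in> carrier G" by (simp add: c_def)
  have ca: "c \<otimes> a = a \<otimes> c" by (simp add: c_def m_assoc)
  have ce: "c \<otimes> e = e \<otimes> c" unfolding c_def e3[symmetric] by (simp add: m_assoc)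
  have cx: "c \<otimes> x = x \<otimes> c"
  proof -
    have "a \<otimes> (c \<otimes> x) = (c \<otimes> a) \<otimes> x" unfolding ca by (simp add: m_assoc)
    also have "\<dots> = e \<otimes> c" using ce by (simp add: e_def m_assoc)
    also have "\<dots> = a \<otimes> (x \<otimes> c)" by (simp add: e_def m_assoc)
    finally show ?thesis by simp
  qed
  \<comment> \<open>\<open>aax\<close> says that conjugation by the square of \<open>a\<close> sends
    \<open>x\<close> to \<open>z\<close>; since the fourth power commutes with \<open>x\<close>, it
    also sends \<open>z\<close> back to \<open>x\<close>.\<close>
  have aaz: "a \<otimes> (a \<otimes> z) = x \<otimes> (a \<otimes> a)"
  proof -
    have "(a \<otimes> (a \<otimes> z)) \<otimes> (a \<otimes> a) = a \<otimes> (a \<otimes> (z \<otimes> (a \<otimes> a)))" by (simp add: m_assoc)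
    also have "\<dots> = c \<otimes> x" unfolding aax[symmetric] by (simp add: c_def m_assoc)
    also have "\<dots> = (x \<otimes> (a \<otimes> a)) \<otimes> (a \<otimes> a)" unfolding cx by (simp add: c_def m_assoc)
    finally show ?thesis by simp
  qed
  have eae: "e \<otimes> a \<otimes> e = a \<otimes> (x \<otimes> (z \<otimes> (a \<otimes> a)))"
    unfolding aax[symmetric] by (simp add: e_def m_assoc)
  have "a \<otimes> a \<otimes> (e \<otimes> a \<otimes> e) = a \<otimes> (a \<otimes> (a \<otimes> x)) \<otimes> (z \<otimes> (a \<otimes> a))"
    unfolding eae by (simp add: m_assoc)
  also have "\<dots> = a \<otimes> z \<otimes> (a \<otimes> (a \<otimes> z)) \<otimes> (a \<otimes> a)" unfolding aax by (simp add: m_assoc)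
  also have "\<dots> = a \<otimes> (z \<otimes> x) \<otimes> (a \<otimes> a) \<otimes> (a \<otimes> a)" unfolding aaz by (simp add: m_assoc)
  also have "\<dots> = e \<otimes> a \<otimes> e \<otimes> (a \<otimes> a)" unfolding eae xz[symmetric] by (simp add: m_assoc)
  finally show "a \<otimes> a \<otimes> (e \<otimes> a \<otimes> e) = e \<otimes> a \<otimes> e \<otimes> (a \<otimes> a)" .
qed

subsection \<open>The action of the braid group on four strands\<close>

definition coxaut :: "('a ucox \<Rightarrow> 'a ucox) monoid" where
  "coxaut = \<lparr>carrier = {f. bij f \<and> add_hom f}, mult = (\<circ>), one = id\<rparr>"

lemma coxaut_simps [simp]:
  "f \<in> carrier coxaut \<longleftrightarrow> bij f \<and> add_hom f" "mult coxaut = (\<circ>)" "one coxaut = id"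
  by (simp_all add: coxaut_def)

lemma group_coxaut: "group coxaut"
proof (rule groupI)
  fix f :: "'a ucox \<Rightarrow> 'a ucox" assume "f \<in> carrier coxaut"
  then have f: "bij f" "add_hom f" by simp_all
  have "add_hom (inv_into UNIV f)"
    using f unfolding add_hom_def by (metis bij_inv_eq_iff)
  then show "\<exists>g\<in>carrier coxaut. g \<otimes>\<^bsub>coxaut\<^esub> f = \<one>\<^bsub>coxaut\<^esub>"
    using f by (intro bexI[of _ "inv_into UNIV f"]) (simp_all add: bij_imp_bij_inv bij_is_inj)
qed (auto simp: bij_comp add_hom_comp add_hom_id comp_assoc)

text \<open>The first two are Hurwitz moves on the triple \<open>S2, S1, S3\<close> and preserve its
  product. The third is the first followed by the inner automorphism of \<open>elt [S3, S1]\<close>;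
  this extends the action from three strands to four and gives the outer generators the same
  matrix.\<close>

definition hurwitz :: "nat \<Rightarrow> letter ucox \<Rightarrow> letter ucox" where
  "hurwitz i = hom_ext (\<lambda>l.
     if i = 1 then (case l of S1 \<Rightarrow> elt [S1, S3, S1] | S2 \<Rightarrow> gen S2 | S3 \<Rightarrow> gen S1)
     else if i = 2 then (case l of S1 \<Rightarrow> gen S2 | S2 \<Rightarrow> elt [S2, S1, S2] | S3 \<Rightarrow> gen S3)
     else (case l of S1 \<Rightarrow> gen S3 | S2 \<Rightarrow> elt [S3, S1, S2, S1, S3] | S3 \<Rightarrow> elt [S3, S1, S3]))"

lemma add_hom_hurwitz: "add_hom (hurwitz i)"
  unfolding hurwitz_def by (rule add_hom_hom_ext) (simp add: add.assoc split: letter.split)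

lemma hurwitz_gen:
  "hurwitz 1 (gen S1) = elt [S1, S3, S1]" "hurwitz 1 (gen S2) = gen S2" "hurwitz 1 (gen S3) = gen S1"
  "hurwitz 2 (gen S1) = gen S2" "hurwitz 2 (gen S2) = elt [S2, S1, S2]" "hurwitz 2 (gen S3) = gen S3"
  "hurwitz 3 (gen S1) = gen S3" "hurwitz 3 (gen S2) = elt [S3, S1, S2, S1, S3]"
  "hurwitz 3 (gen S3) = elt [S3, S1, S3]"
  by (simp_all add: hurwitz_def)

lemmas hurwitz_add = add_hom_add[OF add_hom_hurwitz]

lemma hurwitz_relations:
  "hurwitz 1 \<circ> hurwitz 3 = hurwitz 3 \<circ> hurwitz 1"
  "hurwitz 1 \<circ> (hurwitz 2 \<circ> hurwitz 1) = hurwitz 2 \<circ> (hurwitz 1 \<circ> hurwitz 2)"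
  "hurwitz 2 \<circ> (hurwitz 3 \<circ> hurwitz 2) = hurwitz 3 \<circ> (hurwitz 2 \<circ> hurwitz 3)"
  "hurwitz 1 \<circ> (hurwitz 2 \<circ> hurwitz 3) = aut_a"
  "hurwitz 1 \<circ> (hurwitz 2 \<circ> hurwitz 3) \<circ> hurwitz 1 = aut_e"
proof -
  have *: "f = g" if "add_hom f" "add_hom g" "f (gen S1) = g (gen S1)" "f (gen S2) = g (gen S2)"
    "f (gen S3) = g (gen S3)" for f g :: "letter ucox \<Rightarrow> letter ucox"
    by (rule add_hom_eqI[OF that(1,2)]) (metis that(3-5) letter.exhaust)
  show "hurwitz 1 \<circ> hurwitz 3 = hurwitz 3 \<circ> hurwitz 1"
    by (rule *) (simp_all add: add_hom_comp add_hom_hurwitz hurwitz_add hurwitz_gen add.assoc del: One_nat_def)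
  show "hurwitz 1 \<circ> (hurwitz 2 \<circ> hurwitz 1) = hurwitz 2 \<circ> (hurwitz 1 \<circ> hurwitz 2)"
    by (rule *) (simp_all add: add_hom_comp add_hom_hurwitz hurwitz_add hurwitz_gen add.assoc del: One_nat_def)
  show "hurwitz 2 \<circ> (hurwitz 3 \<circ> hurwitz 2) = hurwitz 3 \<circ> (hurwitz 2 \<circ> hurwitz 3)"
    by (rule *) (simp_all add: add_hom_comp add_hom_hurwitz hurwitz_add hurwitz_gen add.assoc del: One_nat_def)
  show "hurwitz 1 \<circ> (hurwitz 2 \<circ> hurwitz 3) = aut_a"
    by (rule *) (simp_all add: add_hom_comp add_hom_aut add_hom_hurwitz hurwitz_add hurwitz_gen add.assoc del: One_nat_def)
  show "hurwitz 1 \<circ> (hurwitz 2 \<circ> hurwitz 3) \<circ> hurwitz 1 = aut_e"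
    by (rule *) (simp_all add: add_hom_comp add_hom_aut add_hom_hurwitz hurwitz_add hurwitz_gen add.assoc del: One_nat_def)
qed

text \<open>\<open>aut_a\<close> and \<open>aut_e\<close> are invertible because
  \<open>aut_e\<close> has order three and the square of \<open>aut_a\<close> is inner; the
  generators inherit this from the relations that express these two by them.\<close>

lemma bij_hurwitz: "i \<in> {1..<4} \<Longrightarrow> bij (hurwitz i)"
proof -
  define a' where "a' = inn (gen S1) \<circ> aut_a"
  have aa: "aut_a \<circ> a' = id" "a' \<circ> aut_a = id"
    by (auto simp: a'_def fun_eq_iff aut_inn aut_a_square inn_inn)
  have ba: "bij aut_a" by (rule o_bij[OF aa(2,1)])
  have "aut_e \<circ> (aut_e \<circ> aut_e) = id" "(aut_e \<circ> aut_e) \<circ> aut_e = id"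
    by (simp_all add: fun_eq_iff aut_e_cube)
  then have be: "bij aut_e" using o_bij by blast
  note cyc = hurwitz_relations
  have 1: "aut_a \<circ> hurwitz 1 = aut_e" using cyc(4,5) by simp
  then have "hurwitz 1 = a' \<circ> aut_e" using aa(2) by (metis comp_assoc id_comp)
  then have b1: "bij (hurwitz 1)" using be bij_comp o_bij[OF aa] by metis
  have conj: "bij g" if "f \<circ> g = h" "bij f" "bij h" for f g h :: "letter ucox \<Rightarrow> letter ucox"
  proof -
    have "g x = inv_into UNIV f (h x)" for x
      using that(1) bij_is_inj[OF that(2)] by (metis comp_apply inv_f_f)
    then have "g = inv_into UNIV f \<circ> h" by (simp add: fun_eq_iff)
    then show ?thesis using that bij_imp_bij_inv bij_comp by metis
  qed
  have "hurwitz 2 \<circ> aut_a = aut_a \<circ> hurwitz 1"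
    unfolding cyc(4)[symmetric] using cyc(1,2) by (metis comp_assoc)
  then have b2: "bij (hurwitz 2)"
    using ba b1 aa by (metis bij_comp comp_assoc comp_id o_bij)
  have b3: "bij (hurwitz 3)"
    using conj[of "hurwitz 1" "hurwitz 2 \<circ> hurwitz 3" aut_a] conj[of "hurwitz 2" "hurwitz 3"]
      cyc(4) b1 b2 ba by blast
  assume "i \<in> {1..<4}"
  then have "i = 1 \<or> i = 2 \<or> i = 3" by auto
  then show ?thesis using b1 b2 b3 by auto
qed

lemma hurwitz_coxaut: "i \<in> {1..<4} \<Longrightarrow> hurwitz i \<in> carrier coxaut"
  using bij_hurwitz add_hom_hurwitz by simp

section \<open>Homomorphisms out of the groups on three and four strands\<close>

abbreviation "B3 \<equiv> braid_group 3"
abbreviation "B4 \<equiv> braid_group 4"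

lemma braid_alpha_beta_eq:
  "braid_alpha 4 = braid_gen 4 1 \<otimes>\<^bsub>B4\<^esub> (braid_gen 4 2 \<otimes>\<^bsub>B4\<^esub> braid_gen 4 3)"
  "braid_beta 4 = braid_alpha 4 \<otimes>\<^bsub>B4\<^esub> braid_gen 4 1"
  "braid_alpha 3 = braid_gen 3 1 \<otimes>\<^bsub>B3\<^esub> braid_gen 3 2"
  "braid_beta 3 = braid_alpha 3 \<otimes>\<^bsub>B3\<^esub> braid_gen 3 1"
proof -
  interpret B4: group B4 by (rule group_braid_group)
  interpret B3: group B3 by (rule group_braid_group)
  have "[1..<4] = [1, 2, 3]" "[1..<3] = [1, 2::nat]" by (simp_all add: upt_rec)
  then show "braid_alpha 4 = braid_gen 4 1 \<otimes>\<^bsub>B4\<^esub> (braid_gen 4 2 \<otimes>\<^bsub>B4\<^esub> braid_gen 4 3)"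
    "braid_alpha 3 = braid_gen 3 1 \<otimes>\<^bsub>B3\<^esub> braid_gen 3 2"
    by (simp_all add: braid_alpha_def braid_gen_closed del: One_nat_def)
qed (simp_all add: braid_beta_def)

text \<open>Homomorphisms determined by their values on the generators, fixed here by name.
  \<open>deg\<close> and \<open>deg3\<close> are exponent sums, \<open>pr\<close> is the retraction
  of B_4 onto B_3 that identifies the outer generators, and \<open>flip\<close> is the mirror
  image.\<close>

locale braid3_to_4 =
  fixes act :: "nat gword set \<Rightarrow> letter ucox \<Rightarrow> letter ucox" and deg :: "nat gword set \<Rightarrow> int"
    and deg3 :: "nat gword set \<Rightarrow> int" and pr flip :: "nat gword set \<Rightarrow> nat gword set"
  assumes act_hom: "act \<in> hom B4 coxaut"
    and act_gen: "\<And>i. i \<in> {1..<4} \<Longrightarrow> act (braid_gen 4 i) = hurwitz i"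
    and deg_hom: "deg \<in> hom B4 integer_group"
    and deg_gen: "\<And>i. i \<in> {1..<4} \<Longrightarrow> deg (braid_gen 4 i) = 1"
    and deg3_hom: "deg3 \<in> hom B3 integer_group"
    and deg3_gen: "\<And>i. i \<in> {1..<3} \<Longrightarrow> deg3 (braid_gen 3 i) = 1"
    and pr_hom: "pr \<in> hom B4 B3"
    and pr_gen: "pr (braid_gen 4 1) = braid_gen 3 1" "pr (braid_gen 4 2) = braid_gen 3 2"
      "pr (braid_gen 4 3) = braid_gen 3 1"
    and flip_hom: "flip \<in> hom B4 B4"
    and flip_gen: "\<And>i. i \<in> {1..<4} \<Longrightarrow> flip (braid_gen 4 i) = inv\<^bsub>B4\<^esub> braid_gen 4 i"

lemma braid3_to_4_exists: "\<exists>act deg deg3 pr flip. braid3_to_4 act deg deg3 pr flip"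
proof -
  interpret B4: group B4 by (rule group_braid_group)
  interpret B3: group B3 by (rule group_braid_group)
  interpret cox: group coxaut by (rule group_coxaut)
  interpret int: group integer_group by simp
  have i4: "i \<in> {1..<4} \<longleftrightarrow> i = 1 \<or> i = 2 \<or> i = (3::nat)" for i by auto
  have i3: "i \<in> {1..<3} \<longleftrightarrow> i = 1 \<or> i = (2::nat)" for i by auto
  obtain act where act: "act \<in> hom B4 coxaut" "\<forall>i\<in>{1..<4}. act (braid_gen 4 i) = hurwitz i"
  proof -
    have "\<exists>\<Phi>\<in>hom B4 coxaut. \<forall>i\<in>{1..<4}. \<Phi> (braid_gen 4 i) = hurwitz i"
    proof (rule cox.braid_group_hom)
      fix i :: nat assume "i \<in> {1..<4}" "Suc i \<in> {1..<4}"
      then have "i = 1 \<or> i = 2" by auto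
      then show "hurwitz i \<otimes>\<^bsub>coxaut\<^esub> (hurwitz (Suc i) \<otimes>\<^bsub>coxaut\<^esub> hurwitz i) =
          hurwitz (Suc i) \<otimes>\<^bsub>coxaut\<^esub> (hurwitz i \<otimes>\<^bsub>coxaut\<^esub> hurwitz (Suc i))"
        using hurwitz_relations(2,3) by (auto simp: numeral_2_eq_2 numeral_3_eq_3)
    next
      fix i j :: nat assume "i \<in> {1..<4}" "j \<in> {1..<4}" "i + 2 \<le> j"
      then have "i = 1" "j = 3" by auto
      then show "hurwitz i \<otimes>\<^bsub>coxaut\<^esub> hurwitz j = hurwitz j \<otimes>\<^bsub>coxaut\<^esub> hurwitz i"
        using hurwitz_relations(1) by simp
    qed (rule hurwitz_coxaut)
    then show ?thesis using that by blast
  qed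
  have "\<exists>\<Phi>\<in>hom (braid_group n) integer_group. \<forall>i\<in>{1..<n}. \<Phi> (braid_gen n i) = 1" for n
    by (rule int.braid_group_hom) (simp_all add: integer_group_def)
  from this[of 4] this[of 3]
  obtain deg deg3 where deg: "deg \<in> hom B4 integer_group" "\<forall>i\<in>{1..<4}. deg (braid_gen 4 i) = 1"
    "deg3 \<in> hom B3 integer_group" "\<forall>i\<in>{1..<3}. deg3 (braid_gen 3 i) = 1"
    by metis
  have br3: "braid_gen 3 1 \<otimes>\<^bsub>B3\<^esub> (braid_gen 3 2 \<otimes>\<^bsub>B3\<^esub> braid_gen 3 1) =
      braid_gen 3 2 \<otimes>\<^bsub>B3\<^esub> (braid_gen 3 1 \<otimes>\<^bsub>B3\<^esub> braid_gen 3 2)"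
    using braid_gen_braid[of 1 3] braid_gen_closed[of 1 3] braid_gen_closed[of 2 3]
    by (simp add: B3.m_assoc numeral_2_eq_2)
  obtain pr where pr: "pr \<in> hom B4 B3" "\<forall>i\<in>{1..<4}. pr (braid_gen 4 i) = braid_gen 3 (if i = 2 then 2 else 1)"
  proof -
    have "\<exists>\<Phi>\<in>hom B4 B3. \<forall>i\<in>{1..<4}. \<Phi> (braid_gen 4 i) = braid_gen 3 (if i = 2 then 2 else 1)"
    proof (rule B3.braid_group_hom)
      fix i :: nat assume "i \<in> {1..<4}" "Suc i \<in> {1..<4}"
      then have "i = 1 \<or> i = 2" by auto
      then show "braid_gen 3 (if i = 2 then 2 else 1) \<otimes>\<^bsub>B3\<^esub>
         (braid_gen 3 (if Suc i = 2 then 2 else 1) \<otimes>\<^bsub>B3\<^esub> braid_gen 3 (if i = 2 then 2 else 1)) =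
         braid_gen 3 (if Suc i = 2 then 2 else 1) \<otimes>\<^bsub>B3\<^esub>
         (braid_gen 3 (if i = 2 then 2 else 1) \<otimes>\<^bsub>B3\<^esub> braid_gen 3 (if Suc i = 2 then 2 else 1))"
        using br3 by auto
    next
      fix i j :: nat assume "i \<in> {1..<4}" "j \<in> {1..<4}" "i + 2 \<le> j"
      then have "i = 1" "j = 3" by auto
      then show "braid_gen 3 (if i = 2 then 2 else 1) \<otimes>\<^bsub>B3\<^esub> braid_gen 3 (if j = 2 then 2 else 1) =
         braid_gen 3 (if j = 2 then 2 else 1) \<otimes>\<^bsub>B3\<^esub> braid_gen 3 (if i = 2 then 2 else 1)" by simp
    qed (simp add: braid_gen_closed del: One_nat_def)
    then show ?thesis using that by blast
  qed
  obtain flip where flip: "flip \<in> hom B4 B4" "\<forall>i\<in>{1..<4}. flip (braid_gen 4 i) = inv\<^bsub>B4\<^esub> braid_gen 4 i"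
  proof -
    have "\<exists>\<Phi>\<in>hom B4 B4. \<forall>i\<in>{1..<4}. \<Phi> (braid_gen 4 i) = inv\<^bsub>B4\<^esub> braid_gen 4 i"
    proof (rule B4.braid_group_hom)
      fix i :: nat assume i: "i \<in> {1..<4}" "Suc i \<in> {1..<4}"
      then show "inv\<^bsub>B4\<^esub> braid_gen 4 i \<otimes>\<^bsub>B4\<^esub> (inv\<^bsub>B4\<^esub> braid_gen 4 (Suc i) \<otimes>\<^bsub>B4\<^esub> inv\<^bsub>B4\<^esub> braid_gen 4 i) =
          inv\<^bsub>B4\<^esub> braid_gen 4 (Suc i) \<otimes>\<^bsub>B4\<^esub> (inv\<^bsub>B4\<^esub> braid_gen 4 i \<otimes>\<^bsub>B4\<^esub> inv\<^bsub>B4\<^esub> braid_gen 4 (Suc i))"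
        using arg_cong[OF braid_gen_braid[OF i], of "m_inv B4"] braid_gen_closed
        by (simp add: B4.inv_mult_group B4.m_assoc del: One_nat_def)
    next
      fix i j :: nat assume ij: "i \<in> {1..<4}" "j \<in> {1..<4}" "i + 2 \<le> j"
      then show "inv\<^bsub>B4\<^esub> braid_gen 4 i \<otimes>\<^bsub>B4\<^esub> inv\<^bsub>B4\<^esub> braid_gen 4 j =
         inv\<^bsub>B4\<^esub> braid_gen 4 j \<otimes>\<^bsub>B4\<^esub> inv\<^bsub>B4\<^esub> braid_gen 4 i"
        using arg_cong[OF braid_gen_commute[OF ij], of "m_inv B4"] braid_gen_closed
        by (simp add: B4.inv_mult_group del: One_nat_def)
    qed (simp add: braid_gen_closed del: One_nat_def)
    then show ?thesis using that by blast
  qed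
  have "braid3_to_4 act deg deg3 pr flip"
    using act deg pr flip by unfold_locales (simp_all del: One_nat_def)
  then show ?thesis by blast
qed

context braid3_to_4
begin

sublocale G: group B4 by (rule group_braid_group)
sublocale H: group B3 by (rule group_braid_group)
sublocale act: group_hom B4 coxaut act
  using act_hom group_coxaut by (simp add: group_hom_def group_hom_axioms_def)
sublocale deg: group_hom B4 integer_group deg
  using deg_hom by (simp add: group_hom_def group_hom_axioms_def)
sublocale deg3: group_hom B3 integer_group deg3
  using deg3_hom by (simp add: group_hom_def group_hom_axioms_def)
sublocale pr: group_hom B4 B3 pr
  using pr_hom by unfold_locales
sublocale flip: group_hom B4 B4 flip
  using flip_hom by unfold_locales
sublocale inc: group_hom B3 B4 "braid_inclusion 3 4"
  using braid_inclusion_hom[of 3 4] by unfold_locales simp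

abbreviation (input) mult4 (infixl "\<cdot>" 70) where "x \<cdot> y \<equiv> x \<otimes>\<^bsub>B4\<^esub> y"
abbreviation (input) inv4 ("inv4 _" [81] 80) where "inv4 x \<equiv> inv\<^bsub>B4\<^esub> x"
abbreviation s where "s i \<equiv> braid_gen 4 i"

lemma s_closed [simp]: "s 1 \<in> carrier B4" "s (Suc 0) \<in> carrier B4" "s 2 \<in> carrier B4" "s 3 \<in> carrier B4"
  using braid_gen_closed[of _ 4] by auto

lemma s_relations:
  "s 1 \<cdot> s 3 = s 3 \<cdot> s 1" "s 1 \<cdot> (s 2 \<cdot> s 1) = s 2 \<cdot> (s 1 \<cdot> s 2)"
  "s 2 \<cdot> (s 3 \<cdot> s 2) = s 3 \<cdot> (s 2 \<cdot> s 3)"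
proof -
  show "s 1 \<cdot> s 3 = s 3 \<cdot> s 1" using braid_gen_commute[of 1 4 3] by simp
  show "s 1 \<cdot> (s 2 \<cdot> s 1) = s 2 \<cdot> (s 1 \<cdot> s 2)"
    using braid_gen_braid[of 1 4] s_closed by (simp add: G.m_assoc numeral_2_eq_2)
  show "s 2 \<cdot> (s 3 \<cdot> s 2) = s 3 \<cdot> (s 2 \<cdot> s 3)"
    using braid_gen_braid[of 2 4] s_closed by (simp add: G.m_assoc numeral_3_eq_3 numeral_2_eq_2)
qed

abbreviation alpha where "alpha \<equiv> braid_alpha 4"
abbreviation beta where "beta \<equiv> braid_beta 4"

lemma alpha_beta_closed [simp]: "alpha \<in> carrier B4" "beta \<in> carrier B4"
  by (simp_all add: braid_alpha_beta_eq del: One_nat_def)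

lemmas alpha_beta =
  G.braid4_alpha_beta[OF s_closed(1,3,4) s_relations, folded braid_alpha_beta_eq]

lemma alpha_s1: "alpha \<cdot> s 1 = s 2 \<cdot> alpha"
  using alpha_beta(1) by (simp add: braid_alpha_beta_eq(2))

lemma generated: "carrier B4 \<subseteq> generate B4 {alpha, beta}"
proof -
  let ?K = "generate B4 {alpha, beta}"
  interpret K: subgroup ?K B4 by (rule G.generate_is_subgroup) simp
  have ab: "alpha \<in> ?K" "beta \<in> ?K" by (auto intro: generate.incl)
  have "s 1 = inv4 alpha \<cdot> beta" by (simp add: braid_alpha_beta_eq(2) del: One_nat_def)
  then have 1: "s 1 \<in> ?K" using ab by simp
  have "s 2 = alpha \<cdot> s 1 \<cdot> inv4 alpha"
    unfolding alpha_s1 by (simp add: G.m_assoc)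
  moreover have "s 3 = alpha \<cdot> s 2 \<cdot> inv4 alpha"
    unfolding alpha_beta(2) by (simp add: G.m_assoc)
  ultimately have "s 2 \<in> ?K" "s 3 \<in> ?K" using 1 ab by (metis K.m_closed K.m_inv_closed)+
  then have "braid_gen 4 ` {1..<4} \<subseteq> ?K" using 1 by (auto simp: atLeastLessThan_4 simp del: One_nat_def)
  then have "generate B4 (braid_gen 4 ` {1..<4}) \<subseteq> ?K"
    by (intro G.generate_subgroup_incl K.subgroup_axioms)
  then show ?thesis using braid_group_generated by blast
qed

sublocale b4: braid4 B4 alpha beta act deg
proof
  show "carrier B4 \<subseteq> generate B4 {alpha, beta}" by (rule generated)
  show "act (x \<cdot> y) = act x \<circ> act y" if "x \<in> carrier B4" "y \<in> carrier B4" for x y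
    using act.hom_mult[OF that] by simp
  show "act \<one>\<^bsub>B4\<^esub> = id" using act.hom_one by simp
  have "act alpha = hurwitz 1 \<circ> (hurwitz 2 \<circ> hurwitz 3)"
    by (simp add: braid_alpha_beta_eq act_gen del: One_nat_def)
  then show a: "act alpha = aut_a" by (simp add: hurwitz_relations del: One_nat_def)
  have "act beta = act alpha \<circ> hurwitz 1"
    by (simp add: braid_alpha_beta_eq(2) act_gen del: One_nat_def)
  then show "act beta = aut_e" using a hurwitz_relations(4,5) by simp
  show "deg (x \<cdot> y) = deg x + deg y" if "x \<in> carrier B4" "y \<in> carrier B4" for x y
    using deg.hom_mult[OF that] by (simp add: integer_group_def)
  then show "deg alpha = 3"
    by (simp add: braid_alpha_beta_eq deg_gen del: One_nat_def)
qed (use alpha_beta(3,4) in simp_all)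

end

section \<open>The group on three strands and its cyclic homomorphisms\<close>

lemma (in group) braid3_alpha_beta:
  assumes c [simp]: "x \<in> carrier G" "y \<in> carrier G" and xy: "x \<otimes> (y \<otimes> x) = y \<otimes> (x \<otimes> y)"
  shows "(x \<otimes> y) \<otimes> (x \<otimes> y) \<otimes> (x \<otimes> y) = (x \<otimes> y \<otimes> x) \<otimes> (x \<otimes> y \<otimes> x)"
    "(x \<otimes> y) \<otimes> x = y \<otimes> (x \<otimes> y)"
proof -
  show "(x \<otimes> y) \<otimes> x = y \<otimes> (x \<otimes> y)" using xy by (simp add: m_assoc)
  have "(x \<otimes> y) \<otimes> (x \<otimes> y) \<otimes> (x \<otimes> y) = x \<otimes> (y \<otimes> (x \<otimes> (y \<otimes> (x \<otimes> y))))" by (simp add: m_assoc)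
  also have "\<dots> = (x \<otimes> y \<otimes> x) \<otimes> (x \<otimes> y \<otimes> x)" unfolding xy[symmetric] by (simp add: m_assoc)
  finally show "(x \<otimes> y) \<otimes> (x \<otimes> y) \<otimes> (x \<otimes> y) = (x \<otimes> y \<otimes> x) \<otimes> (x \<otimes> y \<otimes> x)" .
qed

lemma (in group) conj_iso:
  assumes h: "h \<in> carrier G"
  shows "(\<lambda>x. h \<otimes> x \<otimes> inv h) \<in> iso G G"
proof -
  have "bij_betw (\<lambda>x. h \<otimes> x \<otimes> inv h) (carrier G) (carrier G)"
    by (rule bij_betw_byWitness[of _ "\<lambda>x. inv h \<otimes> x \<otimes> h"]) (use h in \<open>auto simp: m_assoc\<close>)
  then show ?thesis using h by (auto simp: iso_def hom_def m_assoc)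
qed

context braid3_to_4
begin

abbreviation mult3 (infixl "\<star>" 70) where "x \<star> y \<equiv> x \<otimes>\<^bsub>B3\<^esub> y"
abbreviation r where "r i \<equiv> braid_gen 3 i"
abbreviation alpha3 where "alpha3 \<equiv> braid_alpha 3"
abbreviation beta3 where "beta3 \<equiv> braid_beta 3"
abbreviation inc where "inc \<equiv> braid_inclusion 3 4"

lemma r_closed [simp]: "r 1 \<in> carrier B3" "r (Suc 0) \<in> carrier B3" "r 2 \<in> carrier B3"
  using braid_gen_closed[of _ 3] by auto

lemma alpha_beta3_closed [simp]: "alpha3 \<in> carrier B3" "beta3 \<in> carrier B3"
  by (simp_all add: braid_alpha_beta_eq del: One_nat_def)

lemma r_relation: "r 1 \<star> (r 2 \<star> r 1) = r 2 \<star> (r 1 \<star> r 2)"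
  using braid_gen_braid[of 1 3] r_closed by (simp add: H.m_assoc numeral_2_eq_2)

lemma alpha3_cube: "alpha3 \<star> alpha3 \<star> alpha3 = beta3 \<star> beta3"
  using H.braid3_alpha_beta(1)[OF r_closed(1,3) r_relation] by (simp add: braid_alpha_beta_eq del: One_nat_def)

lemma r1_eq: "r 1 = inv\<^bsub>B3\<^esub> alpha3 \<star> beta3"
  by (simp add: braid_alpha_beta_eq(4) del: One_nat_def)

lemma r2_eq: "r 2 = inv\<^bsub>B3\<^esub> (r 1) \<star> alpha3"
  by (simp add: braid_alpha_beta_eq(3) del: One_nat_def)

lemma hom_B3_eqI:
  assumes "group K" "f \<in> hom B3 K" "g \<in> hom B3 K"
    and ab: "f alpha3 = g alpha3" "f beta3 = g beta3" and "x \<in> carrier B3"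
  shows "f x = g x"
proof (rule braid_group_hom_eq[OF assms(1-3) _ assms(6)])
  interpret f: group_hom B3 K f using assms by (simp add: group_hom_def group_hom_axioms_def)
  interpret g: group_hom B3 K g using assms by (simp add: group_hom_def group_hom_axioms_def)
  have 1: "f (r 1) = g (r 1)" by (simp add: r1_eq ab del: One_nat_def)
  have "f (r 2) = g (r 2)" using 1 by (simp add: r2_eq ab del: One_nat_def)
  then show "f (r i) = g (r i)" if "i \<in> {1..<3}" for i
    using that 1 by (auto simp: atLeastLessThan_3 simp del: One_nat_def)
qed

lemma deg3_alpha_beta: "deg3 alpha3 = 2" "deg3 beta3 = 3"
  by (simp_all add: braid_alpha_beta_eq deg3_gen del: One_nat_def)

lemma pow_deg3_hom:
  assumes x: "x \<in> carrier B4"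
  shows "(\<lambda>y. x [^]\<^bsub>B4\<^esub> (m * deg3 y)) \<in> hom B3 B4"
  using x by (auto intro!: homI simp: ring_distribs G.int_pow_mult)

text \<open>The generators of B_3 are conjugate by \<open>alpha3\<close>, whose image commutes with
  \<open>S\<close>. Both therefore have the image \<open>S\<close>, and every element goes to
  \<open>S\<close> raised to its exponent sum.\<close>

lemma commuting_imp_cyclic:
  assumes \<phi>: "\<phi> \<in> hom B3 B4" and comm: "\<phi> alpha3 \<cdot> \<phi> beta3 = \<phi> beta3 \<cdot> \<phi> alpha3"
  shows "cyclic_hom B3 B4 \<phi>"
proof -
  interpret \<phi>: group_hom B3 B4 \<phi> using \<phi> by unfold_locales
  define S where "S = \<phi> (r 1)"
  have S: "S \<in> carrier B4" by (simp add: S_def)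
  have XS: "\<phi> alpha3 \<cdot> S = \<phi> beta3"
    by (simp add: S_def r1_eq flip: \<phi>.hom_mult del: One_nat_def)
  have SX: "S \<cdot> \<phi> alpha3 = \<phi> beta3"
  proof -
    have "S \<cdot> \<phi> alpha3 = inv4 (\<phi> alpha3) \<cdot> (\<phi> alpha3 \<cdot> \<phi> beta3)"
      by (simp add: S_def r1_eq comm G.m_assoc del: One_nat_def)
    then show ?thesis by simp
  qed
  have "r 2 = alpha3 \<star> r 1 \<star> inv\<^bsub>B3\<^esub> alpha3"
    using H.braid3_alpha_beta(2)[OF r_closed(1,3) r_relation]
    by (simp add: braid_alpha_beta_eq(3) H.m_assoc H.inv_mult_group del: One_nat_def)
  then have "\<phi> (r 2) = \<phi> alpha3 \<cdot> S \<cdot> inv4 (\<phi> alpha3)" by (simp add: S_def)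
  also have "\<dots> = S" unfolding XS SX[symmetric] using S by (simp add: G.m_assoc)
  finally have r2: "\<phi> (r 2) = S" .
  have pow: "\<phi> x = S [^]\<^bsub>B4\<^esub> (1 * deg3 x)" if "x \<in> carrier B3" for x
  proof (rule braid_group_hom_eq[OF G.is_group \<phi> pow_deg3_hom[OF S] _ that])
    fix i :: nat assume "i \<in> {1..<3}"
    then show "\<phi> (r i) = S [^]\<^bsub>B4\<^esub> (1 * deg3 (r i))"
      using r2 S by (auto simp: deg3_gen atLeastLessThan_3 S_def G.int_pow_1 simp del: One_nat_def)
  qed
  have sub: "subgroup (\<phi> ` carrier B3) B4" by (rule \<phi>.img_is_subgroup)
  interpret I: group "B4\<lparr>carrier := \<phi> ` carrier B3\<rparr>" using sub by (rule G.subgroup_imp_group)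
  have SI: "S \<in> \<phi> ` carrier B3" by (simp add: S_def)
  have "\<phi> ` carrier B3 = range (\<lambda>n::int. S [^]\<^bsub>B4\<^esub> n)"
  proof (intro equalityI subsetI)
    fix y assume "y \<in> range (\<lambda>n::int. S [^]\<^bsub>B4\<^esub> n)"
    then obtain n :: int where "y = S [^]\<^bsub>B4\<^esub> n" by blast
    then have "y = \<phi> (r 1 [^]\<^bsub>B3\<^esub> n)" by (simp add: S_def \<phi>.hom_int_pow del: One_nat_def)
    then show "y \<in> \<phi> ` carrier B3" by simp
  qed (use pow in auto)
  then have "carrier (B4\<lparr>carrier := \<phi> ` carrier B3\<rparr>) =
      range (\<lambda>n::int. S [^]\<^bsub>B4\<lparr>carrier := \<phi> ` carrier B3\<rparr>\<^esub> n)"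
    unfolding G.int_pow_consistent[OF sub SI, symmetric] by simp
  moreover have "S \<in> carrier (B4\<lparr>carrier := \<phi> ` carrier B3\<rparr>)" using SI by simp
  ultimately have "cyclic_group (B4\<lparr>carrier := \<phi> ` carrier B3\<rparr>)"
    unfolding I.cyclic_group by blast
  then show ?thesis using \<phi> by (simp add: cyclic_hom_def)
qed

section \<open>Standard forms and central twists\<close>

definition standard_form :: "(nat gword set \<Rightarrow> nat gword set) \<Rightarrow> bool" where
  "standard_form \<phi> \<longleftrightarrow>
    (\<exists>f \<in> hom B3 B4. \<exists>t \<in> hom B3 (B4\<lparr>carrier := center B4\<rparr>). \<exists>\<psi> \<in> iso B4 B4.
      (\<forall>x \<in> carrier B3. \<phi> x = \<psi> (transvection B4 f t x)) \<and>
      ((\<exists>\<epsilon> \<in> hom B3 B3. \<forall>x \<in> carrier B3. f x = inc (\<epsilon> x)) \<or>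
       (\<exists>g \<in> carrier B4. f alpha3 = g \<cdot> beta \<cdot> inv4 g \<and> f beta3 = alpha [^]\<^bsub>B4\<^esub> (2::nat))))"

abbreviation zeta where "zeta \<equiv> b4.zeta"

lemma zeta_pow_center: "zeta [^]\<^bsub>B4\<^esub> (k::int) \<in> center B4"
  using b4.zeta_pow_commute by (auto simp: center_def)

text \<open>The shape in which the cases arise: the automorphism is conjugation by \<open>h\<close>,
  and the transvection is a power of \<open>zeta\<close> governed by the exponent sum. The mirror
  image is added by \<open>standard_form_flip\<close>.\<close>

lemma standard_formI:
  assumes f: "f \<in> hom B3 B4" and h: "h \<in> carrier B4"
    and \<phi>: "\<And>x. x \<in> carrier B3 \<Longrightarrow> \<phi> x = h \<cdot> (f x \<cdot> zeta [^]\<^bsub>B4\<^esub> (m * deg3 x)) \<cdot> inv4 h"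
    and form: "(\<exists>\<epsilon> \<in> hom B3 B3. \<forall>x \<in> carrier B3. f x = inc (\<epsilon> x)) \<or>
       (\<exists>g \<in> carrier B4. f alpha3 = g \<cdot> beta \<cdot> inv4 g \<and> f beta3 = alpha [^]\<^bsub>B4\<^esub> (2::nat))"
  shows "standard_form \<phi>"
proof -
  let ?t = "\<lambda>x. zeta [^]\<^bsub>B4\<^esub> (m * deg3 x)"
  have "?t \<in> hom B3 (B4\<lparr>carrier := center B4\<rparr>)"
    using pow_deg3_hom[OF b4.zeta_closed, of m] zeta_pow_center by (auto simp: hom_def)
  moreover have "\<forall>x\<in>carrier B3. \<phi> x = (\<lambda>y. h \<cdot> y \<cdot> inv4 h) (transvection B4 f ?t x)"
    using \<phi> by (simp add: transvection_def)
  ultimately show ?thesis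
    unfolding standard_form_def using f G.conj_iso[OF h] form
    by (intro bexI[of _ f] bexI[of _ ?t] bexI[of _ "\<lambda>y. h \<cdot> y \<cdot> inv4 h"] conjI)
qed

lemma twist_hom:
  assumes \<phi>: "\<phi> \<in> hom B3 B4" and h: "h \<in> carrier B4"
  shows "(\<lambda>x. inv4 h \<cdot> \<phi> x \<cdot> h \<cdot> zeta [^]\<^bsub>B4\<^esub> (m * deg3 x)) \<in> hom B3 B4"
proof (rule homI)
  interpret \<phi>: group_hom B3 B4 \<phi> using \<phi> by unfold_locales
  fix x y assume xy: "x \<in> carrier B3" "y \<in> carrier B3"
  let ?z = "\<lambda>x. zeta [^]\<^bsub>B4\<^esub> (m * deg3 x)"
  have "inv4 h \<cdot> \<phi> x \<cdot> h \<cdot> ?z x \<cdot> (inv4 h \<cdot> \<phi> y \<cdot> h \<cdot> ?z y)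
      = (inv4 h \<cdot> \<phi> x \<cdot> h) \<cdot> (?z x \<cdot> (inv4 h \<cdot> \<phi> y \<cdot> h)) \<cdot> ?z y"
    using xy h by (simp add: G.m_assoc)
  also have "\<dots> = (inv4 h \<cdot> \<phi> x \<cdot> h) \<cdot> ((inv4 h \<cdot> \<phi> y \<cdot> h) \<cdot> ?z x) \<cdot> ?z y"
    using xy h by (subst b4.zeta_pow_commute) simp_all
  also have "\<dots> = inv4 h \<cdot> (\<phi> x \<cdot> \<phi> y) \<cdot> h \<cdot> (?z x \<cdot> ?z y)"
    using xy h by (simp add: G.m_assoc)
  also have "\<dots> = inv4 h \<cdot> \<phi> (x \<star> y) \<cdot> h \<cdot> ?z (x \<star> y)"
    using xy by (simp add: ring_distribs G.int_pow_mult)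
  finally show "inv4 h \<cdot> \<phi> (x \<star> y) \<cdot> h \<cdot> ?z (x \<star> y) =
      inv4 h \<cdot> \<phi> x \<cdot> h \<cdot> ?z x \<cdot> (inv4 h \<cdot> \<phi> y \<cdot> h \<cdot> ?z y)" ..
next
  interpret \<phi>: group_hom B3 B4 \<phi> using \<phi> by unfold_locales
  show "inv4 h \<cdot> \<phi> x \<cdot> h \<cdot> zeta [^]\<^bsub>B4\<^esub> (m * deg3 x) \<in> carrier B4" if "x \<in> carrier B3" for x
    using that h by simp
qed

lemma conj_zeta_cancel:
  assumes "h \<in> carrier B4" "y \<in> carrier B4"
  shows "inv4 h \<cdot> (zeta [^]\<^bsub>B4\<^esub> (k::int) \<cdot> y) \<cdot> h \<cdot> zeta [^]\<^bsub>B4\<^esub> (- k) = inv4 h \<cdot> y \<cdot> h"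
proof -
  have "inv4 h \<cdot> (zeta [^]\<^bsub>B4\<^esub> k \<cdot> y) = zeta [^]\<^bsub>B4\<^esub> k \<cdot> (inv4 h \<cdot> y)"
    using assms by (intro b4.zeta_pow_lcomm) simp_all
  then have "inv4 h \<cdot> (zeta [^]\<^bsub>B4\<^esub> k \<cdot> y) \<cdot> h = zeta [^]\<^bsub>B4\<^esub> k \<cdot> (inv4 h \<cdot> y \<cdot> h)"
    using assms by (simp add: G.m_assoc)
  moreover have "(zeta [^]\<^bsub>B4\<^esub> k \<cdot> (inv4 h \<cdot> y \<cdot> h)) \<cdot> zeta [^]\<^bsub>B4\<^esub> (- k) =
      zeta [^]\<^bsub>B4\<^esub> (- k) \<cdot> (zeta [^]\<^bsub>B4\<^esub> k \<cdot> (inv4 h \<cdot> y \<cdot> h))"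
    using assms by (intro b4.zeta_pow_commute) simp
  ultimately show ?thesis
    using assms b4.zeta_pow_mult_assoc[of "inv4 h \<cdot> y \<cdot> h" "- k" k] by simp
qed

lemma hom_cube_square:
  assumes "\<phi> \<in> hom B3 B4"
  shows "\<phi> alpha3 \<cdot> \<phi> alpha3 \<cdot> \<phi> alpha3 = \<phi> beta3 \<cdot> \<phi> beta3"
proof -
  interpret \<phi>: group_hom B3 B4 \<phi> using assms by unfold_locales
  show ?thesis using arg_cong[OF alpha3_cube, of \<phi>] by simp
qed

lemma deg_cube_square:
  assumes "\<phi> \<in> hom B3 B4"
  shows "3 * deg (\<phi> alpha3) = 2 * deg (\<phi> beta3)"
proof -
  interpret \<phi>: group_hom B3 B4 \<phi> using assms by unfold_locales
  show ?thesis using arg_cong[OF hom_cube_square[OF assms], of deg] by (simp add: b4.deg_mult)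
qed

text \<open>Since \<open>alpha3\<close> and \<open>beta3\<close> have exponent sums 2 and 3, central
  exponents \<open>k\<close> and \<open>l\<close> of this form belong to the homomorphism with
  exponent \<open>m * deg3 x\<close>.\<close>

lemma three_two_int:
  assumes "3 * k = 2 * (l::int)"
  obtains m where "k = 2 * m" "l = 3 * m"
proof
  show "k = 2 * (k div 2)" "l = 3 * (k div 2)" using assms by presburger+
qed

lemma periodic_standard_form:
  assumes \<phi>: "\<phi> \<in> hom B3 B4" and g: "g \<in> carrier B4" "h \<in> carrier B4"
    and X: "b4.zeq (\<phi> alpha3) (g \<cdot> beta \<cdot> inv4 g)" and Y: "b4.zeq (\<phi> beta3) (h \<cdot> (alpha \<cdot> alpha) \<cdot> inv4 h)"
  shows "standard_form \<phi>"
proof -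
  interpret \<phi>: group_hom B3 B4 \<phi> using \<phi> by unfold_locales
  obtain k l :: int where k: "\<phi> alpha3 = zeta [^]\<^bsub>B4\<^esub> k \<cdot> (g \<cdot> beta \<cdot> inv4 g)"
    and l: "\<phi> beta3 = zeta [^]\<^bsub>B4\<^esub> l \<cdot> (h \<cdot> (alpha \<cdot> alpha) \<cdot> inv4 h)"
    using X Y by (auto simp: b4.zeq_def)
  have "deg beta = 4" using braid_alpha_beta_eq(2) deg_gen[of 1] b4.deg_a by (simp add: b4.deg_mult)
  \<comment> \<open>The degrees are 12 for \<open>zeta\<close>, 4 for \<open>beta\<close> and 6 for
    the square of \<open>alpha\<close>; as 3 times 4 equals 2 times 6, the constants drop out of the
    degree equation.\<close>
  then have "deg (\<phi> alpha3) = 12 * k + 4" "deg (\<phi> beta3) = 12 * l + 6"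
    unfolding k l using g by (simp_all add: b4.deg_mult b4.deg_inv b4.deg_zeta_pow b4.deg_a)
  then have "3 * k = 2 * l" using deg_cube_square[OF \<phi>] by simp
  then obtain m where m: "k = 2 * m" "l = 3 * m" by (rule three_two_int)
  define f where "f x = inv4 h \<cdot> \<phi> x \<cdot> h \<cdot> zeta [^]\<^bsub>B4\<^esub> ((- m) * deg3 x)" for x
  have f: "f \<in> hom B3 B4" unfolding f_def by (rule twist_hom[OF \<phi> g(2)])
  have "f alpha3 = inv4 h \<cdot> (g \<cdot> beta \<cdot> inv4 g) \<cdot> h"
    using conj_zeta_cancel[of h "g \<cdot> beta \<cdot> inv4 g" k] g
    by (simp add: f_def k m deg3_alpha_beta mult.commute)
  then have form: "f alpha3 = (inv4 h \<cdot> g) \<cdot> beta \<cdot> inv4 (inv4 h \<cdot> g)"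
    using g by (simp add: G.m_assoc G.inv_mult_group)
  have "f beta3 = inv4 h \<cdot> (h \<cdot> (alpha \<cdot> alpha) \<cdot> inv4 h) \<cdot> h"
    using conj_zeta_cancel[of h "h \<cdot> (alpha \<cdot> alpha) \<cdot> inv4 h" l] g
    by (simp add: f_def l m deg3_alpha_beta mult.commute)
  then have "f beta3 = alpha \<cdot> alpha" using g by (simp add: G.m_assoc)
  then have form2: "f beta3 = alpha [^]\<^bsub>B4\<^esub> (2::nat)" by (simp add: numeral_2_eq_2)
  have "\<phi> x = h \<cdot> (f x \<cdot> zeta [^]\<^bsub>B4\<^esub> (m * deg3 x)) \<cdot> inv4 h" if "x \<in> carrier B3" for x
    using that g by (simp add: f_def G.m_assoc b4.zeta_pow_mult)
  then show ?thesis using form form2 f g by (intro standard_formI[OF f g(2)]) auto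
qed

subsection \<open>The automorphism inverting the generators\<close>

lemma flip_flip: "x \<in> carrier B4 \<Longrightarrow> flip (flip x) = x"
proof -
  assume x: "x \<in> carrier B4"
  have "(flip \<circ> flip) x = id x"
  proof (rule braid_group_hom_eq[OF G.is_group _ _ _ x])
    show "flip \<circ> flip \<in> hom B4 B4" by (rule hom_compose[OF flip_hom flip_hom])
    show "id \<in> hom B4 B4" by (auto simp: hom_def)
    fix i :: nat assume "i \<in> {1..<4}"
    then show "(flip \<circ> flip) (s i) = id (s i)" using braid_gen_closed[of i 4] by (simp add: flip_gen)
  qed
  then show ?thesis by simp
qed

lemma flip_iso: "flip \<in> iso B4 B4"
  unfolding iso_def using flip_hom flip_flip
  by (auto intro!: bij_betw_byWitness[of _ flip])

lemma standard_form_flip: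
  assumes \<phi>: "\<phi> \<in> hom B3 B4" and "standard_form (flip \<circ> \<phi>)"
  shows "standard_form \<phi>"
proof -
  interpret \<phi>: group_hom B3 B4 \<phi> using \<phi> by unfold_locales
  obtain f t \<psi> where *: "f \<in> hom B3 B4" "t \<in> hom B3 (B4\<lparr>carrier := center B4\<rparr>)" "\<psi> \<in> iso B4 B4"
      "\<forall>x \<in> carrier B3. (flip \<circ> \<phi>) x = \<psi> (transvection B4 f t x)"
      "(\<exists>\<epsilon> \<in> hom B3 B3. \<forall>x \<in> carrier B3. f x = inc (\<epsilon> x)) \<or>
       (\<exists>g \<in> carrier B4. f alpha3 = g \<cdot> beta \<cdot> inv4 g \<and> f beta3 = alpha [^]\<^bsub>B4\<^esub> (2::nat))"
    using assms(2) unfolding standard_form_def by blast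
  have "flip \<circ> \<psi> \<in> iso B4 B4" using *(3) flip_iso by (rule iso_set_trans)
  moreover have "\<phi> x = (flip \<circ> \<psi>) (transvection B4 f t x)" if "x \<in> carrier B3" for x
    using *(4) that flip_flip[of "\<phi> x"] by simp
  ultimately show ?thesis unfolding standard_form_def using *(1,2,5) by blast
qed

text \<open>The inverse of the mirror image is \<open>alpha\<close> read backwards,
  \<open>s 3 \<cdot> (s 2 \<cdot> s 1)\<close>. As \<open>s 1\<close> and \<open>s 3\<close>
  commute, conjugation by \<open>s 3 \<cdot> inv4 (s 1)\<close> exchanges the outer letters of
  \<open>alpha\<close>.\<close>

lemma flip_alpha: "flip alpha = (s 3 \<cdot> inv4 (s 1)) \<cdot> inv4 alpha \<cdot> inv4 (s 3 \<cdot> inv4 (s 1))"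
proof -
  have "inv4 (flip alpha) = s 3 \<cdot> (s 2 \<cdot> s 1)"
    by (simp add: braid_alpha_beta_eq(1) flip_gen G.inv_mult_group G.m_assoc del: One_nat_def)
  also have "\<dots> = (s 3 \<cdot> inv4 (s 1)) \<cdot> alpha \<cdot> inv4 (s 3 \<cdot> inv4 (s 1))"
  proof -
    have "(s 3 \<cdot> inv4 (s 1)) \<cdot> alpha \<cdot> inv4 (s 3 \<cdot> inv4 (s 1)) = s 3 \<cdot> (s 2 \<cdot> ((s 3 \<cdot> s 1) \<cdot> inv4 (s 3)))"
      by (simp add: braid_alpha_beta_eq(1) G.inv_mult_group G.m_assoc del: One_nat_def)
    also have "\<dots> = s 3 \<cdot> (s 2 \<cdot> s 1)"
      unfolding s_relations(1)[symmetric] by (simp add: G.m_assoc del: One_nat_def)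
    finally show ?thesis ..
  qed
  finally have "inv4 (inv4 (flip alpha)) = inv4 ((s 3 \<cdot> inv4 (s 1)) \<cdot> alpha \<cdot> inv4 (s 3 \<cdot> inv4 (s 1)))"
    by simp
  then show ?thesis by (simp add: G.inv_mult_group G.m_assoc del: One_nat_def)
qed

lemma flip_beta: "flip (inv4 beta) = s 3 \<cdot> beta \<cdot> inv4 (s 3)"
proof -
  have "flip (inv4 beta) = s 1 \<cdot> (s 3 \<cdot> (s 2 \<cdot> s 1))"
    by (simp add: braid_alpha_beta_eq flip_gen G.inv_mult_group G.m_assoc del: One_nat_def)
  also have "\<dots> = (s 1 \<cdot> s 3) \<cdot> (s 2 \<cdot> s 1)" by (simp add: G.m_assoc del: One_nat_def)
  also have "\<dots> = s 3 \<cdot> (s 1 \<cdot> (s 2 \<cdot> ((s 1 \<cdot> s 3) \<cdot> inv4 (s 3))))"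
  proof -
    have "(s 1 \<cdot> s 3) \<cdot> inv4 (s 3) = s 1" by (simp add: G.m_assoc del: One_nat_def)
    then show ?thesis unfolding s_relations(1) by (simp add: G.m_assoc del: One_nat_def)
  qed
  also have "\<dots> = s 3 \<cdot> (s 1 \<cdot> (s 2 \<cdot> ((s 3 \<cdot> s 1) \<cdot> inv4 (s 3))))"
    unfolding s_relations(1) ..
  also have "\<dots> = s 3 \<cdot> beta \<cdot> inv4 (s 3)"
    by (simp add: braid_alpha_beta_eq G.m_assoc del: One_nat_def)
  finally show ?thesis .
qed

lemma flip_aa: "b4.zeq (flip (alpha \<cdot> alpha))
  ((s 3 \<cdot> inv4 (s 1)) \<cdot> (alpha \<cdot> alpha) \<cdot> inv4 (s 3 \<cdot> inv4 (s 1)))"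
proof -
  define q where "q = s 3 \<cdot> inv4 (s 1)"
  have q: "q \<in> carrier B4" by (simp add: q_def del: One_nat_def)
  have fa: "flip alpha = q \<cdot> inv4 alpha \<cdot> inv4 q" unfolding q_def by (rule flip_alpha)
  have "flip (alpha \<cdot> alpha) = q \<cdot> inv4 (alpha \<cdot> alpha) \<cdot> inv4 q"
    using q by (simp add: fa G.m_assoc G.inv_mult_group)
  also have "inv4 (alpha \<cdot> alpha) = zeta [^]\<^bsub>B4\<^esub> (- 1 :: int) \<cdot> (alpha \<cdot> alpha)"
    by (simp add: G.int_pow_neg G.int_pow_1 b4.zeta_def G.inv_mult_group G.m_assoc)
  finally have "flip (alpha \<cdot> alpha) = q \<cdot> (zeta [^]\<^bsub>B4\<^esub> (- 1 :: int) \<cdot> ((alpha \<cdot> alpha) \<cdot> inv4 q))"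
    using q by (simp add: G.m_assoc)
  also have "\<dots> = zeta [^]\<^bsub>B4\<^esub> (- 1 :: int) \<cdot> (q \<cdot> (alpha \<cdot> alpha) \<cdot> inv4 q)"
    using q by (subst b4.zeta_pow_lcomm) (simp_all add: G.m_assoc)
  finally show ?thesis unfolding q_def b4.zeq_def by blast
qed

lemma flip_zeta: "flip (zeta [^]\<^bsub>B4\<^esub> (k::int)) = zeta [^]\<^bsub>B4\<^esub> (- k)"
proof -
  define q where "q = s 3 \<cdot> inv4 (s 1)"
  have q: "q \<in> carrier B4" by (simp add: q_def del: One_nat_def)
  have fa: "flip alpha = q \<cdot> inv4 alpha \<cdot> inv4 q" unfolding q_def by (rule flip_alpha)
  have "flip zeta = q \<cdot> inv4 zeta \<cdot> inv4 q"
    using q by (simp add: b4.zeta_def fa G.m_assoc G.inv_mult_group)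
  also have "\<dots> = inv4 zeta"
    using q b4.zeta_pow_commute[OF q, of "- 1"] by (simp add: G.int_pow_neg G.int_pow_1 G.m_assoc)
  finally have "flip (zeta [^]\<^bsub>B4\<^esub> k) = (inv4 zeta) [^]\<^bsub>B4\<^esub> k" by (simp add: flip.hom_int_pow)
  then show ?thesis by (simp add: G.int_pow_neg G.int_pow_inv)
qed

lemma flip_zeq:
  assumes "b4.zeq x y" "y \<in> carrier B4"
  shows "b4.zeq (flip x) (flip y)"
proof -
  obtain k :: int where "x = zeta [^]\<^bsub>B4\<^esub> k \<cdot> y" using assms(1) by (auto simp: b4.zeq_def)
  then have "flip x = zeta [^]\<^bsub>B4\<^esub> (- k) \<cdot> flip y" using assms(2) by (simp add: flip_zeta)
  then show ?thesis by (auto simp: b4.zeq_def)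
qed

text \<open>The mirror image carries the inverse of \<open>beta\<close> to a conjugate of
  \<open>beta\<close>, and the square of \<open>alpha\<close> to a conjugate of itself up to the
  center, which reduces this case to \<open>periodic_standard_form\<close>.\<close>

lemma periodic_standard_form_neg:
  assumes \<phi>: "\<phi> \<in> hom B3 B4" and g: "g \<in> carrier B4" "h \<in> carrier B4"
    and X: "b4.zeq (\<phi> alpha3) (g \<cdot> inv4 beta \<cdot> inv4 g)" and Y: "b4.zeq (\<phi> beta3) (h \<cdot> (alpha \<cdot> alpha) \<cdot> inv4 h)"
  shows "standard_form \<phi>"
proof (rule standard_form_flip[OF \<phi>], rule periodic_standard_form)
  define q where "q = s 3 \<cdot> inv4 (s 1)"
  have q: "q \<in> carrier B4" by (simp add: q_def del: One_nat_def)
  show "flip \<circ> \<phi> \<in> hom B3 B4" using \<phi> flip_hom by (rule hom_compose)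
  show "flip g \<cdot> s 3 \<in> carrier B4" "flip h \<cdot> q \<in> carrier B4" using g q by simp_all
  have "b4.zeq (flip (\<phi> alpha3)) (flip (g \<cdot> inv4 beta \<cdot> inv4 g))"
    using flip_zeq[OF X] g by simp
  also have "flip (g \<cdot> inv4 beta \<cdot> inv4 g) = flip g \<cdot> flip (inv4 beta) \<cdot> inv4 (flip g)"
    using g by simp
  also have "\<dots> = (flip g \<cdot> s 3) \<cdot> beta \<cdot> inv4 (flip g \<cdot> s 3)"
    using g unfolding flip_beta by (simp add: G.m_assoc G.inv_mult_group)
  finally show "b4.zeq ((flip \<circ> \<phi>) alpha3) ((flip g \<cdot> s 3) \<cdot> beta \<cdot> inv4 (flip g \<cdot> s 3))" by simp
  have "b4.zeq (flip (\<phi> beta3)) (flip (h \<cdot> (alpha \<cdot> alpha) \<cdot> inv4 h))"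
    using flip_zeq[OF Y] g by simp
  also have "flip (h \<cdot> (alpha \<cdot> alpha) \<cdot> inv4 h) = flip h \<cdot> flip (alpha \<cdot> alpha) \<cdot> inv4 (flip h)"
    using g by simp
  finally have 1: "b4.zeq (flip (\<phi> beta3)) (flip h \<cdot> flip (alpha \<cdot> alpha) \<cdot> inv4 (flip h))" .
  have "b4.zeq (flip h \<cdot> flip (alpha \<cdot> alpha) \<cdot> inv4 (flip h))
      (flip h \<cdot> (q \<cdot> (alpha \<cdot> alpha) \<cdot> inv4 q) \<cdot> inv4 (flip h))"
    using g q flip_aa[folded q_def] by (intro b4.zeq_mult) simp_all
  from b4.zeq_trans[OF 1 this] show "b4.zeq ((flip \<circ> \<phi>) beta3)
      ((flip h \<cdot> q) \<cdot> (alpha \<cdot> alpha) \<cdot> inv4 (flip h \<cdot> q))"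
    using g q by (simp add: G.m_assoc G.inv_mult_group)
qed

subsection \<open>The centralizer of delta\<close>

abbreviation delta where "delta \<equiv> b4.delta"

lemma pr_inc: "x \<in> carrier B3 \<Longrightarrow> pr (inc x) = x"
proof -
  assume x: "x \<in> carrier B3"
  have "(pr \<circ> inc) x = id x"
  proof (rule braid_group_hom_eq[OF H.is_group _ _ _ x])
    show "pr \<circ> inc \<in> hom B3 B3" using inc.homh pr_hom by (rule hom_compose)
    show "id \<in> hom B3 B3" by (auto simp: hom_def)
    fix i :: nat assume i: "i \<in> {1..<3}"
    then have "inc (r i) = s i" using braid_inclusion_gen[of 3 4 i] by (simp del: One_nat_def)
    then show "(pr \<circ> inc) (r i) = id (r i)" using i pr_gen by (auto simp: atLeastLessThan_3 simp del: One_nat_def)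
  qed
  then show ?thesis by simp
qed

lemma inc_r: "inc (r 1) = s 1" "inc (r 2) = s 2"
  using braid_inclusion_gen[of 3 4] by simp_all

lemma act_s: "act (s 1) = hurwitz 1" "act (s 2) = hurwitz 2" "act (s 3) = hurwitz 3"
  using act_gen by simp_all

lemma hurwitz_delta: "hurwitz 1 delta = delta" "hurwitz 2 delta = delta"
  by (simp_all add: hurwitz_add hurwitz_gen add.assoc del: One_nat_def)

lemma act_inc_delta:
  assumes "x \<in> carrier B3"
  shows "act (inc x) delta = delta"
proof -
  have "x \<in> generate B3 (r ` {1..<3})" using assms braid_group_generated by blast
  then have "x \<in> carrier B3 \<and> act (inc x) delta = delta"
  proof (induction rule: generate.induct)
    case one
    then show ?case by simp
  next
    case (incl h)
    then show ?case using inc_r hurwitz_delta by (auto simp: act_s atLeastLessThan_3 simp del: One_nat_def elt_simps)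
  next
    case (inv h)
    then have h: "h \<in> carrier B3" "act (inc h) delta = delta"
      using inc_r hurwitz_delta by (auto simp: act_s atLeastLessThan_3 simp del: One_nat_def elt_simps)
    then show ?case using b4.act_inv_act(1)[of "inc h" delta] by (simp del: elt_simps)
  next
    case (eng h1 h2)
    then show ?case by (simp add: b4.act_mult_apply del: elt_simps)
  qed
  then show ?thesis by simp
qed

text \<open>\<open>s 1\<close> and \<open>s 3\<close> have the same matrix, so identifying them, as
  \<open>pr\<close> does, is invisible to matrices.\<close>

lemma mg_inc_pr:
  assumes "x \<in> carrier B4"
  shows "b4.mg (inc (pr x)) = b4.mg x"
proof -
  have gens: "b4.mg (inc (pr (s i))) = b4.mg (s i)" if "i \<in> {1..<4}" for i
  proof -
    have "b4.mg (s 1) = b4.mg (s 3)"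
      by (simp add: b4.mg_def act_s mat_def hurwitz_add hurwitz_gen altu_add del: One_nat_def)
    then show ?thesis using that by (auto simp: atLeastLessThan_4 pr_gen inc_r simp del: One_nat_def)
  qed
  have mg_inv_eq: "b4.mg (inv4 y) = b4.mg (inv4 x)" if "x \<in> carrier B4" "y \<in> carrier B4" "b4.mg y = b4.mg x" for x y
  proof -
    have "b4.mg (inv4 y) = b4.mg (inv4 y) * (b4.mg x * b4.mg (inv4 x))"
      using that(1) b4.mg_inv(1) by simp
    also have "\<dots> = b4.mg (inv4 y) * b4.mg y * b4.mg (inv4 x)"
      using that(3) by (simp add: mult.assoc)
    also have "\<dots> = b4.mg (inv4 x)" using that(2) b4.mg_inv(2) by simp
    finally show ?thesis .
  qed
  have "x \<in> generate B4 (s ` {1..<4})" using assms braid_group_generated by blast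
  then have "x \<in> carrier B4 \<and> b4.mg (inc (pr x)) = b4.mg x"
  proof (induction rule: generate.induct)
    case (incl h)
    then show ?case using gens braid_gen_closed by auto
  next
    case (inv h)
    then have "h \<in> carrier B4" "b4.mg (inc (pr h)) = b4.mg h" using gens braid_gen_closed by auto
    then show ?case using mg_inv_eq[of h "inc (pr h)"] by simp
  next
    case (eng h1 h2)
    then show ?case by (simp add: b4.mg_mult)
  qed simp
  then show ?thesis by simp
qed

definition full_twist where "full_twist = inc (alpha3 \<star> alpha3 \<star> alpha3)"

lemma full_twist_closed [simp]: "full_twist \<in> carrier B4"
  by (simp add: full_twist_def)

lemma act_full_twist: "act full_twist = inn delta"
proof -
  have "act (inc alpha3) = hurwitz 1 \<circ> hurwitz 2"
    by (simp add: braid_alpha_beta_eq inc_r act_s del: One_nat_def)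
  then have "act full_twist = (hurwitz 1 \<circ> hurwitz 2) \<circ> (hurwitz 1 \<circ> hurwitz 2) \<circ> (hurwitz 1 \<circ> hurwitz 2)"
    by (simp add: full_twist_def)
  also have "\<dots> = inn delta"
  proof (rule add_hom_eqI)
    fix l show "((hurwitz 1 \<circ> hurwitz 2) \<circ> (hurwitz 1 \<circ> hurwitz 2) \<circ> (hurwitz 1 \<circ> hurwitz 2)) (gen l) = inn delta (gen l)"
      by (cases l) (simp_all add: hurwitz_add hurwitz_gen inn_def minus_add add.assoc
        del: One_nat_def add_uminus_conv_diff)
  qed (intro add_hom_comp add_hom_hurwitz add_hom_inn)+
  finally show ?thesis .
qed

lemma act_full_twist_pow: "act (full_twist [^]\<^bsub>B4\<^esub> (n::nat)) = inn (ntimes n delta)"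
proof (induction n)
  case 0
  show ?case by (simp add: fun_eq_iff)
next
  case (Suc n)
  have "ntimes n delta + delta = ntimes (Suc n) delta" using ntimes_add[of n 1 delta] by simp
  then show ?case using Suc by (simp add: fun_eq_iff b4.act_mult_apply act_full_twist inn_inn del: elt_simps sum_list.Cons)
qed

lemma ntimes_delta_nonzero: "n > 0 \<Longrightarrow> ntimes n delta \<noteq> 0"
proof
  assume n: "n > 0" and 0: "ntimes n delta = 0"
  have "word delta = [] @ [S2, S1, S3] @ rev []" by (simp add: word_elt del: elt_simps)
  then have "word (ntimes n delta) = [] @ concat (replicate n [S2, S1, S3]) @ rev []"
    using n by (intro word_ntimes_core) (simp_all add: cyc_red_def)
  then show False using 0 n by (simp add: concat_replicate_eq_Nil_iff del: elt_simps)
qed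

text \<open>Dividing \<open>x\<close> by \<open>inc (pr x)\<close> leaves an element of trivial
  matrix, which acts as \<open>inn u\<close>. Both factors fix \<open>delta\<close>, so
  \<open>u\<close> commutes with it and is a multiple of \<open>delta\<close> by
  \<open>centralizer_elt3\<close>; such inner automorphisms are powers of the full twist on three
  strands.\<close>

lemma stabilizer_delta:
  assumes x: "x \<in> carrier B4" and fixed: "act x delta = delta"
  shows "\<exists>c\<in>carrier B3. b4.zeq x (inc c)"
proof -
  define b where "b = inc (pr x)"
  have b: "b \<in> carrier B4" using x by (simp add: b_def)
  have "b4.mg (x \<cdot> inv4 b) = b4.mg b * b4.mg (inv4 b)"
    using x b mg_inc_pr[OF x] by (simp add: b4.mg_mult b_def)
  then have "b4.mg (x \<cdot> inv4 b) = 1" using b b4.mg_inv by simp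
  then have "x \<cdot> inv4 b \<in> b4.K" using x b by (intro b4.mg_scalar_imp_K) simp_all
  then obtain u where u: "act (x \<cdot> inv4 b) = inn u" using b4.K_inner by blast
  have "act (inv4 b) delta = delta"
    using b4.act_inv_act(1)[OF b, of delta] act_inc_delta[of "pr x"] x by (simp add: b_def del: elt_simps)
  then have "inn u delta = delta"
    using x b fixed by (simp add: b4.act_mult_apply del: elt_simps flip: u)
  then have "u + delta = delta + u" by (simp add: inn_eq_self_iff)
  then obtain n where n: "u = ntimes n delta \<or> u = - ntimes n delta"
    using centralizer_elt3[of S2 S1 S3 u] by auto
  define w where "w = (if u = ntimes n delta then full_twist [^]\<^bsub>B4\<^esub> n else inv4 (full_twist [^]\<^bsub>B4\<^esub> n))"
  have w: "w \<in> carrier B4" by (simp add: w_def)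
  have "act (inv4 (full_twist [^]\<^bsub>B4\<^esub> n)) v = inn (- ntimes n delta) v" for v
    using b4.act_inv_act(1)[of "full_twist [^]\<^bsub>B4\<^esub> n" "inn (- ntimes n delta) v"]
    by (simp add: act_full_twist_pow del: elt_simps)
  then have "act w = inn u" using n by (auto simp: w_def act_full_twist_pow fun_eq_iff)
  then have "b4.zeq (x \<cdot> inv4 b) w" using x b w u by (intro b4.act_eq_imp_zeq) simp_all
  then have "b4.zeq (x \<cdot> inv4 b \<cdot> b) (w \<cdot> b)" using b w by (intro b4.zeq_mult) simp_all
  then have xw: "b4.zeq x (w \<cdot> b)" using x b by (simp add: G.m_assoc)
  define c0 where "c0 = alpha3 \<star> alpha3 \<star> alpha3"
  define c where "c = (if u = ntimes n delta then c0 [^]\<^bsub>B3\<^esub> n else inv\<^bsub>B3\<^esub> (c0 [^]\<^bsub>B3\<^esub> n)) \<star> pr x"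
  have c0: "c0 \<in> carrier B3" by (simp add: c0_def)
  have "inc (c0 [^]\<^bsub>B3\<^esub> n) = full_twist [^]\<^bsub>B4\<^esub> n"
    using c0 by (simp only: inc.hom_nat_pow full_twist_def c0_def)
  then have "inc c = w \<cdot> b" using c0 x by (simp add: c_def w_def b_def)
  then show ?thesis using xw c0 x by (intro bexI[of _ c]) (simp_all add: c_def)
qed

text \<open>Projecting by \<open>pr\<close> shows that \<open>c\<close> is the \<open>m\<close>-th
  power of \<open>pr zeta\<close>, whose inclusion is the square of the full twist. Its powers act
  by even multiples of \<open>delta\<close>, while \<open>zeta\<close> acts trivially.\<close>

lemma zeta_inc_trivial:
  assumes c: "c \<in> carrier B3" and eq: "zeta [^]\<^bsub>B4\<^esub> (m::int) = inc c"
  shows "m = 0"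
proof -
  define d where "d = pr zeta"
  have d: "d \<in> carrier B3" by (simp add: d_def)
  have "c = d [^]\<^bsub>B3\<^esub> m"
    using arg_cong[OF eq, of pr] pr_inc[OF c] by (simp add: pr.hom_int_pow d_def)
  then have zm: "zeta [^]\<^bsub>B4\<^esub> m = inc d [^]\<^bsub>B4\<^esub> m" using eq d by (simp add: inc.hom_int_pow)
  have "pr alpha = beta3"
    by (simp add: braid_alpha_beta_eq pr_gen H.m_assoc del: One_nat_def)
  then have "d = (beta3 \<star> beta3) \<star> (beta3 \<star> beta3)" by (simp add: d_def b4.zeta_def)
  then have id: "inc d = full_twist \<cdot> full_twist" by (simp add: full_twist_def alpha3_cube)
  have actd: "act (inc d [^]\<^bsub>B4\<^esub> n) = inn (ntimes (2 * n) delta)" for n :: nat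
  proof -
    have "inc d [^]\<^bsub>B4\<^esub> n = full_twist [^]\<^bsub>B4\<^esub> (2 * n)"
      using G.nat_pow_pow[of full_twist 2 n] by (simp add: id numeral_2_eq_2)
    then show ?thesis by (simp add: act_full_twist_pow del: elt_simps)
  qed
  obtain n where n: "m = int n \<or> m = - int n" by (cases m rule: int_cases2) auto
  have "zeta [^]\<^bsub>B4\<^esub> (int n) = inc d [^]\<^bsub>B4\<^esub> (int n)"
    using n
  proof
    assume "m = - int n"
    then have "inv4 (zeta [^]\<^bsub>B4\<^esub> (int n)) = inv4 (inc d [^]\<^bsub>B4\<^esub> (int n))"
      using zm d by (simp add: G.int_pow_neg)
    then show ?thesis using d by (metis G.inv_inv G.int_pow_closed inc.hom_closed b4.zeta_closed)
  qed (use zm in simp)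
  then have "act (inc d [^]\<^bsub>B4\<^esub> n) = id"
    using b4.act_zeta_pow[of "int n"] by (simp add: int_pow_int)
  then have "ntimes (2 * n) delta = 0" using b4.inn_eq_id_iff actd by simp
  then have "n = 0" using ntimes_delta_nonzero[of "2 * n"] by (cases n) auto
  then show ?thesis using n by auto
qed

text \<open>After conjugation both images are products of a power of \<open>zeta\<close> and an
  element of the included B_3. These two factors are independent by \<open>zeta_inc_trivial\<close>,
  so the central parts form a twist and the other parts an endomorphism.\<close>

lemma reducible_standard_form:
  assumes \<phi>: "\<phi> \<in> hom B3 B4" and h: "h \<in> carrier B4"
    and fixed: "act (inv4 h \<cdot> \<phi> alpha3 \<cdot> h) delta = delta" "act (inv4 h \<cdot> \<phi> beta3 \<cdot> h) delta = delta"
  shows "standard_form \<phi>"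
proof -
  interpret \<phi>: group_hom B3 B4 \<phi> using \<phi> by unfold_locales
  define X where "X = inv4 h \<cdot> \<phi> alpha3 \<cdot> h"
  define Y where "Y = inv4 h \<cdot> \<phi> beta3 \<cdot> h"
  have XY: "X \<in> carrier B4" "Y \<in> carrier B4" using h by (simp_all add: X_def Y_def)
  obtain a' b' where ab: "a' \<in> carrier B3" "b' \<in> carrier B3" "b4.zeq X (inc a')" "b4.zeq Y (inc b')"
    using stabilizer_delta XY fixed unfolding X_def Y_def by metis
  obtain k l :: int where k: "X = zeta [^]\<^bsub>B4\<^esub> k \<cdot> inc a'" and l: "Y = zeta [^]\<^bsub>B4\<^esub> l \<cdot> inc b'"
    using ab by (auto simp: b4.zeq_def)
  have "X \<cdot> X \<cdot> X = inv4 h \<cdot> (\<phi> alpha3 \<cdot> \<phi> alpha3 \<cdot> \<phi> alpha3) \<cdot> h"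
    using h by (simp add: X_def G.m_assoc)
  also have "\<dots> = Y \<cdot> Y" using h unfolding hom_cube_square[OF \<phi>] by (simp add: Y_def G.m_assoc)
  finally have eq: "X \<cdot> X \<cdot> X = Y \<cdot> Y" .
  have "X \<cdot> X \<cdot> X = zeta [^]\<^bsub>B4\<^esub> (3 * k) \<cdot> inc (a' \<star> a' \<star> a')"
  proof -
    have "X \<cdot> X = zeta [^]\<^bsub>B4\<^esub> (k + k) \<cdot> (inc a' \<cdot> inc a')"
      unfolding k using ab by (simp add: G.m_assoc b4.zeta_pow_lcomm[of "inc a'" "inc a'"] b4.zeta_pow_mult_assoc)
    then have "X \<cdot> X \<cdot> X = zeta [^]\<^bsub>B4\<^esub> (k + k) \<cdot> ((inc a' \<cdot> inc a') \<cdot> (zeta [^]\<^bsub>B4\<^esub> k \<cdot> inc a'))"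
      unfolding k using ab by (simp add: G.m_assoc)
    also have "(inc a' \<cdot> inc a') \<cdot> (zeta [^]\<^bsub>B4\<^esub> k \<cdot> inc a') = zeta [^]\<^bsub>B4\<^esub> k \<cdot> (inc a' \<cdot> inc a' \<cdot> inc a')"
      using ab by (intro b4.zeta_pow_lcomm) simp_all
    finally show ?thesis using ab by (simp add: b4.zeta_pow_mult_assoc)
  qed
  moreover have "Y \<cdot> Y = zeta [^]\<^bsub>B4\<^esub> (2 * l) \<cdot> inc (b' \<star> b')"
    unfolding l using ab by (simp add: G.m_assoc b4.zeta_pow_lcomm[of "inc b'" "inc b'"] b4.zeta_pow_mult_assoc)
  ultimately have eq2: "zeta [^]\<^bsub>B4\<^esub> (3 * k) \<cdot> inc (a' \<star> a' \<star> a') = zeta [^]\<^bsub>B4\<^esub> (2 * l) \<cdot> inc (b' \<star> b')"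
    using eq by simp
  define A3 where "A3 = a' \<star> a' \<star> a'"
  define B2 where "B2 = b' \<star> b'"
  have AB: "A3 \<in> carrier B3" "B2 \<in> carrier B3" using ab by (simp_all add: A3_def B2_def)
  \<comment> \<open>All central factors are brought to one side, so that
    \<open>zeta_inc_trivial\<close> forces the exponent to vanish.\<close>
  have "zeta [^]\<^bsub>B4\<^esub> (3 * k - 2 * l) = inc (B2 \<star> inv\<^bsub>B3\<^esub> A3)"
  proof -
    have "zeta [^]\<^bsub>B4\<^esub> (- (2 * l)) \<cdot> (zeta [^]\<^bsub>B4\<^esub> (3 * k) \<cdot> inc A3) =
        zeta [^]\<^bsub>B4\<^esub> (- (2 * l)) \<cdot> (zeta [^]\<^bsub>B4\<^esub> (2 * l) \<cdot> inc B2)"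
      using eq2 by (simp only: A3_def B2_def)
    then have "zeta [^]\<^bsub>B4\<^esub> (3 * k - 2 * l) \<cdot> inc A3 = inc B2"
      using AB by (simp add: b4.zeta_pow_mult_assoc)
    then have "zeta [^]\<^bsub>B4\<^esub> (3 * k - 2 * l) \<cdot> inc A3 \<cdot> inv4 (inc A3) = inc B2 \<cdot> inv4 (inc A3)" by simp
    then show ?thesis using AB by (simp add: G.m_assoc)
  qed
  then have "3 * k - 2 * l = 0" using zeta_inc_trivial AB by (metis H.inv_closed H.m_closed)
  then have kl: "3 * k = 2 * l" by simp
  then obtain m where m: "k = 2 * m" "l = 3 * m" by (rule three_two_int)
  have "inc A3 = inc B2" using eq2 AB unfolding kl A3_def[symmetric] B2_def[symmetric] by simp
  then have a3b2: "a' \<star> a' \<star> a' = b' \<star> b'" using AB pr_inc unfolding A3_def B2_def by metis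
  define x where "x = inv\<^bsub>B3\<^esub> a' \<star> b'"
  define y where "y = a' \<star> x \<star> inv\<^bsub>B3\<^esub> a'"
  have xy: "x \<in> carrier B3" "y \<in> carrier B3" using ab by (simp_all add: x_def y_def)
  have ax: "a' \<star> x = b'" using ab by (simp add: x_def)
  have xya: "x \<star> y = a'"
  proof -
    have "x \<star> y = inv\<^bsub>B3\<^esub> a' \<star> (b' \<star> b') \<star> inv\<^bsub>B3\<^esub> a'" using ab by (simp add: x_def y_def H.m_assoc)
    then show ?thesis using ab unfolding a3b2[symmetric] by (simp add: H.m_assoc)
  qed
  have "x \<star> (y \<star> x) = y \<star> (x \<star> y)"
  proof -
    have "x \<star> (y \<star> x) = a' \<star> x" using xy xya by (simp flip: H.m_assoc)
    also have "\<dots> = y \<star> a'" using ab xy by (simp add: y_def H.m_assoc)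
    finally show ?thesis using xya by simp
  qed
  note br = this
  define hh where "hh i = (if i = 1 then x else y)" for i :: nat
  have "\<exists>\<epsilon>\<in>hom B3 B3. \<forall>i\<in>{1..<3}. \<epsilon> (r i) = hh i"
  proof (rule H.braid_group_hom)
    fix i :: nat assume "i \<in> {1..<3}" "Suc i \<in> {1..<3}"
    then have "i = 1" by auto
    then show "hh i \<star> (hh (Suc i) \<star> hh i) = hh (Suc i) \<star> (hh i \<star> hh (Suc i))"
      using br by (simp add: hh_def)
  qed (use xy in \<open>auto simp: hh_def\<close>)
  then obtain \<epsilon> where \<epsilon>: "\<epsilon> \<in> hom B3 B3" "\<epsilon> (r 1) = x" "\<epsilon> (r 2) = y" by (auto simp: hh_def atLeastLessThan_3)
  interpret \<epsilon>: group_hom B3 B3 \<epsilon> using \<epsilon>(1) by unfold_locales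
  have \<epsilon>a: "\<epsilon> alpha3 = a'" using xya \<epsilon> by (simp add: braid_alpha_beta_eq del: One_nat_def)
  have \<epsilon>b: "\<epsilon> beta3 = b'" using ax \<epsilon> \<epsilon>a by (simp add: braid_alpha_beta_eq(4) del: One_nat_def)
  define f where "f = inc \<circ> \<epsilon>"
  have f: "f \<in> hom B3 B4" unfolding f_def using \<epsilon>(1) inc.homh by (rule hom_compose)
  define \<psi> where "\<psi> u = inv4 h \<cdot> \<phi> u \<cdot> h \<cdot> zeta [^]\<^bsub>B4\<^esub> ((- m) * deg3 u)" for u
  have \<psi>: "\<psi> \<in> hom B3 B4" unfolding \<psi>_def by (rule twist_hom[OF \<phi> h])
  have "\<psi> u = f u" if "u \<in> carrier B3" for u
  proof (rule hom_B3_eqI[OF G.is_group \<psi> f _ _ that])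
    have "\<psi> alpha3 = zeta [^]\<^bsub>B4\<^esub> (- k) \<cdot> X"
      using h b4.zeta_pow_commute[OF XY(1)] by (simp add: \<psi>_def X_def[symmetric] deg3_alpha_beta m mult.commute)
    then show "\<psi> alpha3 = f alpha3" using ab by (simp add: k f_def \<epsilon>a b4.zeta_pow_mult_assoc)
    have "\<psi> beta3 = zeta [^]\<^bsub>B4\<^esub> (- l) \<cdot> Y"
      using h b4.zeta_pow_commute[OF XY(2)] by (simp add: \<psi>_def Y_def[symmetric] deg3_alpha_beta m mult.commute)
    then show "\<psi> beta3 = f beta3" using ab by (simp add: l f_def \<epsilon>b b4.zeta_pow_mult_assoc)
  qed
  then have "\<phi> u = h \<cdot> (f u \<cdot> zeta [^]\<^bsub>B4\<^esub> (m * deg3 u)) \<cdot> inv4 h" if "u \<in> carrier B3" for u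
  proof -
    have "f u = inv4 h \<cdot> \<phi> u \<cdot> h \<cdot> zeta [^]\<^bsub>B4\<^esub> ((- m) * deg3 u)"
      using \<open>\<And>u. u \<in> carrier B3 \<Longrightarrow> \<psi> u = f u\<close>[OF that] by (simp add: \<psi>_def)
    then show ?thesis using that h by (simp add: G.m_assoc b4.zeta_pow_mult)
  qed
  moreover have "\<exists>\<epsilon>\<in>hom B3 B3. \<forall>x\<in>carrier B3. f x = inc (\<epsilon> x)"
    using \<epsilon>(1) by (auto simp: f_def)
  ultimately show ?thesis using standard_formI[OF f h] by blast
qed

lemma noncyclic_standard_form:
  assumes \<phi>: "\<phi> \<in> hom B3 B4" and nc: "\<not> cyclic_hom B3 B4 \<phi>"
  shows "standard_form \<phi>"
proof -
  interpret \<phi>: group_hom B3 B4 \<phi> using \<phi> by unfold_locales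
  have XY: "\<phi> alpha3 \<in> carrier B4" "\<phi> beta3 \<in> carrier B4" by simp_all
  note eq = hom_cube_square[OF \<phi>]
  show ?thesis
  proof (cases "b4.mg (\<phi> alpha3) * b4.mg (\<phi> beta3) = b4.mg (\<phi> beta3) * b4.mg (\<phi> alpha3)")
    case True
    then show ?thesis
      using b4.commuting_case[OF XY eq] commuting_imp_cyclic[OF \<phi>] nc
        periodic_standard_form[OF \<phi>] periodic_standard_form_neg[OF \<phi>] by blast
  next
    case False
    then show ?thesis
      using b4.noncommuting_case[OF XY eq] reducible_standard_form[OF \<phi>] by blast
  qed
qed

end

theorem theorem5p1:
  fixes \<phi> :: "nat gword set \<Rightarrow> nat gword set"
  assumes "\<phi> \<in> hom (braid_group 3) (braid_group 4)"
    and "\<not> cyclic_hom (braid_group 3) (braid_group 4) \<phi>"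
  shows "\<exists>f \<in> hom (braid_group 3) (braid_group 4).
         \<exists>t \<in> hom (braid_group 3) ((braid_group 4)\<lparr>carrier := center (braid_group 4)\<rparr>).
         \<exists>\<psi> \<in> iso (braid_group 4) (braid_group 4).
           (\<forall>x \<in> carrier (braid_group 3). \<phi> x = \<psi> (transvection (braid_group 4) f t x)) \<and>
           ((\<exists>\<epsilon> \<in> hom (braid_group 3) (braid_group 3).
               \<forall>x \<in> carrier (braid_group 3). f x = braid_inclusion 3 4 (\<epsilon> x)) \<or>
            (\<exists>g \<in> carrier (braid_group 4).
               f (braid_alpha 3) =
                 g \<otimes>\<^bsub>braid_group 4\<^esub> braid_beta 4 \<otimes>\<^bsub>braid_group 4\<^esub> inv\<^bsub>braid_group 4\<^esub> g \<and>
               f (braid_beta 3) = braid_alpha 4 [^]\<^bsub>braid_group 4\<^esub> (2::nat)))"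
proof -
  obtain act deg deg3 pr flip where "braid3_to_4 act deg deg3 pr flip"
    using braid3_to_4_exists by blast
  then interpret braid3_to_4 act deg deg3 pr flip .
  show ?thesis using noncyclic_standard_form[OF assms] unfolding standard_form_def .
qed

end
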